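(* Let $0<p\le1$ and $C<\infty$. The function $\mathscr{L}^p_C\times\mathbb{R}\ni(\mu,E)\mapsto L_1(\mu,E)$ is locally Hölder continuous with respect to the Wasserstein metric $W_p$ on $\mathscr{L}^p_C$ (and the usual metric on $\mathbb{R}$).
   Context: $\mathscr{L}^p_C$ is the space of non-compactly supported Borel probability measures $\mu$ on $\mathbb{R}$ satisfying $\int_{\mathbb{R}}|x|^p\,d\mu(x)\le C$, with the Wasserstein metric $W_p(\mu,\nu)=\inf_\pi\iint|x-y|^p\,d\pi(x,y)$, the infimum over all couplings $\pi$ of $\mu$ and $\nu$. Let $\Omega=\mathbb{R}^{\mathbb{Z}}$ with shift $\sigma$ and Bernoulli measure $\mathbb{P}_\mu=\mu^{\mathbb{Z}}$, let $\mathscr{V}(\omega)=\omega_0$, and for $E\in\mathbb{R}$ let $A_E:\Omega\to\mathrm{SL}_2(\mathbb{R})$, $$A_E(\omega)=\begin{bmatrix}\mathscr{V}(\omega)-E&-1\\1&0\end{bmatrix}.$$ $L_1(\mu,E)$ is the first Lyapunov exponent: the $\mathbb{P}_\mu$-almost sure limit of $\frac1n\log\|A_E(\sigma^{n-1}\omega)\cdots A_E(\sigma\omega)A_E(\omega)\|$. *)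

theory Defs
  imports "HOL-Probability.Probability"
begin

definition msupport :: "real measure \<Rightarrow> real set" where
  "msupport \<mu> = {x. \<forall>U. open U \<longrightarrow> x \<in> U \<longrightarrow> emeasure \<mu> U > 0}"

definition Lp_measures :: "real \<Rightarrow> real \<Rightarrow> real measure set" where
  "Lp_measures p C = {\<mu>. sets \<mu> = sets borel \<and> prob_space \<mu> \<and> \<not> compact (msupport \<mu>) \<and>
     (\<integral>\<^sup>+ x. ennreal (\<bar>x\<bar> powr p) \<partial>\<mu>) \<le> ennreal C}"

definition couplings :: "real measure \<Rightarrow> real measure \<Rightarrow> (real \<times> real) measure set" where
  "couplings \<mu> \<nu> = {\<pi>. sets \<pi> = sets (borel \<Otimes>\<^sub>M borel) \<and>
     distr \<pi> borel fst = \<mu> \<and> distr \<pi> borel snd = \<nu>}"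

text \<open>There is no \<open>p\<close>-th root: for \<open>0 < p \<le> 1\<close> the transport cost itself is a metric.
  The infimum is taken in the extended nonnegative reals; on \<open>Lp_measures p C\<close> it is finite
  (the product coupling has cost at most \<open>2 * C\<close>), so \<open>enn2real\<close> loses nothing there.\<close>

definition wasserstein :: "real \<Rightarrow> real measure \<Rightarrow> real measure \<Rightarrow> real" where
  "wasserstein p \<mu> \<nu> =
     enn2real (INF \<pi>\<in>couplings \<mu> \<nu>. \<integral>\<^sup>+ z. ennreal (\<bar>fst z - snd z\<bar> powr p) \<partial>\<pi>)"

definition bernoulli :: "real measure \<Rightarrow> (int \<Rightarrow> real) measure" where
  "bernoulli \<mu> = PiM UNIV (\<lambda>_. \<mu>)"

definition shift :: "(int \<Rightarrow> real) \<Rightarrow> (int \<Rightarrow> real)" where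
  "shift \<omega> = (\<lambda>k. \<omega> (k + 1))"

definition potential :: "(int \<Rightarrow> real) \<Rightarrow> real" where
  "potential \<omega> = \<omega> 0"

definition schroedinger :: "real \<Rightarrow> (int \<Rightarrow> real) \<Rightarrow> real^2^2" where
  "schroedinger E \<omega> = vector [vector [potential \<omega> - E, -1], vector [1, 0]]"

primrec iterate :: "real \<Rightarrow> nat \<Rightarrow> (int \<Rightarrow> real) \<Rightarrow> real^2^2" where
  "iterate E 0 \<omega> = mat 1"
| "iterate E (Suc n) \<omega> = schroedinger E ((shift ^^ n) \<omega>) ** iterate E n \<omega>"

text \<open>The almost sure limit is unique because \<open>bernoulli \<mu>\<close> is a probability measure; it exists
  by the Furstenberg--Kesten theorem whenever \<open>log (1 + \<bar>x\<bar>)\<close> is \<open>\<mu>\<close>-integrable, hence for all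
  \<open>\<mu> \<in> Lp_measures p C\<close> with \<open>p > 0\<close>.\<close>

definition lyapunov :: "real measure \<Rightarrow> real \<Rightarrow> real" where
  "lyapunov \<mu> E = (THE L. AE \<omega> in bernoulli \<mu>.
     (\<lambda>n. ln (onorm (\<lambda>v. iterate E n \<omega> *v v)) / real n) \<longlonglongrightarrow> L)"

definition locally_hoelder_on ::
  "'a set \<Rightarrow> ('a \<Rightarrow> 'a \<Rightarrow> real) \<Rightarrow> ('a \<Rightarrow> real) \<Rightarrow> bool" where
  "locally_hoelder_on X d f \<longleftrightarrow>
     (\<forall>x\<in>X. \<exists>r>0. \<exists>\<alpha>>0. \<exists>K. \<alpha> \<le> 1 \<and>
        (\<forall>y\<in>X. \<forall>z\<in>X. d x y < r \<longrightarrow> d x z < r \<longrightarrow> \<bar>f y - f z\<bar> \<le> K * d y z powr \<alpha>))"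

end

theory Submission
  imports Defs
begin

text \<open>
  The energy is absorbed into the potential by replacing \<open>\<mu>\<close> by the law of \<open>x - E\<close>, so that only the
  random walk \<open>v \<mapsto> (x a - b, a)\<close>, \<open>v = (a, b)\<close>, on the plane has to be studied, with constants that
  depend on the law only through a moment bound and through the mass it gives to three intervals far
  apart from each other.  A measure whose support is not compact has such intervals, and they keep
  their mass under small perturbations in the Wasserstein metric; this is why the constants are
  uniform in a neighbourhood.

  \<^bold>\<open>Growth.\<close>  In the chart \<open>t \<mapsto> (t, 1)\<close> a step acts on functions of degree \<open>-1\<close>, unitarily on
  \<open>L\<^sup>2\<close> of the line, as a translation followed by the inversion \<open>t \<mapsto> -1/t\<close>.  An averaged translation
  loses norm unless the function has little mass on every bounded interval of fixed length, and the
  inversion exchanges \<open>[-1, 1]\<close> with its complement; hence two averaged steps contract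
  (\<open>sqmass_avg_inversion_avg\<close>).  So \<open>1/\<parallel>A\<^sup>n u\<parallel>\<close> has exponentially small mean for some direction \<open>u\<close>,
  and \<open>E ln \<parallel>A\<^sup>n u\<parallel>\<close> grows linearly (\<open>lognorm_somewhere\<close>).  To pass from one direction to all of them,
  let the first step of a given vector take three well separated values: a matrix of determinant one
  that is large contracts at most one of three separated directions, and shrinks that one by at most
  the reciprocal of its norm, so that the three logarithms together are at least the logarithm of
  the norm (\<open>three_vectors\<close>).  This gives \<open>E ln (\<parallel>A\<^sup>n v\<parallel> / \<parallel>v\<parallel>) \<ge> c n - D\<close> for all \<open>v\<close>
  (\<open>gain_lower_bound\<close>).

  \<^bold>\<open>Contraction.\<close>  Expanding \<open>\<parallel>A\<^sup>m v\<parallel>\<^sup>-\<^sup>s\<close> to second order in a small \<open>s\<close> shows that its mean is at most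
  \<open>\<gamma> \<parallel>v\<parallel>\<^sup>-\<^sup>s\<close> with \<open>\<gamma> < 1\<close>.  Since the action of a matrix on the projective line changes distances by
  the factor \<open>\<parallel>v\<parallel>\<parallel>w\<parallel> / (\<parallel>A v\<parallel>\<parallel>A w\<parallel>)\<close>, a power of the averaging operator \<open>Q\<close> contracts Hoelder seminorms, and
  the iterates of the drift \<open>E ln (\<parallel>A v\<parallel>/\<parallel>v\<parallel>)\<close> under \<open>Q\<close> converge to a constant, geometrically
  (\<open>Qn_drift_hoelder\<close>, \<open>Qn_drift_limit\<close>).  The same second order expansion bounds exponential
  moments of \<open>ln \<parallel>A\<^sup>n v\<parallel> - n L\<close>, and a Borel--Cantelli argument identifies the constant \<open>L\<close> with the
  Lyapunov exponent (\<open>lyapunov_eq_exponent\<close>).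

  \<^bold>\<open>Comparison.\<close>  Run two walks with coupled steps \<open>x\<close> and \<open>y\<close>.  One step moves a common vector to two
  directions at distance at most \<open>\<bar>x - y\<bar>\<close>, and an error made \<open>k\<close> steps before the end is damped like
  \<open>\<gamma>\<^sup>k\<close>.  Summing the geometric series bounds the difference of the exponents by
  \<open>E \<bar>x - y\<bar>\<^sup>\<alpha>\<close>, and this by a power of the transport cost (\<open>exponent_diff_le_cost\<close>).
\<close>

section \<open>A spectral gap for translations and the inversion of the line\<close>

lemma ennreal_weighted_amgm:
  fixes a b :: ennreal
  assumes "0 < k" "0 < l" "1 \<le> 4 * k * l"
  shows "a * b \<le> ennreal k * a\<^sup>2 + ennreal l * b\<^sup>2"
proof (cases "a = \<top> \<or> b = \<top>")
  case True
  then have "ennreal k * a\<^sup>2 + ennreal l * b\<^sup>2 = \<top>"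
    using assms by (auto simp: power2_eq_square ennreal_mult_eq_top_iff)
  then show ?thesis by (simp only: top_greatest)
next
  case False
  then obtain x y where xy: "a = ennreal x" "b = ennreal y" "0 \<le> x" "0 \<le> y"
    by (cases a; cases b) auto
  have "4 * k * (x * y) \<le> 4 * k * (k * x\<^sup>2 + l * y\<^sup>2)"
  proof -
    have "4 * k * (k * x\<^sup>2 + l * y\<^sup>2) - 4 * k * (x * y) = (2 * k * x - y)\<^sup>2 + (4 * k * l - 1) * y\<^sup>2"
      by (simp add: power2_eq_square algebra_simps)
    also have "\<dots> \<ge> 0" using assms by simp
    finally show ?thesis by simp
  qed
  then have "x * y \<le> k * x\<^sup>2 + l * y\<^sup>2" using assms by simp
  then show ?thesis
    using xy assms by (simp add: ennreal_power flip: ennreal_mult ennreal_plus)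
qed

lemma ennreal_half_add: "ennreal (1/2) * x + ennreal (1/2) * x = x"
proof -
  have "ennreal (1/2) + ennreal (1/2) = 1" by (subst ennreal_plus[symmetric]) auto
  then show ?thesis by (simp only: distrib_right[symmetric] mult_1)
qed

lemma square_nn_integral_le:
  fixes f :: "'a \<Rightarrow> ennreal"
  assumes "prob_space M" and [measurable]: "f \<in> borel_measurable M"
  shows "(\<integral>\<^sup>+x. f x \<partial>M)\<^sup>2 \<le> (\<integral>\<^sup>+x. (f x)\<^sup>2 \<partial>M)"
proof -
  interpret prob_space M by fact
  have "(\<integral>\<^sup>+x. f x \<partial>M)\<^sup>2 = (\<integral>\<^sup>+x. \<integral>\<^sup>+y. f x * f y \<partial>M \<partial>M)"
    by (simp add: nn_integral_cmult nn_integral_multc power2_eq_square)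
  also have "\<dots> \<le> (\<integral>\<^sup>+x. \<integral>\<^sup>+y. ennreal (1/2) * (f x)\<^sup>2 + ennreal (1/2) * (f y)\<^sup>2 \<partial>M \<partial>M)"
    by (intro nn_integral_mono ennreal_weighted_amgm) auto
  also have "\<dots> = ennreal (1/2) * (\<integral>\<^sup>+x. (f x)\<^sup>2 \<partial>M) + ennreal (1/2) * (\<integral>\<^sup>+x. (f x)\<^sup>2 \<partial>M)"
    by (simp add: nn_integral_add nn_integral_cmult emeasure_space_1)
  finally show ?thesis by (simp only: ennreal_half_add)
qed

definition sqmass :: "(real \<Rightarrow> ennreal) \<Rightarrow> ennreal" where
  "sqmass f = (\<integral>\<^sup>+t. (f t)\<^sup>2 \<partial>lborel)"

definition sqmass_on :: "real set \<Rightarrow> (real \<Rightarrow> ennreal) \<Rightarrow> ennreal" where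
  "sqmass_on A f = (\<integral>\<^sup>+t. (f t)\<^sup>2 * indicator A t \<partial>lborel)"

text \<open>With the matrix of a step \<open>x\<close> acting on functions \<open>F\<close> of degree \<open>-1\<close> by \<open>F \<circ> step x\<close>, and
  \<open>f t = F (t, 1)\<close>, the expected value of \<open>F \<circ> step x\<close> is \<open>inversion (avg \<mu> f)\<close>: the following two
  operators are an average of unipotent elements and the Weyl element, in a principal series
  representation of the group on \<open>L\<^sup>2\<close> of the line.\<close>

definition avg :: "real measure \<Rightarrow> (real \<Rightarrow> ennreal) \<Rightarrow> real \<Rightarrow> ennreal" where
  "avg \<mu> f u = (\<integral>\<^sup>+x. f (u + x) \<partial>\<mu>)"

definition inversion :: "(real \<Rightarrow> ennreal) \<Rightarrow> real \<Rightarrow> ennreal" where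
  "inversion f t = f (- 1 / t) * ennreal (1 / \<bar>t\<bar>)"

lemma nn_integral_translate:
  fixes f :: "real \<Rightarrow> ennreal"
  assumes [measurable]: "f \<in> borel_measurable borel"
  shows "(\<integral>\<^sup>+t. f (t + h) \<partial>lborel) = (\<integral>\<^sup>+t. f t \<partial>lborel)"
  using nn_integral_real_affine[of f 1 h] by (simp add: add.commute)

lemma overlap_bound:
  fixes f :: "real \<Rightarrow> ennreal"
  assumes f[measurable]: "f \<in> borel_measurable borel"
  shows "(\<integral>\<^sup>+u. f u * f (u + h) \<partial>lborel) \<le> sqmass f"
proof -
  have "(\<integral>\<^sup>+u. f u * f (u + h) \<partial>lborel)
      \<le> (\<integral>\<^sup>+u. ennreal (1/2) * (f u)\<^sup>2 + ennreal (1/2) * (f (u + h))\<^sup>2 \<partial>lborel)"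
    by (intro nn_integral_mono ennreal_weighted_amgm) auto
  also have "\<dots> = ennreal (1/2) * (\<integral>\<^sup>+u. (f u)\<^sup>2 \<partial>lborel) + ennreal (1/2) * (\<integral>\<^sup>+u. (f u)\<^sup>2 \<partial>lborel)"
    using nn_integral_translate[of "\<lambda>u. (f u)\<^sup>2" h]
    by (simp add: nn_integral_add nn_integral_cmult)
  finally show ?thesis by (simp only: ennreal_half_add sqmass_def)
qed

text \<open>A function with much mass on an interval \<open>I\<close> of length 2 has a small scalar product with its
  translate by \<open>h\<close>, as \<open>I\<close>, \<open>I + h\<close> and \<open>I - h\<close> are disjoint.  Quantitatively, the pointwise
  inequality \<open>a b \<le> \<alpha> a\<^sup>2 + \<beta> b\<^sup>2\<close>, \<open>4 \<alpha> \<beta> = 1\<close>, is used with \<open>\<alpha> = 1/3\<close> on \<open>I\<close>, \<open>\<beta> = 1/3\<close> on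
  \<open>I - h\<close>, and \<open>\<alpha> = \<beta> = 1/2\<close> away from both.  The square of \<open>f\<close> then gets the total
  coefficient \<open>2/3 = 5/4 - 7/12\<close> on \<open>I\<close>, \<open>5/4 = 3/4 + 1/2\<close> on \<open>I \<plusminus> h\<close>, and 1 elsewhere.  The
  inequality improves on \<open>overlap_bound\<close> once \<open>I\<close> carries more than \<open>3/7\<close> of the mass; that this
  fraction is below one half makes \<open>sqmass_avg_inversion_avg\<close> work.\<close>

lemma overlap_loss:
  fixes f :: "real \<Rightarrow> ennreal"
  assumes f[measurable]: "f \<in> borel_measurable borel" and h: "\<bar>h\<bar> > 2"
  shows "(\<integral>\<^sup>+u. f u * f (u + h) \<partial>lborel) + ennreal (7/12) * sqmass_on {c-1..c+1} f
           \<le> ennreal (5/4) * sqmass f"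
proof -
  define \<alpha> where "\<alpha> u = (if u \<in> {c-1..c+1} then 1/3 else if u + h \<in> {c-1..c+1} then 3/4 else (1/2::real))" for u
  define \<beta> where "\<beta> u = (if u \<in> {c-1..c+1} then 3/4 else if u + h \<in> {c-1..c+1} then 1/3 else (1/2::real))" for u
  have [measurable]: "\<alpha> \<in> borel_measurable borel" "\<beta> \<in> borel_measurable borel"
    unfolding \<alpha>_def \<beta>_def by measurable
  have pos: "0 \<le> \<alpha> u" "0 \<le> \<beta> u" for u by (auto simp: \<alpha>_def \<beta>_def)
  have "(\<integral>\<^sup>+u. f u * f (u + h) \<partial>lborel)
      \<le> (\<integral>\<^sup>+u. ennreal (\<alpha> u) * (f u)\<^sup>2 + ennreal (\<beta> u) * (f (u + h))\<^sup>2 \<partial>lborel)"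
    by (intro nn_integral_mono ennreal_weighted_amgm) (auto simp: \<alpha>_def \<beta>_def)
  also have "\<dots> = (\<integral>\<^sup>+u. ennreal (\<alpha> u) * (f u)\<^sup>2 \<partial>lborel) + (\<integral>\<^sup>+u. ennreal (\<beta> u) * (f (u + h))\<^sup>2 \<partial>lborel)"
    by (subst nn_integral_add) auto
  also have "(\<integral>\<^sup>+u. ennreal (\<beta> u) * (f (u + h))\<^sup>2 \<partial>lborel) = (\<integral>\<^sup>+u. ennreal (\<beta> (u - h)) * (f u)\<^sup>2 \<partial>lborel)"
    using nn_integral_translate[of "\<lambda>u. ennreal (\<beta> (u - h)) * (f u)\<^sup>2" h] by simp
  finally have "(\<integral>\<^sup>+u. f u * f (u + h) \<partial>lborel) + ennreal (7/12) * sqmass_on {c-1..c+1} f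
     \<le> (\<integral>\<^sup>+u. ennreal (\<alpha> u) * (f u)\<^sup>2 \<partial>lborel) + (\<integral>\<^sup>+u. ennreal (\<beta> (u - h)) * (f u)\<^sup>2 \<partial>lborel)
        + ennreal (7/12) * sqmass_on {c-1..c+1} f"
    by (rule add_right_mono)
  also have "\<dots> = (\<integral>\<^sup>+u. ennreal (\<alpha> u) * (f u)\<^sup>2 + ennreal (\<beta> (u - h)) * (f u)\<^sup>2
                     + ennreal (7/12) * ((f u)\<^sup>2 * indicator {c-1..c+1} u) \<partial>lborel)"
    by (subst nn_integral_add, measurable)+ (simp add: sqmass_on_def nn_integral_cmult)
  also have "\<dots> \<le> (\<integral>\<^sup>+u. ennreal (5/4) * (f u)\<^sup>2 \<partial>lborel)"
  proof (rule nn_integral_mono)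
    fix u :: real
    have le: "\<alpha> u + \<beta> (u - h) + 7/12 * indicator {c-1..c+1} u \<le> 5/4"
      using h by (auto simp: \<alpha>_def \<beta>_def indicator_def abs_if split: if_splits)
    have "ennreal (\<alpha> u) * (f u)\<^sup>2 + ennreal (\<beta> (u - h)) * (f u)\<^sup>2
         + ennreal (7/12) * ((f u)\<^sup>2 * indicator {c-1..c+1} u)
         = ennreal (\<alpha> u + \<beta> (u - h) + 7/12 * indicator {c-1..c+1} u) * (f u)\<^sup>2"
      using pos by (simp add: ennreal_plus distrib_right indicator_def)
    also have "\<dots> \<le> ennreal (5/4) * (f u)\<^sup>2"
      by (intro mult_right_mono ennreal_leI le) auto
    finally show "ennreal (\<alpha> u) * (f u)\<^sup>2 + ennreal (\<beta> (u - h)) * (f u)\<^sup>2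
         + ennreal (7/12) * ((f u)\<^sup>2 * indicator {c-1..c+1} u) \<le> ennreal (5/4) * (f u)\<^sup>2" .
  qed
  also have "\<dots> = ennreal (5/4) * sqmass f"
    by (simp add: sqmass_def nn_integral_cmult)
  finally show ?thesis .
qed

lemma nn_integral_indicator_Icc_incseq:
  fixes f :: "real \<Rightarrow> ennreal"
  assumes [measurable]: "f \<in> borel_measurable borel"
    and inc: "incseq A" and [measurable]: "\<And>n. A n \<in> sets borel"
  shows "(\<integral>\<^sup>+t. f t * indicator (\<Union>n. A n) t \<partial>lborel) = (SUP n. \<integral>\<^sup>+t. f t * indicator (A n) t \<partial>lborel)"
proof -
  have "f t * indicator (\<Union>n. A n) t = (SUP n. f t * indicator (A n) t)" for t
  proof (cases "t \<in> (\<Union>n. A n)")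
    case True
    then obtain m where "t \<in> A m" by auto
    show ?thesis
    proof (rule antisym)
      show "f t * indicator (\<Union>n. A n) t \<le> (SUP n. f t * indicator (A n) t)"
        using \<open>t \<in> A m\<close> True by (intro SUP_upper2[of m]) auto
      show "(SUP n. f t * indicator (A n) t) \<le> f t * indicator (\<Union>n. A n) t"
        using True by (intro SUP_least) (auto simp: indicator_def)
    qed
  qed (auto simp: indicator_def)
  then have "(\<integral>\<^sup>+t. f t * indicator (\<Union>n. A n) t \<partial>lborel) = (\<integral>\<^sup>+t. (SUP n. f t * indicator (A n) t) \<partial>lborel)"
    by simp
  also have "\<dots> = (SUP n. \<integral>\<^sup>+t. f t * indicator (A n) t \<partial>lborel)"
    using inc by (intro nn_integral_monotone_convergence_SUP)
      (auto simp: incseq_def le_fun_def indicator_def)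
  finally show ?thesis .
qed

text \<open>The inversion has derivative \<open>1/t\<^sup>2\<close>.  The substitution is carried out on compact intervals that
  exhaust a half line, because it is singular at 0.\<close>

lemma inversion_half_line:
  fixes f :: "real \<Rightarrow> ennreal"
  assumes [measurable]: "f \<in> borel_measurable borel"
  shows "(\<integral>\<^sup>+t. f (-1/t) * ennreal (1/t\<^sup>2) * indicator {0<..} t \<partial>lborel) = (\<integral>\<^sup>+t. f t * indicator {..<0} t \<partial>lborel)"
    and "(\<integral>\<^sup>+t. f (-1/t) * ennreal (1/t\<^sup>2) * indicator {..<0} t \<partial>lborel) = (\<integral>\<^sup>+t. f t * indicator {0<..} t \<partial>lborel)"
proof -
  define r where "r n = real (Suc (Suc n))" for n
  have r: "r n > 1" "1 / r n < r n" "0 < 1 / r n" for n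
  proof -
    show "r n > 1" by (simp add: r_def)
    then show "0 < 1 / r n" by simp
    have "1 / r n < 1" using \<open>r n > 1\<close> by simp
    then show "1 / r n < r n" using \<open>r n > 1\<close> by linarith
  qed
  have ex: "\<exists>n. t < r n" for t
  proof -
    obtain n where "t < real n" using reals_Archimedean2 by blast
    then show ?thesis by (intro exI[of _ n]) (simp add: r_def)
  qed
  have mono: "r m \<le> r n" "1 / r n \<le> 1 / r m" if "m \<le> n" for m n
    using that r[of m] r[of n] by (auto simp: r_def frac_le)
  have incp: "incseq (\<lambda>n. {1 / r n .. r n})" and incn: "incseq (\<lambda>n. {- r n .. - (1 / r n)})"
    using mono by (force simp: incseq_def)+
  have both: "\<exists>n. 1 / r n \<le> t \<and> t \<le> r n" if "0 < t" for t
  proof -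
    obtain n where n: "max t (1/t) < r n" using ex by blast
    then have "1 / r n < t" using that r[of n] by (simp add: field_simps)
    with n show ?thesis by (intro exI[of _ n]) auto
  qed
  have Up: "(\<Union>n. {1 / r n .. r n}) = {0<..}"
    using both r(3) by (auto intro: less_le_trans simp: order_less_le_trans[OF r(3)])
  have Un: "(\<Union>n. {- r n .. - (1 / r n)}) = {..<0}"
  proof (intro equalityI subsetI)
    fix t assume "t \<in> (\<Union>n. {- r n .. - (1 / r n)})"
    then obtain n where "t \<le> - (1 / r n)" by auto
    with r(3)[of n] show "t \<in> {..<0}" unfolding lessThan_iff by linarith
  next
    fix t :: real assume "t \<in> {..<0}"
    then obtain n where "1 / r n \<le> - t \<and> - t \<le> r n" using both[of "-t"] by auto
    then show "t \<in> (\<Union>n. {- r n .. - (1 / r n)})" by (intro UN_I[of n]) auto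
  qed
  have sub: "(\<integral>\<^sup>+x. f x * indicator {-1/a .. -1/b} x \<partial>lborel)
      = (\<integral>\<^sup>+x. f (-1/x) * ennreal (1/x\<^sup>2) * indicator {a..b} x \<partial>lborel)" if "a < b" "0 < a \<or> b < 0" for a b
  proof (rule nn_integral_substitution_aux)
    fix x assume "x \<in> {a..b}"
    then have "x \<noteq> 0" using that by auto
    then show "((\<lambda>x. - 1 / x) has_real_derivative 1 / x\<^sup>2) (at x)"
      by (auto intro!: derivative_eq_intros simp: power2_eq_square)
  qed (use that in \<open>auto intro!: continuous_intros\<close>)
  have "(\<integral>\<^sup>+t. f (-1/t) * ennreal (1/t\<^sup>2) * indicator {0<..} t \<partial>lborel)
      = (SUP n. \<integral>\<^sup>+t. f (-1/t) * ennreal (1/t\<^sup>2) * indicator {1 / r n .. r n} t \<partial>lborel)"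
    unfolding Up[symmetric] by (rule nn_integral_indicator_Icc_incseq[OF _ incp]) auto
  also have "\<dots> = (SUP n. \<integral>\<^sup>+t. f t * indicator {- r n .. - (1 / r n)} t \<partial>lborel)"
  proof (intro SUP_cong refl)
    fix n show "(\<integral>\<^sup>+t. f (-1/t) * ennreal (1/t\<^sup>2) * indicator {1 / r n .. r n} t \<partial>lborel)
        = (\<integral>\<^sup>+t. f t * indicator {- r n .. - (1 / r n)} t \<partial>lborel)"
      using sub[of "1 / r n" "r n"] r[of n] by simp
  qed
  also have "\<dots> = (\<integral>\<^sup>+t. f t * indicator {..<0} t \<partial>lborel)"
    unfolding Un[symmetric] by (rule nn_integral_indicator_Icc_incseq[OF _ incn, symmetric]) auto
  finally show "(\<integral>\<^sup>+t. f (-1/t) * ennreal (1/t\<^sup>2) * indicator {0<..} t \<partial>lborel)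
      = (\<integral>\<^sup>+t. f t * indicator {..<0} t \<partial>lborel)" .
  have "(\<integral>\<^sup>+t. f (-1/t) * ennreal (1/t\<^sup>2) * indicator {..<0} t \<partial>lborel)
      = (SUP n. \<integral>\<^sup>+t. f (-1/t) * ennreal (1/t\<^sup>2) * indicator {- r n .. - (1 / r n)} t \<partial>lborel)"
    unfolding Un[symmetric] by (rule nn_integral_indicator_Icc_incseq[OF _ incn]) auto
  also have "\<dots> = (SUP n. \<integral>\<^sup>+t. f t * indicator {1 / r n .. r n} t \<partial>lborel)"
  proof (intro SUP_cong refl)
    fix n show "(\<integral>\<^sup>+t. f (-1/t) * ennreal (1/t\<^sup>2) * indicator {- r n .. - (1 / r n)} t \<partial>lborel)
        = (\<integral>\<^sup>+t. f t * indicator {1 / r n .. r n} t \<partial>lborel)"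
      using sub[of "- r n" "- (1 / r n)"] r[of n] by simp
  qed
  also have "\<dots> = (\<integral>\<^sup>+t. f t * indicator {0<..} t \<partial>lborel)"
    unfolding Up[symmetric] by (rule nn_integral_indicator_Icc_incseq[OF _ incp, symmetric]) auto
  finally show "(\<integral>\<^sup>+t. f (-1/t) * ennreal (1/t\<^sup>2) * indicator {..<0} t \<partial>lborel)
      = (\<integral>\<^sup>+t. f t * indicator {0<..} t \<partial>lborel)" .
qed

lemma nn_integral_split_0:
  fixes f :: "real \<Rightarrow> ennreal"
  assumes [measurable]: "f \<in> borel_measurable borel"
  shows "(\<integral>\<^sup>+t. f t \<partial>lborel)
      = (\<integral>\<^sup>+t. f t * indicator {0<..} t \<partial>lborel) + (\<integral>\<^sup>+t. f t * indicator {..<0} t \<partial>lborel)"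
proof -
  have "(\<integral>\<^sup>+t. f t \<partial>lborel) = (\<integral>\<^sup>+t. f t * indicator {0<..} t + f t * indicator {..<0} t \<partial>lborel)"
    by (rule nn_integral_cong_AE, rule AE_mp[OF AE_lborel_singleton[of 0]])
      (auto simp: indicator_def)
  then show ?thesis by (simp add: nn_integral_add)
qed

lemma inversion_isometry:
  fixes f :: "real \<Rightarrow> ennreal"
  assumes [measurable]: "f \<in> borel_measurable borel"
  shows "(\<integral>\<^sup>+t. f (-1/t) * ennreal (1/t\<^sup>2) \<partial>lborel) = (\<integral>\<^sup>+t. f t \<partial>lborel)"
proof -
  have [measurable]: "(\<lambda>t. f (-1/t) * ennreal (1/t\<^sup>2)) \<in> borel_measurable borel" by measurable
  have "(\<integral>\<^sup>+t. f (-1/t) * ennreal (1/t\<^sup>2) \<partial>lborel)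
      = (\<integral>\<^sup>+t. f (-1/t) * ennreal (1/t\<^sup>2) * indicator {0<..} t \<partial>lborel)
        + (\<integral>\<^sup>+t. f (-1/t) * ennreal (1/t\<^sup>2) * indicator {..<0} t \<partial>lborel)"
    by (rule nn_integral_split_0) measurable
  also have "\<dots> = (\<integral>\<^sup>+t. f t * indicator {..<0} t \<partial>lborel) + (\<integral>\<^sup>+t. f t * indicator {0<..} t \<partial>lborel)"
    unfolding inversion_half_line[OF assms] by (rule refl)
  also have "\<dots> = (\<integral>\<^sup>+t. f t \<partial>lborel)"
    unfolding nn_integral_split_0[OF assms] by (rule add.commute)
  finally show ?thesis .
qed

lemma measurable_inversion [measurable]:
  assumes [measurable]: "f \<in> borel_measurable borel"
  shows "inversion f \<in> borel_measurable borel"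
  unfolding inversion_def by measurable

lemma inversion_square: "(inversion f t)\<^sup>2 = (f (-1/t))\<^sup>2 * ennreal (1/t\<^sup>2)"
proof -
  have "(ennreal (1/\<bar>t\<bar>))\<^sup>2 = ennreal (1/t\<^sup>2)"
    by (simp add: ennreal_power power_divide)
  then show ?thesis by (simp add: inversion_def power_mult_distrib)
qed

lemma sqmass_inversion:
  assumes [measurable]: "f \<in> borel_measurable borel"
  shows "sqmass (inversion f) = sqmass f"
  unfolding sqmass_def inversion_square by (rule inversion_isometry) measurable

text \<open>The inversion carries the complement of \<open>{-1..1}\<close> into \<open>{-1..1}\<close>.\<close>

lemma sqmass_on_inversion:
  assumes [measurable]: "f \<in> borel_measurable borel"
  shows "sqmass f \<le> sqmass_on {-1..1} f + sqmass_on {-1..1} (inversion f)"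
proof -
  have "sqmass_on {-1..1} (inversion f)
      = (\<integral>\<^sup>+t. ((f (-1/t))\<^sup>2 * indicator {t. 1 \<le> \<bar>t\<bar>} (-1/t)) * ennreal (1/t\<^sup>2) \<partial>lborel)"
    unfolding sqmass_on_def inversion_square
    by (rule nn_integral_cong_AE, rule AE_mp[OF AE_lborel_singleton[of 0]])
      (auto simp: indicator_def field_simps abs_le_iff zero_less_abs_iff)
  also have "\<dots> = (\<integral>\<^sup>+t. (f t)\<^sup>2 * indicator {t. 1 \<le> \<bar>t\<bar>} t \<partial>lborel)"
    by (rule inversion_isometry) measurable
  finally have "sqmass_on {-1..1} f + sqmass_on {-1..1} (inversion f)
     = (\<integral>\<^sup>+t. (f t)\<^sup>2 * indicator {-1..1} t + (f t)\<^sup>2 * indicator {t. 1 \<le> \<bar>t\<bar>} t \<partial>lborel)"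
    by (simp add: sqmass_on_def nn_integral_add)
  also have "\<dots> \<ge> (\<integral>\<^sup>+t. (f t)\<^sup>2 \<partial>lborel)"
    by (intro nn_integral_mono) (auto simp: indicator_def)
  finally show ?thesis by (simp add: sqmass_def)
qed

lemma measurable_avg [measurable]:
  assumes "prob_space \<mu>" "sets \<mu> = sets borel" and [measurable]: "f \<in> borel_measurable borel"
  shows "avg \<mu> f \<in> borel_measurable borel"
proof -
  interpret prob_space \<mu> by fact
  note [measurable_cong] = \<open>sets \<mu> = sets borel\<close>
  show ?thesis unfolding avg_def by measurable
qed

text \<open>The square of the norm of an average of translates is the average of their scalar products;
  pairs of translations in \<open>A \<times> B\<close> contribute with the loss of \<open>overlap_loss\<close>.\<close>

lemma sqmass_avg_loss_before:
  fixes f :: "real \<Rightarrow> ennreal"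
  assumes \<mu>: "prob_space \<mu>" "sets \<mu> = sets borel"
    and f[measurable]: "f \<in> borel_measurable borel"
    and A[measurable]: "A \<in> sets borel" "B \<in> sets borel"
    and AB: "\<And>x y. x \<in> A \<Longrightarrow> y \<in> B \<Longrightarrow> \<bar>x - y\<bar> > 2"
  defines "\<theta> \<equiv> emeasure \<mu> A * emeasure \<mu> B"
  shows "sqmass (avg \<mu> f) + \<theta> * (ennreal (7/12) * sqmass_on {c-1..c+1} f)
           \<le> (1 + \<theta> * ennreal (1/4)) * sqmass f"
proof -
  interpret prob_space \<mu> by fact
  interpret P: pair_sigma_finite \<mu> \<mu> by unfold_locales
  interpret PL: pair_sigma_finite \<mu> lborel by unfold_locales
  note [measurable_cong] = \<open>sets \<mu> = sets borel\<close>
  have eq: "sqmass (avg \<mu> f) = (\<integral>\<^sup>+x. \<integral>\<^sup>+y. \<integral>\<^sup>+u. f (u + x) * f (u + y) \<partial>lborel \<partial>\<mu> \<partial>\<mu>)"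
  proof -
    have "sqmass (avg \<mu> f) = (\<integral>\<^sup>+u. \<integral>\<^sup>+x. \<integral>\<^sup>+y. f (u + x) * f (u + y) \<partial>\<mu> \<partial>\<mu> \<partial>lborel)"
      by (simp add: sqmass_def avg_def power2_eq_square nn_integral_cmult nn_integral_multc)
    also have "\<dots> = (\<integral>\<^sup>+x. \<integral>\<^sup>+u. \<integral>\<^sup>+y. f (u + x) * f (u + y) \<partial>\<mu> \<partial>lborel \<partial>\<mu>)"
      by (rule PL.Fubini') measurable
    also have "\<dots> = (\<integral>\<^sup>+x. \<integral>\<^sup>+y. \<integral>\<^sup>+u. f (u + x) * f (u + y) \<partial>lborel \<partial>\<mu> \<partial>\<mu>)"
      by (intro nn_integral_cong PL.Fubini') measurable
    finally show ?thesis .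
  qed
  have tr: "(\<integral>\<^sup>+u. f (u + x) * f (u + y) \<partial>lborel) = (\<integral>\<^sup>+u. f u * f (u + (y - x)) \<partial>lborel)" for x y
    using nn_integral_translate[of "\<lambda>u. f u * f (u + (y - x))" x] by (simp add: algebra_simps)
  have pt: "(\<integral>\<^sup>+u. f (u + x) * f (u + y) \<partial>lborel)
        + indicator A x * indicator B y * (ennreal (7/12) * sqmass_on {c-1..c+1} f)
      \<le> sqmass f + indicator A x * indicator B y * (ennreal (1/4) * sqmass f)" for x y c
  proof (cases "x \<in> A \<and> y \<in> B")
    case True
    have "ennreal (5/4) = 1 + ennreal (1/4)" by (simp flip: ennreal_plus ennreal_1)
    then show ?thesis
      using overlap_loss[OF f, of "y - x" c] AB[of x y] True by (simp add: tr distrib_right abs_minus_commute)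
  next
    case False
    then have z: "indicator A x * (indicator B y :: ennreal) = 0" by (auto simp: indicator_def)
    show ?thesis unfolding z tr using overlap_bound[OF f] by simp
  qed
  have "sqmass (avg \<mu> f) + \<theta> * (ennreal (7/12) * sqmass_on {c-1..c+1} f)
      = (\<integral>\<^sup>+x. \<integral>\<^sup>+y. (\<integral>\<^sup>+u. f (u + x) * f (u + y) \<partial>lborel)
        + indicator A x * indicator B y * (ennreal (7/12) * sqmass_on {c-1..c+1} f) \<partial>\<mu> \<partial>\<mu>)"
    by (simp add: nn_integral_add nn_integral_multc nn_integral_cmult eq \<theta>_def)
  also have "\<dots> \<le> (\<integral>\<^sup>+x. \<integral>\<^sup>+y. sqmass f + indicator A x * indicator B y * (ennreal (1/4) * sqmass f) \<partial>\<mu> \<partial>\<mu>)"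
    by (intro nn_integral_mono pt)
  also have "\<dots> = (1 + \<theta> * ennreal (1/4)) * sqmass f"
    by (simp add: nn_integral_add nn_integral_multc nn_integral_cmult \<theta>_def emeasure_space_1
        distrib_right mult.assoc)
  finally show ?thesis .
qed

text \<open>The mass that causes the loss can be measured after averaging: the interval of
  \<open>sqmass_avg_loss_before\<close> may be placed anywhere, so its centre can be averaged over \<open>\<mu>\<close>, and by Jensen's
  inequality the averaged mass dominates the mass of the averaged function.\<close>

lemma sqmass_avg_loss_after:
  fixes f :: "real \<Rightarrow> ennreal"
  assumes \<mu>: "prob_space \<mu>" "sets \<mu> = sets borel"
    and f[measurable]: "f \<in> borel_measurable borel"
    and A[measurable]: "A \<in> sets borel" "B \<in> sets borel"
    and AB: "\<And>x y. x \<in> A \<Longrightarrow> y \<in> B \<Longrightarrow> \<bar>x - y\<bar> > 2"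
  defines "\<theta> \<equiv> emeasure \<mu> A * emeasure \<mu> B"
  shows "sqmass (avg \<mu> f) + \<theta> * (ennreal (7/12) * sqmass_on {-1..1} (avg \<mu> f))
           \<le> (1 + \<theta> * ennreal (1/4)) * sqmass f"
proof -
  interpret prob_space \<mu> by fact
  interpret PL: pair_sigma_finite \<mu> lborel by unfold_locales
  note [measurable_cong] = \<open>sets \<mu> = sets borel\<close>
  have "sqmass_on {-1..1} (avg \<mu> f) \<le> (\<integral>\<^sup>+u. \<integral>\<^sup>+y. (f (u + y))\<^sup>2 * indicator {-1..1} u \<partial>\<mu> \<partial>lborel)"
    unfolding sqmass_on_def avg_def
    by (subst nn_integral_multc, measurable)
      (intro nn_integral_mono mult_right_mono square_nn_integral_le \<mu>, auto)
  also have "\<dots> = (\<integral>\<^sup>+y. \<integral>\<^sup>+u. (f (u + y))\<^sup>2 * indicator {-1..1} u \<partial>lborel \<partial>\<mu>)"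
    by (rule PL.Fubini') measurable
  also have "\<dots> = (\<integral>\<^sup>+y. sqmass_on {y-1..y+1} f \<partial>\<mu>)"
  proof (rule nn_integral_cong)
    fix y
    have "(\<integral>\<^sup>+u. (f (u + y))\<^sup>2 * indicator {-1..1} u \<partial>lborel)
        = (\<integral>\<^sup>+u. (f (u + y))\<^sup>2 * indicator {y-1..y+1} (u + y) \<partial>lborel)"
      by (intro nn_integral_cong) (auto simp: indicator_def)
    also have "\<dots> = sqmass_on {y-1..y+1} f"
      unfolding sqmass_on_def
      by (rule nn_integral_translate[of "\<lambda>u. (f u)\<^sup>2 * indicator {y-1..y+1} u" y]) measurable
    finally show "(\<integral>\<^sup>+u. (f (u + y))\<^sup>2 * indicator {-1..1} u \<partial>lborel) = sqmass_on {y-1..y+1} f" .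
  qed
  finally have "sqmass (avg \<mu> f) + \<theta> * (ennreal (7/12) * sqmass_on {-1..1} (avg \<mu> f))
     \<le> sqmass (avg \<mu> f) + \<theta> * (ennreal (7/12) * (\<integral>\<^sup>+y. sqmass_on {y-1..y+1} f \<partial>\<mu>))"
    by (intro add_left_mono mult_left_mono) auto
  also have "\<dots> = (\<integral>\<^sup>+y. sqmass (avg \<mu> f) + \<theta> * (ennreal (7/12) * sqmass_on {y-1..y+1} f) \<partial>\<mu>)"
  proof -
    have [measurable]: "(\<lambda>y. sqmass_on {y-1..y+1} f) \<in> borel_measurable \<mu>"
    proof -
      have "(\<lambda>y. sqmass_on {y-1..y+1} f) = (\<lambda>y. \<integral>\<^sup>+u. (f u)\<^sup>2 * (if y - 1 \<le> u \<and> u \<le> y + 1 then 1 else 0) \<partial>lborel)"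
        unfolding sqmass_on_def by (intro ext nn_integral_cong) (auto simp: indicator_def)
      also have "\<dots> \<in> borel_measurable \<mu>" by measurable
      finally show ?thesis .
    qed
    show ?thesis by (simp add: nn_integral_add nn_integral_cmult emeasure_space_1 )
  qed
  also have "\<dots> \<le> (\<integral>\<^sup>+y. (1 + \<theta> * ennreal (1/4)) * sqmass f \<partial>\<mu>)"
    by (intro nn_integral_mono)
      (unfold \<theta>_def, rule sqmass_avg_loss_before[OF \<mu> f A AB])
  also have "\<dots> = (1 + \<theta> * ennreal (1/4)) * sqmass f"
    by (simp add: emeasure_space_1)
  finally show ?thesis .
qed


lemma sqmass_avg_le:
  assumes "prob_space \<mu>" "sets \<mu> = sets borel" "f \<in> borel_measurable borel"
  shows "sqmass (avg \<mu> f) \<le> sqmass f"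
  using sqmass_avg_loss_before[OF assms, of "{}" "{}"] by simp

lemma sqmass_on_le: "sqmass_on A f \<le> sqmass f"
  unfolding sqmass_on_def sqmass_def by (intro nn_integral_mono) (auto simp: indicator_def)

lemma sqmass_cong:
  assumes "\<And>t. t \<noteq> 0 \<Longrightarrow> f t = g t"
  shows "sqmass f = sqmass g"
  unfolding sqmass_def
  by (rule nn_integral_cong_AE, rule AE_mp[OF AE_lborel_singleton[of 0]]) (use assms in auto)

lemma sqmass_on_cong:
  assumes "\<And>t. t \<noteq> 0 \<Longrightarrow> f t = g t"
  shows "sqmass_on A f = sqmass_on A g"
  unfolding sqmass_on_def
  by (rule nn_integral_cong_AE, rule AE_mp[OF AE_lborel_singleton[of 0]]) (use assms in auto)

text \<open>Let \<open>g = avg \<mu> f\<close>, and let \<open>f'\<close> be its inversion.  The first averaging loses a multiple of the mass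
  of \<open>g\<close> in \<open>{-1..1}\<close>, the second one a multiple of the mass of \<open>f'\<close> there, and together these
  masses are at least that of \<open>g\<close>.  Hence a definite loss occurs in one of the two averagings.
  The function \<open>f'\<close> is left free at the point 0, which is the direction at infinity after inversion.\<close>

lemma sqmass_avg_inversion_avg:
  fixes f f' :: "real \<Rightarrow> ennreal"
  assumes \<mu>: "prob_space \<mu>" "sets \<mu> = sets borel"
    and f[measurable]: "f \<in> borel_measurable borel" and f'[measurable]: "f' \<in> borel_measurable borel"
    and ff': "\<And>t. t \<noteq> 0 \<Longrightarrow> f' t = inversion (avg \<mu> f) t"
    and A[measurable]: "A \<in> sets borel" "B \<in> sets borel"
    and AB: "\<And>x y. x \<in> A \<Longrightarrow> y \<in> B \<Longrightarrow> \<bar>x - y\<bar> > 2"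
    and t: "0 < t" "t \<le> measure \<mu> A" "t \<le> measure \<mu> B"
    and fin: "sqmass f \<noteq> \<top>"
  shows "sqmass (avg \<mu> f') \<le> ennreal ((1 + t\<^sup>2/4) / (1 + t\<^sup>2/3)) * sqmass f"
proof -
  interpret prob_space \<mu> by fact
  define g where "g = avg \<mu> f"
  define \<theta> where "\<theta> = measure \<mu> A * measure \<mu> B"
  have \<theta>: "emeasure \<mu> A * emeasure \<mu> B = ennreal \<theta>"
    by (simp add: \<theta>_def emeasure_eq_measure ennreal_mult)
  have [measurable]: "g \<in> borel_measurable borel"
    unfolding g_def by (rule measurable_avg[OF \<mu> f])
  have f'_mass: "sqmass f' = sqmass g"
    using sqmass_cong[of f' "inversion g"] sqmass_inversion[of g] ff' by (simp flip: g_def)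
  have f'_mass_on: "sqmass_on A f' = sqmass_on A (inversion g)" for A
    by (rule sqmass_on_cong) (simp add: ff' g_def)
  have le1: "sqmass g \<le> sqmass f" unfolding g_def by (rule sqmass_avg_le[OF \<mu> f])
  have le2: "sqmass (avg \<mu> f') \<le> sqmass g"
    using sqmass_avg_le[OF \<mu> f'] f'_mass by simp
  have i1: "sqmass g + ennreal \<theta> * (ennreal (7/12) * sqmass_on {-1..1} g)
      \<le> (1 + ennreal \<theta> * ennreal (1/4)) * sqmass f"
    using sqmass_avg_loss_after[OF \<mu> f A AB] by (simp only: \<theta> g_def)
  have i2: "sqmass (avg \<mu> f') + ennreal \<theta> * (ennreal (7/12) * sqmass_on {-1..1} (inversion g))
      \<le> (1 + ennreal \<theta> * ennreal (1/4)) * sqmass g"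
    using sqmass_avg_loss_before[OF \<mu> f' A AB, of 0]
    by (simp add: \<theta> f'_mass f'_mass_on)
  have i3: "sqmass g \<le> sqmass_on {-1..1} g + sqmass_on {-1..1} (inversion g)"
    by (rule sqmass_on_inversion) measurable
  obtain a where a: "sqmass f = ennreal a" "0 \<le> a" using fin by (cases "sqmass f") auto
  then obtain b where b: "sqmass g = ennreal b" "0 \<le> b" using le1 by (cases "sqmass g") (auto simp: top_unique)
  then obtain c where c: "sqmass (avg \<mu> f') = ennreal c" "0 \<le> c"
    using le2 by (cases "sqmass (avg \<mu> f')") (auto simp: top_unique)
  obtain m where m: "sqmass_on {-1..1} g = ennreal m" "0 \<le> m"
    using b sqmass_on_le[of "{-1..1}" g] by (cases "sqmass_on {-1..1} g") (auto simp: top_unique)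
  obtain m' where m': "sqmass_on {-1..1} (inversion g) = ennreal m'" "0 \<le> m'"
    using b sqmass_on_le[of "{-1..1}" "inversion g"] sqmass_inversion[of g]
    by (cases "sqmass_on {-1..1} (inversion g)") (auto simp: top_unique)
  have th0: "t\<^sup>2 \<le> \<theta>" using t by (auto simp: \<theta>_def power2_eq_square intro!: mult_mono)
  then have th: "0 < \<theta>" using t by (meson less_le_trans zero_less_power)
  have j1: "b + \<theta> * (7/12 * m) \<le> (1 + \<theta> * (1/4)) * a"
    using i1 a b m th by (simp flip: ennreal_mult ennreal_plus ennreal_1)
  have j2: "c + \<theta> * (7/12 * m') \<le> (1 + \<theta> * (1/4)) * b"
    using i2 c b m' th by (simp flip: ennreal_mult ennreal_plus ennreal_1)
  have j3: "b \<le> m + m'" using i3 b m m' by (simp flip: ennreal_plus)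
  have j4: "c \<le> b" using le2 c b by simp
  have j5: "\<theta> * (7/12 * b) \<le> \<theta> * (7/12 * m) + \<theta> * (7/12 * m')"
    using mult_left_mono[OF j3, of "\<theta> * (7/12)"] th by (simp add: algebra_simps)
  have j6: "\<theta> / 3 * c \<le> \<theta> / 3 * b" using j4 th by (intro mult_left_mono) auto
  have "c * (1 + \<theta>/3) \<le> (1 + \<theta>/4) * a"
    using j1 j2 j5 j6 by (simp add: algebra_simps)
  then have "c \<le> (1 + \<theta>/4) / (1 + \<theta>/3) * a" using th by (simp add: field_simps)
  also have "(1 + \<theta>/4) / (1 + \<theta>/3) \<le> (1 + t\<^sup>2/4) / (1 + t\<^sup>2/3)"
  proof -
    have "(1 + \<theta>/4) * (1 + t\<^sup>2/3) \<le> (1 + t\<^sup>2/4) * (1 + \<theta>/3)" 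
    proof -
      have "(1 + t\<^sup>2/4) * (1 + \<theta>/3) - (1 + \<theta>/4) * (1 + t\<^sup>2/3) = (\<theta> - t\<^sup>2) / 12"
        by (simp add: field_simps)
      with th0 show ?thesis by simp
    qed
    moreover have pos: "0 < 1 + \<theta>/3" "0 < 1 + t\<^sup>2/3" using th by (auto intro: add_pos_nonneg)
    ultimately show ?thesis
      by (intro mult_imp_div_pos_le pos) (simp only: times_divide_eq_left mult_imp_le_div_pos pos)
  qed
  finally have "c \<le> (1 + t\<^sup>2/4) / (1 + t\<^sup>2/3) * a" using a(2) by (simp add: mult_right_mono)
  then show ?thesis
    unfolding a(1) c(1) by (simp add: ennreal_leI flip: ennreal_mult')
qed

lemma sqmass_iterates:
  fixes f :: "nat \<Rightarrow> real \<Rightarrow> ennreal"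
  assumes \<mu>: "prob_space \<mu>" "sets \<mu> = sets borel"
    and f: "\<And>n. f n \<in> borel_measurable borel"
    and rec: "\<And>n t. t \<noteq> 0 \<Longrightarrow> f (Suc n) t = inversion (avg \<mu> (f n)) t"
    and A: "A \<in> sets borel" "B \<in> sets borel"
    and AB: "\<And>x y. x \<in> A \<Longrightarrow> y \<in> B \<Longrightarrow> \<bar>x - y\<bar> > 2"
    and t: "0 < t" "t \<le> measure \<mu> A" "t \<le> measure \<mu> B"
    and fin: "sqmass (f 0) \<noteq> \<top>"
  shows "sqmass (f n) \<le> ennreal (((1 + t\<^sup>2/4) / (1 + t\<^sup>2/3)) ^ (n div 2)) * sqmass (f 0)"
proof (induction n rule: induct_nat_012)
  case 0
  then show ?case by simp
next
  case 1
  show ?case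
    using sqmass_avg_le[OF \<mu> f] sqmass_inversion[OF measurable_avg[OF \<mu> f]] sqmass_cong[OF rec]
    by simp
next
  case (ge2 n)
  define \<rho> where "\<rho> = (1 + t\<^sup>2/4) / (1 + t\<^sup>2/3)"
  have \<rho>: "0 < \<rho>" unfolding \<rho>_def by (intro divide_pos_pos add_pos_nonneg) auto
  have gfin: "sqmass (f n) \<noteq> \<top>"
  proof -
    have "ennreal (\<rho> ^ (n div 2)) * sqmass (f 0) < \<top>"
      using fin by (simp add: ennreal_mult_less_top less_top)
    then show ?thesis using ge2(1) by (auto simp: \<rho>_def top_unique)
  qed
  have "sqmass (f (Suc (Suc n))) = sqmass (avg \<mu> (f (Suc n)))"
    using sqmass_inversion[OF measurable_avg[OF \<mu> f]] sqmass_cong[OF rec] by simp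
  also have "\<dots> \<le> ennreal \<rho> * sqmass (f n)"
    unfolding \<rho>_def by (rule sqmass_avg_inversion_avg[OF \<mu> f f rec A AB t gfin])
  also have "\<dots> \<le> ennreal \<rho> * (ennreal (\<rho> ^ (n div 2)) * sqmass (f 0))"
    using ge2(1) by (intro mult_left_mono) (auto simp: \<rho>_def)
  also have "\<dots> = ennreal (\<rho> ^ (Suc (Suc n) div 2)) * sqmass (f 0)"
    using \<rho> by (simp add: ennreal_mult' mult.assoc)
  finally show ?case by (simp only: \<rho>_def)
qed

text \<open>The reciprocal of the norm of the plane, read in the chart.\<close>

definition unit_density :: "real \<Rightarrow> ennreal" where
  "unit_density t = ennreal (1 / sqrt (1 + t\<^sup>2))"

lemma measurable_unit_density [measurable]: "unit_density \<in> borel_measurable borel"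
  unfolding unit_density_def by measurable

lemma sqmass_unit_density: "sqmass unit_density \<le> 4"
proof -
  have pt: "(unit_density t)\<^sup>2 \<le> indicator {-1..1} t + indicator {-1..1} (-1/t) * ennreal (1/t\<^sup>2)" for t
  proof -
    have e: "(unit_density t)\<^sup>2 = ennreal (1 / (1 + t\<^sup>2))"
      by (simp add: unit_density_def ennreal_power power_divide)
    show ?thesis
    proof (cases "\<bar>t\<bar> \<le> 1")
      case True
      have "ennreal (1 / (1 + t\<^sup>2)) \<le> 1" by (simp add: divide_le_eq_1 add_pos_nonneg flip: ennreal_1)
      then show ?thesis
        unfolding e using True by (intro order_trans[OF _ add_increasing2[OF zero_le order_refl]]) (auto simp: indicator_def)
    next
      case False
      then have "-1/t \<in> {-1..1}" by (auto simp: field_simps abs_if split: if_splits)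
      moreover have "1 / (1 + t\<^sup>2) \<le> 1 / t\<^sup>2" using False by (intro divide_left_mono) (auto intro!: mult_pos_pos add_pos_nonneg)
      ultimately show ?thesis unfolding e by (intro add_increasing) (auto simp: ennreal_leI)
    qed
  qed
  then have "sqmass unit_density \<le> (\<integral>\<^sup>+t. indicator {-1..1} t + indicator {-1..1} (-1/t) * ennreal (1/t\<^sup>2) \<partial>lborel)"
    unfolding sqmass_def by (intro nn_integral_mono)
  also have "\<dots> = (\<integral>\<^sup>+t. indicator {-1..1::real} t \<partial>lborel) + (\<integral>\<^sup>+t. indicator {-1..1::real} t \<partial>lborel)"
    using inversion_isometry[of "indicator {-1..1}"] by (subst nn_integral_add) auto
  also have "\<dots> = 4" by simp
  finally show ?thesis .
qed

text \<open>Smallness in the mean square sense is turned into smallness at one point of \<open>{0..1}\<close>, since a value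
  at a single point is all that \<open>lognorm_somewhere\<close> needs.\<close>

lemma exists_small_value_iterates:
  fixes f :: "nat \<Rightarrow> real \<Rightarrow> ennreal"
  assumes \<mu>: "prob_space \<mu>" "sets \<mu> = sets borel"
    and f: "\<And>n. f n \<in> borel_measurable borel"
    and rec: "\<And>n t. t \<noteq> 0 \<Longrightarrow> f (Suc n) t = inversion (avg \<mu> (f n)) t"
    and f0: "f 0 = unit_density"
    and A: "A \<in> sets borel" "B \<in> sets borel"
    and AB: "\<And>x y. x \<in> A \<Longrightarrow> y \<in> B \<Longrightarrow> \<bar>x - y\<bar> > 2"
    and t: "0 < t" "t \<le> measure \<mu> A" "t \<le> measure \<mu> B"
  shows "\<exists>s\<in>{0..1}. f n s
      \<le> ennreal (3 * sqrt ((1 + t\<^sup>2/4) / (1 + t\<^sup>2/3)) ^ (n div 2))"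
proof (rule ccontr)
  define \<rho> where "\<rho> = (1 + t\<^sup>2/4) / (1 + t\<^sup>2/3)"
  have \<rho>: "0 < \<rho>" unfolding \<rho>_def by (intro divide_pos_pos add_pos_nonneg) auto
  assume "\<not> (\<exists>s\<in>{0..1}. f n s \<le> ennreal (3 * sqrt ((1 + t\<^sup>2/4) / (1 + t\<^sup>2/3)) ^ (n div 2)))"
  then have *: "ennreal (3 * sqrt \<rho> ^ (n div 2)) \<le> f n s" if "s \<in> {0..1}" for s
    using that by (auto simp: \<rho>_def not_le intro: less_imp_le)
  have "ennreal (9 * \<rho> ^ (n div 2)) = (ennreal (3 * sqrt \<rho> ^ (n div 2)))\<^sup>2"
    using \<rho> by (simp add: ennreal_power power_mult_distrib flip: power_mult power_even_eq)
      (simp add: power_mult mult.commute[of _ 2])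
  also have "\<dots> = (\<integral>\<^sup>+s. (ennreal (3 * sqrt \<rho> ^ (n div 2)))\<^sup>2 * indicator {0..1::real} s \<partial>lborel)"
    by (simp add: nn_integral_cmult)
  also have "\<dots> \<le> sqmass (f n)"
    unfolding sqmass_def using * by (intro nn_integral_mono) (auto simp: indicator_def intro!: power_mono)
  also have "\<dots> \<le> ennreal (\<rho> ^ (n div 2)) * sqmass unit_density"
    unfolding \<rho>_def using sqmass_unit_density
    by (subst f0[symmetric], intro sqmass_iterates[where f = f, OF \<mu> f rec A AB t]) (auto simp: f0 top_unique)
  also have "\<dots> \<le> ennreal (\<rho> ^ (n div 2)) * ennreal 4"
    using sqmass_unit_density by (intro mult_left_mono) auto
  also have "\<dots> = ennreal (4 * \<rho> ^ (n div 2))" using \<rho> by (subst ennreal_mult'[symmetric]) (auto simp: mult.commute)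
  finally show False using \<rho> by (simp add: ennreal_le_iff)
qed

section \<open>The averaging operator of the random walk on the plane\<close>

definition step :: "real \<Rightarrow> real \<times> real \<Rightarrow> real \<times> real" where
  "step x v = (x * fst v - snd v, fst v)"

text \<open>The area form, which every step preserves.\<close>

definition wedge :: "real \<times> real \<Rightarrow> real \<times> real \<Rightarrow> real" where
  "wedge v w = fst v * snd w - snd v * fst w"

lemma wedge_step [simp]: "wedge (step x v) (step x w) = wedge v w"
  by (simp add: wedge_def step_def algebra_simps)

lemma step_eq_0_iff [simp]: "step x v = 0 \<longleftrightarrow> v = 0"
  by (auto simp: step_def prod_eq_iff)

lemma step_0 [simp]: "step x 0 = 0"
  by simp

lemma step_scaleR: "step x (c *\<^sub>R v) = c *\<^sub>R step x v"
  by (simp add: step_def algebra_simps)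

lemma abs_fst_le_norm: "\<bar>fst v\<bar> \<le> norm v" and abs_snd_le_norm: "\<bar>snd v\<bar> \<le> norm v"
  for v :: "real \<times> real"
  by (simp_all add: norm_prod_def)

lemma norm_step_le: "norm (step x v) \<le> (1 + \<bar>x\<bar>) * norm v"
proof -
  have "norm (step x v) = norm ((x * fst v, 0) + (- snd v, fst v))"
    by (simp add: step_def)
  also have "\<dots> \<le> norm (x * fst v, 0::real) + norm (- snd v, fst v)"
    by (rule norm_triangle_ineq)
  also have "norm (- snd v, fst v) = norm v" by (simp add: norm_prod_def add.commute)
  also have "norm (x * fst v, 0::real) = \<bar>x\<bar> * \<bar>fst v\<bar>" by (simp add: norm_prod_def abs_mult)
  also have "\<bar>x\<bar> * \<bar>fst v\<bar> \<le> \<bar>x\<bar> * norm v" by (intro mult_left_mono abs_fst_le_norm) auto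
  finally show ?thesis by (simp add: algebra_simps)
qed

lemma norm_le_step: "norm v \<le> (1 + \<bar>x\<bar>) * norm (step x v)"
proof -
  let ?w = "step x v"
  have "norm v = norm ((0, x * snd ?w) + (snd ?w, - fst ?w))"
    by (simp add: step_def)
  also have "\<dots> \<le> norm (0::real, x * snd ?w) + norm (snd ?w, - fst ?w)"
    by (rule norm_triangle_ineq)
  also have "norm (snd ?w, - fst ?w) = norm ?w" by (simp add: norm_prod_def add.commute)
  also have "norm (0::real, x * snd ?w) = \<bar>x\<bar> * \<bar>snd ?w\<bar>" by (simp add: norm_prod_def abs_mult)
  also have "\<bar>x\<bar> * \<bar>snd ?w\<bar> \<le> \<bar>x\<bar> * norm ?w" by (intro mult_left_mono abs_snd_le_norm) auto
  finally show ?thesis by (simp add: algebra_simps)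
qed

lemma powr_add_le:
  fixes a b p :: real
  assumes "0 < p" "p \<le> 1" "0 \<le> a" "0 \<le> b"
  shows "(a + b) powr p \<le> a powr p + b powr p"
proof (cases "a + b = 0")
  case True
  then show ?thesis using assms by simp
next
  case False
  then have s: "a + b > 0" using assms by simp
  have *: "x / (a + b) \<le> (x / (a + b)) powr p" if "0 \<le> x" "x \<le> a + b" for x
  proof (cases "x = 0")
    case False
    then have "(x / (a + b)) powr 1 \<le> (x / (a + b)) powr p"
      using that s assms by (intro powr_mono') auto
    then show ?thesis using that s by simp
  qed simp
  have "1 = a / (a + b) + b / (a + b)" using s by (simp flip: add_divide_distrib)
  also have "\<dots> \<le> (a / (a + b)) powr p + (b / (a + b)) powr p"
    using assms s by (intro add_mono *) auto
  also have "\<dots> = (a powr p + b powr p) / (a + b) powr p"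
    using assms s by (simp add: powr_divide add_divide_distrib)
  finally show ?thesis using s by (simp add: field_simps)
qed

lemma powr_le_powr_add_neg:
  fixes y s p :: real
  assumes "0 < y" "\<bar>s\<bar> \<le> p"
  shows "y powr s \<le> y powr p + y powr - p"
proof (cases "y \<ge> 1")
  case True
  then have "y powr s \<le> y powr p" using assms by (intro powr_mono) auto
  then show ?thesis by (simp add: add_increasing2)
next
  case False
  then have "y powr s \<le> y powr - p" using assms by (intro powr_mono') auto
  then show ?thesis by (simp add: add_increasing)
qed

lemma ln_le_powr: "ln y \<le> y powr p / p" if "0 < y" "0 < p" for y p :: real
proof -
  have "p * ln y = ln (y powr p)" using that by (simp add: ln_powr)
  also have "\<dots> \<le> y powr p - 1" using that by (intro ln_le_minus_one) auto
  finally show ?thesis using that by (simp add: field_simps)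
qed

lemma measurable_step [measurable (raw)]:
  assumes [measurable]: "f \<in> borel_measurable N" "g \<in> N \<rightarrow>\<^sub>M borel"
  shows "(\<lambda>\<omega>. step (f \<omega>) (g \<omega>)) \<in> N \<rightarrow>\<^sub>M borel"
proof -
  have c: "continuous_on UNIV (\<lambda>p. step (fst p) (snd p))"
    unfolding step_def by (intro continuous_intros)
  have "(\<lambda>\<omega>. (f \<omega>, g \<omega>)) \<in> N \<rightarrow>\<^sub>M borel \<Otimes>\<^sub>M borel" by measurable
  then have "(\<lambda>\<omega>. (f \<omega>, g \<omega>)) \<in> N \<rightarrow>\<^sub>M borel" by (simp add: borel_prod)
  from measurable_compose[OF this borel_measurable_continuous_onI[OF c]] show ?thesis by simp
qed

text \<open>The constant \<open>C\<close> bounds the \<open>p\<close>-th moment.  The numbers defined below, except for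
  \<open>exponent\<close>, depend on \<open>p\<close>, \<open>C\<close> and the parameters of \<open>spread_law\<close>, and not on the measure
  itself; this is how uniformity in the measure is expressed.\<close>

locale potential_law = prob_space \<mu> for \<mu> :: "real measure" +
  fixes p C :: real
  assumes sets_law [measurable_cong]: "sets \<mu> = sets borel"
    and p_pos: "0 < p" and p_le_1: "p \<le> 1" and C_nonneg: "0 \<le> C"
    and moment: "(\<integral>\<^sup>+ x. ennreal (\<bar>x\<bar> powr p) \<partial>\<mu>) \<le> ennreal C"
begin

abbreviation M :: real where "M \<equiv> 1 + C"

lemma integrable_growth: "integrable \<mu> (\<lambda>x. (1 + \<bar>x\<bar>) powr p)"
  and integral_growth: "(\<integral>x. (1 + \<bar>x\<bar>) powr p \<partial>\<mu>) \<le> M"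
proof -
  have le: "(\<integral>\<^sup>+x. ennreal ((1 + \<bar>x\<bar>) powr p) \<partial>\<mu>) \<le> ennreal M"
  proof -
    have "(\<integral>\<^sup>+x. ennreal ((1 + \<bar>x\<bar>) powr p) \<partial>\<mu>) \<le> (\<integral>\<^sup>+x. 1 + ennreal (\<bar>x\<bar> powr p) \<partial>\<mu>)"
    proof (rule nn_integral_mono)
      fix x
      have "(1 + \<bar>x\<bar>) powr p \<le> 1 + \<bar>x\<bar> powr p"
        using powr_add_le[OF p_pos p_le_1, of 1 "\<bar>x\<bar>"] by simp
      then show "ennreal ((1 + \<bar>x\<bar>) powr p) \<le> 1 + ennreal (\<bar>x\<bar> powr p)"
        by (simp add: ennreal_leI flip: ennreal_1 ennreal_plus)
    qed
    also have "\<dots> = 1 + (\<integral>\<^sup>+x. ennreal (\<bar>x\<bar> powr p) \<partial>\<mu>)"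
      by (subst nn_integral_add) (auto simp: emeasure_space_1)
    also have "\<dots> \<le> 1 + ennreal C" using moment by (intro add_left_mono)
    finally show ?thesis using C_nonneg by simp
  qed
  then show I: "integrable \<mu> (\<lambda>x. (1 + \<bar>x\<bar>) powr p)"
    by (intro integrableI_bounded) (auto intro: le_less_trans)
  from le show "(\<integral>x. (1 + \<bar>x\<bar>) powr p \<partial>\<mu>) \<le> M"
    using C_nonneg by (subst (asm) nn_integral_eq_integral[OF I]) (auto simp del: ennreal_plus)
qed

definition weight :: "real \<times> real \<Rightarrow> real" where
  "weight v = norm v powr p + norm v powr - p"

text \<open>The functions on which \<open>Q\<close> is defined by convergent integrals and which \<open>Q\<close> maps to each other:
  a step multiplies \<open>weight\<close> by at most \<open>(1 + \<bar>x\<bar>) powr p\<close>, which is integrable.  The origin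
  is exempt because powers of the norm are singular there and the walk never meets it from elsewhere.\<close>

definition tame :: "(real \<times> real \<Rightarrow> real) \<Rightarrow> bool" where
  "tame F \<longleftrightarrow> F \<in> borel_measurable borel \<and> (\<exists>K. \<forall>v. v \<noteq> 0 \<longrightarrow> \<bar>F v\<bar> \<le> K * weight v)"

definition Q :: "(real \<times> real \<Rightarrow> real) \<Rightarrow> real \<times> real \<Rightarrow> real" where
  "Q F v = (\<integral>x. F (step x v) \<partial>\<mu>)"

lemma weight_ge_1: "1 \<le> weight v" if "v \<noteq> 0"
  using powr_le_powr_add_neg[of "norm v" 0 p] that p_pos by (simp add: weight_def)

text \<open>Positive and negative powers obey the same bound because a step and its inverse have the same norm.\<close>

lemma norm_step_powr_le: "norm (step x v) powr s \<le> (1 + \<bar>x\<bar>) powr p * norm v powr s"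
  if "\<bar>s\<bar> \<le> p"
proof (cases "v = 0")
  case False
  have pos: "0 < norm (step x v)" "0 < norm v" "1 \<le> 1 + \<bar>x\<bar>" using False by auto
  have "norm (step x v) powr s \<le> (1 + \<bar>x\<bar>) powr \<bar>s\<bar> * norm v powr s"
  proof (cases "s \<ge> 0")
    case True
    then have "norm (step x v) powr s \<le> ((1 + \<bar>x\<bar>) * norm v) powr s"
      using norm_step_le by (intro powr_mono2) auto
    then show ?thesis using True by (simp add: powr_mult)
  next
    case s: False
    have "norm v powr - s \<le> ((1 + \<bar>x\<bar>) * norm (step x v)) powr - s"
      using s norm_le_step by (intro powr_mono2) auto
    then have "1 / norm v powr s \<le> (1 + \<bar>x\<bar>) powr - s * (1 / norm (step x v) powr s)"
      by (simp add: powr_mult powr_minus_divide)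
    then show ?thesis using s pos by (simp add: field_simps)
  qed
  also have "\<dots> \<le> (1 + \<bar>x\<bar>) powr p * norm v powr s"
    using that pos by (intro mult_right_mono powr_mono) auto
  finally show ?thesis .
qed simp

lemma weight_step_le: "weight (step x v) \<le> (1 + \<bar>x\<bar>) powr p * weight v"
  using norm_step_powr_le[of p x v] norm_step_powr_le[of "-p" x v] p_pos
  by (simp add: weight_def distrib_left)

lemma tame_integrable: "integrable \<mu> (\<lambda>x. F (step x v))" if F: "tame F"
proof (cases "v = 0")
  case False
  obtain K where K: "\<And>v. v \<noteq> 0 \<Longrightarrow> \<bar>F v\<bar> \<le> K * weight v" and [measurable]: "F \<in> borel_measurable borel"
    using F unfolding tame_def by blast
  have "0 \<le> K" using order_trans[OF abs_ge_zero K[OF False]] weight_ge_1[OF False]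
    by (simp add: zero_le_mult_iff)
  show ?thesis
  proof (rule Bochner_Integration.integrable_bound)
    show "integrable \<mu> (\<lambda>x. (1 + \<bar>x\<bar>) powr p * (K * weight v))"
      using integrable_growth by simp
    show "AE x in \<mu>. norm (F (step x v)) \<le> norm ((1 + \<bar>x\<bar>) powr p * (K * weight v))"
    proof (rule AE_I2)
      fix x
      have "\<bar>F (step x v)\<bar> \<le> K * weight (step x v)" using K False by simp
      also have "\<dots> \<le> K * ((1 + \<bar>x\<bar>) powr p * weight v)"
        using \<open>0 \<le> K\<close> by (intro mult_left_mono weight_step_le)
      also have "\<dots> = (1 + \<bar>x\<bar>) powr p * (K * weight v)" by simp
      finally show "norm (F (step x v)) \<le> norm ((1 + \<bar>x\<bar>) powr p * (K * weight v))" by simp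
    qed
  qed measurable
qed simp

lemma Q_mono:
  assumes "tame F" "tame H" "\<And>v. v \<noteq> 0 \<Longrightarrow> F v \<le> H v" "v \<noteq> 0"
  shows "Q F v \<le> Q H v"
  unfolding Q_def using assms by (intro integral_mono tame_integrable) auto

lemma tame_Q: "tame (Q F)" if F: "tame F"
proof -
  obtain K where K: "\<And>v. v \<noteq> 0 \<Longrightarrow> \<bar>F v\<bar> \<le> K * weight v" and [measurable]: "F \<in> borel_measurable borel"
    using F unfolding tame_def by blast
  have K0: "0 \<le> K" using order_trans[OF abs_ge_zero K[of "(1,0)"]] weight_ge_1[of "(1,0)"]
    by (simp add: zero_le_mult_iff prod_eq_iff)
  have "Q F \<in> borel_measurable borel"
  proof -
    have "(\<lambda>(v, x). F (step x v)) \<in> borel_measurable (borel \<Otimes>\<^sub>M \<mu>)" by measurable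
    then show ?thesis unfolding Q_def by measurable
  qed
  moreover have "\<bar>Q F v\<bar> \<le> (K * M) * weight v" if v: "v \<noteq> 0" for v
  proof -
    have "\<bar>Q F v\<bar> \<le> (\<integral>x. \<bar>F (step x v)\<bar> \<partial>\<mu>)" unfolding Q_def by (rule integral_abs_bound)
    also have "\<dots> \<le> (\<integral>x. (1 + \<bar>x\<bar>) powr p * (K * weight v) \<partial>\<mu>)"
    proof (rule integral_mono)
      show "integrable \<mu> (\<lambda>x. \<bar>F (step x v)\<bar>)" using tame_integrable[OF F] by auto
      show "integrable \<mu> (\<lambda>x. (1 + \<bar>x\<bar>) powr p * (K * weight v))"
        using integrable_growth by simp
      fix x
      have "\<bar>F (step x v)\<bar> \<le> K * weight (step x v)" using K v by simp
      also have "\<dots> \<le> K * ((1 + \<bar>x\<bar>) powr p * weight v)"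
        using K0 by (intro mult_left_mono weight_step_le)
      finally show "\<bar>F (step x v)\<bar> \<le> (1 + \<bar>x\<bar>) powr p * (K * weight v)" by (simp add: mult.left_commute)
    qed
    also have "\<dots> = (\<integral>x. (1 + \<bar>x\<bar>) powr p \<partial>\<mu>) * (K * weight v)" by simp
    also have "\<dots> \<le> M * (K * weight v)"
      using integral_growth K0 weight_ge_1[OF v] by (intro mult_right_mono) auto
    finally show ?thesis by (simp add: ac_simps)
  qed
  ultimately show ?thesis unfolding tame_def by blast
qed

lemma tame_Qn: "tame F \<Longrightarrow> tame ((Q ^^ n) F)"
  by (induction n) (auto intro: tame_Q)

lemma tame_measurable: "tame F \<Longrightarrow> F \<in> borel_measurable borel"
  by (simp add: tame_def)

lemma tame_add: "tame (\<lambda>v. F v + H v)" if FH: "tame F" "tame H"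
proof -
  obtain K L where "\<And>v. v \<noteq> 0 \<Longrightarrow> \<bar>F v\<bar> \<le> K * weight v" "\<And>v. v \<noteq> 0 \<Longrightarrow> \<bar>H v\<bar> \<le> L * weight v"
    using FH unfolding tame_def by meson
  then have "\<bar>F v + H v\<bar> \<le> (K + L) * weight v" if "v \<noteq> 0" for v
    using that abs_triangle_ineq[of "F v" "H v"] by (simp add: distrib_right) (smt (verit))
  then show ?thesis using FH unfolding tame_def by (auto simp del: split_paired_All intro!: exI[of _ "K + L"])
qed

lemma tame_cmult: "tame (\<lambda>v. c * F v)" if F: "tame F"
proof -
  obtain K where K: "\<And>v. v \<noteq> 0 \<Longrightarrow> \<bar>F v\<bar> \<le> K * weight v" using F unfolding tame_def by blast
  then have "\<bar>c * F v\<bar> \<le> (\<bar>c\<bar> * K) * weight v" if "v \<noteq> 0" for v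
    using mult_left_mono[OF K[OF that], of "\<bar>c\<bar>"] by (simp add: abs_mult mult.assoc)
  then show ?thesis using F unfolding tame_def by (auto simp del: split_paired_All intro!: exI[of _ "\<bar>c\<bar> * K"])
qed

lemma tame_diff: "tame (\<lambda>v. F v - H v)" if "tame F" "tame H"
  using tame_add[OF that(1) tame_cmult[OF that(2), of "-1"]] by simp

lemma tame_bounded:
  assumes "F \<in> borel_measurable borel" "\<And>v. v \<noteq> 0 \<Longrightarrow> \<bar>F v\<bar> \<le> K"
  shows "tame F"
proof -
  have "\<bar>F v\<bar> \<le> K * weight v" if "v \<noteq> 0" for v
    using assms(2)[OF that] weight_ge_1[OF that] mult_left_mono[OF weight_ge_1[OF that], of K] by fastforce
  then show ?thesis using assms unfolding tame_def by blast
qed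

lemma tame_const: "tame (\<lambda>v. c)"
  by (rule tame_bounded[of _ "\<bar>c\<bar>"]) auto

lemma Q_add: "tame F \<Longrightarrow> tame H \<Longrightarrow> Q (\<lambda>v. F v + H v) = (\<lambda>v. Q F v + Q H v)"
  unfolding Q_def by (intro ext Bochner_Integration.integral_add tame_integrable)

lemma Q_diff: "tame F \<Longrightarrow> tame H \<Longrightarrow> Q (\<lambda>v. F v - H v) = (\<lambda>v. Q F v - Q H v)"
  unfolding Q_def by (intro ext Bochner_Integration.integral_diff tame_integrable)

lemma Q_cmult: "Q (\<lambda>v. c * F v) = (\<lambda>v. c * Q F v)"
  unfolding Q_def by simp

lemma Q_const: "Q (\<lambda>v. c) = (\<lambda>v. c)"
  unfolding Q_def by (simp add: prob_space)

lemma Qn_add: "tame F \<Longrightarrow> tame H \<Longrightarrow> (Q ^^ n) (\<lambda>v. F v + H v) = (\<lambda>v. (Q ^^ n) F v + (Q ^^ n) H v)"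
  by (induction n) (auto simp: Q_add tame_Qn)

lemma Qn_diff: "tame F \<Longrightarrow> tame H \<Longrightarrow> (Q ^^ n) (\<lambda>v. F v - H v) = (\<lambda>v. (Q ^^ n) F v - (Q ^^ n) H v)"
  by (induction n) (auto simp: Q_diff tame_Qn)

lemma Qn_cmult: "(Q ^^ n) (\<lambda>v. c * F v) = (\<lambda>v. c * (Q ^^ n) F v)"
  by (induction n) (auto simp: Q_cmult)

lemma Qn_const: "(Q ^^ n) (\<lambda>v. c) = (\<lambda>v. c)"
  by (induction n) (auto simp: Q_const)

lemma Qn_mono:
  assumes "tame F" "tame H" "\<And>v. v \<noteq> 0 \<Longrightarrow> F v \<le> H v" "v \<noteq> 0"
  shows "(Q ^^ n) F v \<le> (Q ^^ n) H v"
  using assms(4)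
proof (induction n arbitrary: v)
  case (Suc n)
  then show ?case using assms by (auto intro: Q_mono tame_Qn)
qed (use assms in auto)

lemma tame_norm_powr: "tame (\<lambda>v. norm v powr s)" if "\<bar>s\<bar> \<le> p"
  unfolding tame_def
proof (intro conjI exI[of _ 1] allI impI)
  fix v :: "real \<times> real" assume "v \<noteq> 0"
  then show "\<bar>norm v powr s\<bar> \<le> 1 * weight v"
    using powr_le_powr_add_neg[of "norm v" s p] that by (simp add: weight_def)
qed measurable

lemma Q_norm_powr_le: "Q (\<lambda>v. norm v powr s) v \<le> M * norm v powr s" if "\<bar>s\<bar> \<le> p"
proof -
  have "Q (\<lambda>v. norm v powr s) v \<le> (\<integral>x. (1 + \<bar>x\<bar>) powr p * norm v powr s \<partial>\<mu>)"
    unfolding Q_def using that integrable_growth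
    by (intro integral_mono tame_integrable tame_norm_powr norm_step_powr_le) auto
  also have "\<dots> = (\<integral>x. (1 + \<bar>x\<bar>) powr p \<partial>\<mu>) * norm v powr s" by simp
  also have "\<dots> \<le> M * norm v powr s"
    using integral_growth by (intro mult_right_mono) auto
  finally show ?thesis .
qed

lemma Qn_norm_powr_le: "(Q ^^ n) (\<lambda>v. norm v powr s) v \<le> M ^ n * norm v powr s"
  if "\<bar>s\<bar> \<le> p" "v \<noteq> 0"
  using that(2)
proof (induction n arbitrary: v)
  case (Suc n)
  have "(Q ^^ Suc n) (\<lambda>v. norm v powr s) v \<le> Q (\<lambda>v. M ^ n * norm v powr s) v"
    using Suc that by (auto intro!: Q_mono tame_Qn tame_cmult tame_norm_powr)
  also have "\<dots> = M ^ n * Q (\<lambda>v. norm v powr s) v" by (simp add: Q_cmult)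
  also have "\<dots> \<le> M ^ n * (M * norm v powr s)"
    using C_nonneg that by (intro mult_left_mono Q_norm_powr_le) auto
  finally show ?case by (simp add: ac_simps)
qed simp

abbreviation lognorm :: "real \<times> real \<Rightarrow> real" where "lognorm \<equiv> \<lambda>v. ln (norm v)"

lemma tame_lognorm: "tame lognorm"
  unfolding tame_def
proof (intro conjI exI[of _ "1/p"] allI impI)
  fix v :: "real \<times> real" assume v: "v \<noteq> 0"
  have "ln (norm v) \<le> norm v powr p / p" using v p_pos by (intro ln_le_powr) auto
  moreover have "- ln (norm v) \<le> norm v powr - p / p"
    using ln_le_powr[of "1 / norm v" p] v p_pos by (simp add: ln_div powr_divide powr_minus_divide)
  moreover have "0 \<le> norm v powr p / p" "0 \<le> norm v powr - p / p" using p_pos by auto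
  ultimately show "\<bar>ln (norm v)\<bar> \<le> 1 / p * weight v"
    by (simp add: weight_def add_divide_distrib)
qed measurable

lemma abs_lognorm_step_le: "\<bar>lognorm (step x v) - lognorm v\<bar> \<le> ln (1 + \<bar>x\<bar>)" if "v \<noteq> 0"
proof -
  have pos: "0 < norm v" "0 < norm (step x v)" using that by auto
  have "ln (norm (step x v)) \<le> ln ((1 + \<bar>x\<bar>) * norm v)" using norm_step_le pos by (subst ln_le_cancel_iff) auto
  moreover have "ln (norm v) \<le> ln ((1 + \<bar>x\<bar>) * norm (step x v))"
    using norm_le_step pos by (subst ln_le_cancel_iff) auto
  moreover have "1 + \<bar>x\<bar> \<noteq> 0" by linarith
  ultimately show ?thesis using pos by (simp add: ln_mult)
qed

definition drift :: "real \<times> real \<Rightarrow> real" where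
  "drift v = Q lognorm v - lognorm v"

lemma drift_eq_integral: "drift v = (\<integral>x. lognorm (step x v) - lognorm v \<partial>\<mu>)"
  unfolding drift_def Q_def using tame_integrable[OF tame_lognorm] by (simp add: prob_space)

lemma abs_drift_le: "\<bar>drift v\<bar> \<le> M / p" if "v \<noteq> 0"
proof -
  have "\<bar>drift v\<bar> \<le> (\<integral>x. \<bar>lognorm (step x v) - lognorm v\<bar> \<partial>\<mu>)"
    unfolding drift_eq_integral by (rule integral_abs_bound)
  also have "\<dots> \<le> (\<integral>x. (1 + \<bar>x\<bar>) powr p / p \<partial>\<mu>)"
  proof (rule integral_mono)
    show "integrable \<mu> (\<lambda>x. \<bar>lognorm (step x v) - lognorm v\<bar>)"
      using tame_integrable[OF tame_lognorm] by auto
    show "integrable \<mu> (\<lambda>x. (1 + \<bar>x\<bar>) powr p / p)" using integrable_growth by simp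
    show "\<bar>lognorm (step x v) - lognorm v\<bar> \<le> (1 + \<bar>x\<bar>) powr p / p" for x
      using p_pos by (intro order_trans[OF abs_lognorm_step_le[OF that] ln_le_powr]) auto
  qed
  also have "\<dots> \<le> M / p" using integral_growth p_pos by (simp add: divide_right_mono)
  finally show ?thesis .
qed

lemma tame_drift: "tame drift"
  unfolding drift_def by (intro tame_diff tame_Q tame_lognorm)

definition gain :: "nat \<Rightarrow> real \<times> real \<Rightarrow> real" where
  "gain n v = (Q ^^ n) lognorm v - lognorm v"

lemma tame_gain: "tame (gain n)"
  unfolding gain_def by (intro tame_diff tame_Qn tame_lognorm)

lemma gain_0 [simp]: "gain 0 v = 0"
  by (simp add: gain_def)

lemma gain_Suc: "gain (Suc n) v = drift v + Q (gain n) v"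
  unfolding gain_def by (subst Q_diff) (auto simp: drift_def tame_Qn tame_lognorm)

lemma gain_Suc': "gain (Suc n) v = gain n v + (Q ^^ n) drift v"
  unfolding gain_def drift_def
  by (subst Qn_diff) (auto simp: tame_Q tame_lognorm funpow_swap1)

end

section \<open>Linear growth of the expected logarithm\<close>

lemma abs_wedge_le: "\<bar>wedge v w\<bar> \<le> norm v * norm w"
proof -
  have "wedge v w = (fst v, snd v) \<bullet> (snd w, - fst w)"
    by (simp add: wedge_def inner_prod_def)
  also have "\<bar>\<dots>\<bar> \<le> norm (fst v, snd v) * norm (snd w, - fst w)" by (rule Cauchy_Schwarz_ineq2)
  also have "norm (snd w, - fst w) = norm w" by (simp add: norm_prod_def add.commute)
  finally show ?thesis by simp
qed

lemma wedge_three_term: "wedge u v *\<^sub>R z = wedge z v *\<^sub>R u + wedge u z *\<^sub>R v"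
  by (simp add: wedge_def prod_eq_iff algebra_simps)

lemma abs_wedge_commute: "\<bar>wedge v w\<bar> = \<bar>wedge w v\<bar>"
  by (simp add: wedge_def abs_minus_commute mult.commute)

lemma wedge_0 [simp]: "wedge 0 v = 0" "wedge v 0 = 0"
  by (simp_all add: wedge_def)

text \<open>In the plane \<open>z\<close> is a combination of \<open>u\<close> and \<open>v\<close> with coefficients given by areas.  Areas are
  invariant under the walk, so that the estimate persists along it.\<close>

lemma norm_le_of_wedge:
  assumes "d \<le> \<bar>wedge u v\<bar>" "\<bar>wedge z u\<bar> \<le> K" "\<bar>wedge z v\<bar> \<le> K"
  shows "d * norm z \<le> K * (norm u + norm v)"
proof -
  have "d * norm z \<le> \<bar>wedge u v\<bar> * norm z" using assms by (intro mult_right_mono) auto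
  also have "\<dots> = norm (wedge z v *\<^sub>R u + wedge u z *\<^sub>R v)"
    by (simp flip: wedge_three_term)
  also have "\<dots> \<le> \<bar>wedge z v\<bar> * norm u + \<bar>wedge u z\<bar> * norm v"
    by (rule norm_triangle_le) simp
  also have "\<dots> \<le> K * norm u + K * norm v"
    using assms abs_wedge_commute[of u z] by (intro add_mono mult_right_mono) auto
  finally show ?thesis by (simp add: distrib_left)
qed

lemma product_ge_aux:
  fixes r1 r2 r3 r d K :: real
  assumes pos: "0 < r1" "0 < r2" "0 < r3" "0 < r" "0 < d" "0 < K"
    and ord: "r3 \<le> r2" "r2 \<le> r1"
    and w: "d * r \<le> K * (r2 + r3)" "d \<le> r1 * r3"
  shows "r * (d\<^sup>2 / (2 * K)) \<le> r1 * r2 * r3"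
proof -
  have "d * r \<le> K * (2 * r2)" using w(1) ord(1) pos by (smt (verit) mult_left_mono)
  then have "d * (d * r) \<le> d * (K * (2 * r2))" using pos by (intro mult_left_mono) auto
  also have "\<dots> \<le> (r1 * r3) * (K * (2 * r2))" using w pos by (intro mult_right_mono) auto
  finally show ?thesis using pos by (simp add: field_simps power2_eq_square)
qed

text \<open>Among three vectors with areas at least \<open>d\<close>, the two longest are not much shorter than \<open>z\<close>, by
  \<open>norm_le_of_wedge\<close>, and the shortest is at least \<open>d\<close> over the longest.  Two vectors would
  not be enough: the short one could then cancel all that is gained from the long one.\<close>

lemma three_vectors:
  assumes d: "0 < d" and K: "0 < K" and z: "z \<noteq> 0"
    and "d \<le> \<bar>wedge u v\<bar>" "d \<le> \<bar>wedge u w\<bar>" "d \<le> \<bar>wedge v w\<bar>"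
    and "\<bar>wedge z u\<bar> \<le> K" "\<bar>wedge z v\<bar> \<le> K" "\<bar>wedge z w\<bar> \<le> K"
  shows "ln (norm z) + ln (d\<^sup>2 / (2 * K)) \<le> ln (norm u) + ln (norm v) + ln (norm w)"
proof -
  have nz: "u \<noteq> 0" "v \<noteq> 0" "w \<noteq> 0" using assms by auto
  have pr: "d \<le> norm u * norm v" "d \<le> norm u * norm w" "d \<le> norm v * norm w"
    using assms abs_wedge_le order_trans by meson+
  have su: "d * norm z \<le> K * (norm u + norm v)" "d * norm z \<le> K * (norm u + norm w)"
    "d * norm z \<le> K * (norm v + norm w)"
    using assms norm_le_of_wedge by auto
  have pos: "0 < norm u" "0 < norm v" "0 < norm w" "0 < norm z" using nz z by auto
  have "norm z * (d\<^sup>2 / (2 * K)) \<le> norm u * norm v * norm w"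
  proof -
    have sorted: "norm z * (d\<^sup>2 / (2 * K)) \<le> norm r1 * norm r2 * norm r3"
      if "r1 \<in> {u, v, w}" "r2 \<in> {u, v, w}" "r3 \<in> {u, v, w}" "norm r3 \<le> norm r2" "norm r2 \<le> norm r1"
        "d * norm z \<le> K * (norm r2 + norm r3)" "d \<le> norm r1 * norm r3" for r1 r2 r3
      using that pos d K by (intro product_ge_aux) auto
    consider "norm w \<le> norm v" "norm v \<le> norm u" | "norm v \<le> norm w" "norm w \<le> norm u"
      | "norm w \<le> norm u" "norm u \<le> norm v" | "norm u \<le> norm w" "norm w \<le> norm v"
      | "norm v \<le> norm u" "norm u \<le> norm w" | "norm u \<le> norm v" "norm v \<le> norm w"
      by linarith
    then show ?thesis
      by cases (use sorted[of u v w] sorted[of u w v] sorted[of v u w] sorted[of v w u] sorted[of w u v]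
          sorted[of w v u] pr su in \<open>simp_all add: ac_simps insert_commute\<close>)
  qed
  then have "ln (norm z * (d\<^sup>2 / (2 * K))) \<le> ln (norm u * norm v * norm w)"
    using pos d K by (subst ln_le_cancel_iff) auto
  moreover have "ln (norm z * (d\<^sup>2 / (2 * K))) = ln (norm z) + ln (d\<^sup>2 / (2 * K))"
    using pos d K by (intro ln_mult_pos) auto
  moreover have "ln (norm u * norm v * norm w) = ln (norm u) + ln (norm v) + ln (norm w)"
    using pos by (simp add: ln_mult_pos)
  ultimately show ?thesis by simp
qed

text \<open>The ratio under the roots is the one by which two averaged steps contract the square mass; one
  root passes to the norm, the other one to a single step.\<close>

definition gap_rate :: "real \<Rightarrow> real" where
  "gap_rate t = sqrt (sqrt ((1 + t\<^sup>2/4) / (1 + t\<^sup>2/3)))"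

lemma gap_rate_pos: "0 < gap_rate t" and gap_rate_less_1: "t \<noteq> 0 \<Longrightarrow> gap_rate t < 1"
proof -
  have "0 < 1 + t\<^sup>2/4" "0 < 1 + t\<^sup>2/3" by (auto intro: add_pos_nonneg)
  then show "0 < gap_rate t" unfolding gap_rate_def by simp
  assume "t \<noteq> 0"
  then have "0 < t\<^sup>2" by simp
  then have "1 + t\<^sup>2/4 < 1 + t\<^sup>2/3" by linarith
  then have "(1 + t\<^sup>2/4) / (1 + t\<^sup>2/3) < 1" using \<open>0 < 1 + t\<^sup>2/3\<close> by (subst divide_less_eq_1_pos) auto
  then show "gap_rate t < 1" unfolding gap_rate_def by simp
qed

context potential_law
begin

text \<open>The operator \<open>Q\<close> for nonnegative functions that need not be integrable, such as \<open>invnorm\<close>.\<close>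

definition qplus :: "(real \<times> real \<Rightarrow> ennreal) \<Rightarrow> real \<times> real \<Rightarrow> ennreal" where
  "qplus F v = (\<integral>\<^sup>+x. F (step x v) \<partial>\<mu>)"

definition invnorm :: "real \<times> real \<Rightarrow> ennreal" where
  "invnorm v = ennreal (1 / norm v)"

lemma measurable_qplus: "F \<in> borel_measurable borel \<Longrightarrow> qplus F \<in> borel_measurable borel"
proof -
  assume [measurable]: "F \<in> borel_measurable borel"
  have "(\<lambda>(v, x). F (step x v)) \<in> borel_measurable (borel \<Otimes>\<^sub>M \<mu>)" by measurable
  then show ?thesis unfolding qplus_def by measurable
qed

lemma measurable_qplusn: "F \<in> borel_measurable borel \<Longrightarrow> (qplus ^^ n) F \<in> borel_measurable borel"
  by (induction n) (auto intro: measurable_qplus)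

lemma qplus_mono:
  assumes "\<And>v. v \<noteq> 0 \<Longrightarrow> F v \<le> H v" "v \<noteq> 0"
  shows "qplus F v \<le> qplus H v"
  unfolding qplus_def using assms by (intro nn_integral_mono) auto

lemma qplusn_mono:
  assumes "\<And>v. v \<noteq> 0 \<Longrightarrow> F v \<le> H v" "v \<noteq> 0"
  shows "(qplus ^^ n) F v \<le> (qplus ^^ n) H v"
  using assms(2)
proof (induction n arbitrary: v)
  case (Suc n)
  then show ?case by (auto intro: qplus_mono)
qed (use assms in auto)

lemma qplusn_affine:
  assumes F: "F \<in> borel_measurable borel"
  shows "(qplus ^^ n) (\<lambda>v. a + b * F v) = (\<lambda>v. a + b * (qplus ^^ n) F v)"
proof (induction n)
  case (Suc n)
  have [measurable]: "(qplus ^^ n) F \<in> borel_measurable borel" by (rule measurable_qplusn[OF F])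
  have "qplus (\<lambda>v. a + b * (qplus ^^ n) F v) = (\<lambda>v. a + b * qplus ((qplus ^^ n) F) v)"
    by (intro ext) (simp add: qplus_def[of "\<lambda>v. a + b * (qplus ^^ n) F v"] qplus_def[of "(qplus ^^ n) F"]
      nn_integral_add nn_integral_cmult emeasure_space_1)
  then show ?case using Suc by simp
qed simp

lemma Qn_nonneg:
  assumes "\<And>v. 0 \<le> F v"
  shows "0 \<le> (Q ^^ n) F v"
proof (induction n arbitrary: v)
  case (Suc n)
  then show ?case by (simp add: Q_def)
qed (use assms in simp)

lemma ennreal_Qn:
  assumes F: "tame F" "\<And>v. 0 \<le> F v"
  shows "ennreal ((Q ^^ n) F v) = (qplus ^^ n) (\<lambda>v. ennreal (F v)) v"
proof (induction n arbitrary: v)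
  case (Suc n)
  have "(qplus ^^ Suc n) (\<lambda>v. ennreal (F v)) v = (\<integral>\<^sup>+x. ennreal ((Q ^^ n) F (step x v)) \<partial>\<mu>)"
    by (simp add: qplus_def[of "(qplus ^^ n) F" for F] Suc)
  also have "\<dots> = ennreal ((Q ^^ Suc n) F v)"
    by (subst nn_integral_eq_integral) (auto simp: Q_def intro!: tame_integrable tame_Qn Qn_nonneg F)
  finally show ?case by simp
qed simp

lemma invnorm_measurable: "invnorm \<in> borel_measurable borel"
  unfolding invnorm_def by measurable

lemma qplusn_invnorm_scaleR:
  "(qplus ^^ n) invnorm (c *\<^sub>R v) = ennreal (1 / \<bar>c\<bar>) * (qplus ^^ n) invnorm v"
proof (induction n arbitrary: v)
  case 0
  show ?case by (simp add: invnorm_def flip: ennreal_mult)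
next
  case (Suc n)
  have [measurable]: "(qplus ^^ n) invnorm \<in> borel_measurable borel"
    by (intro measurable_qplusn invnorm_measurable)
  show ?case by (simp add: qplus_def[of "(qplus ^^ n) invnorm"] step_scaleR Suc nn_integral_cmult)
qed

lemma qplusn_invnorm_chart:
  assumes "t \<noteq> 0"
  shows "(qplus ^^ Suc n) invnorm (t, 1) = inversion (avg \<mu> (\<lambda>s. (qplus ^^ n) invnorm (s, 1))) t"
proof -
  have [measurable]: "(qplus ^^ n) invnorm \<in> borel_measurable borel"
    by (intro measurable_qplusn invnorm_measurable)
  have "step x (t, 1) = t *\<^sub>R (- 1 / t + x, 1)" for x
    using assms by (simp add: step_def field_simps)
  then have "(qplus ^^ Suc n) invnorm (t, 1)
      = (\<integral>\<^sup>+x. ennreal (1 / \<bar>t\<bar>) * (qplus ^^ n) invnorm (- 1 / t + x, 1) \<partial>\<mu>)"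
    by (simp only: funpow.simps o_apply qplus_def[of "(qplus ^^ n) invnorm"] qplusn_invnorm_scaleR)
  also have "\<dots> = inversion (avg \<mu> (\<lambda>s. (qplus ^^ n) invnorm (s, 1))) t"
    by (subst nn_integral_cmult) (auto simp: inversion_def avg_def mult.commute)
  finally show ?thesis .
qed

text \<open>The spectral gap gives a direction in which the mean of \<open>1/\<parallel>A\<^sup>n u\<parallel>\<close> is exponentially small.  Only
  powers with exponents up to \<open>p\<close> are known to be integrable at each direction, so \<open>\<parallel>A\<^sup>n u\<parallel>\<^sup>-\<^sup>p\<close> is first bounded
  by a linear function of \<open>1/\<parallel>A\<^sup>n u\<parallel>\<close>; Jensen's inequality, in the form of a tangent to the
  logarithm, does the rest.\<close>

lemma lognorm_somewhere:
  assumes A: "A \<in> sets borel" "B \<in> sets borel"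
    and AB: "\<And>x y. x \<in> A \<Longrightarrow> y \<in> B \<Longrightarrow> \<bar>x - y\<bar> > 2"
    and t: "0 < t" "t \<le> measure \<mu> A" "t \<le> measure \<mu> B"
  shows "\<exists>s\<in>{0..1}. real n * (- ln (gap_rate t)) - 3 / (gap_rate t * p) \<le> (Q ^^ n) lognorm (s, 1)"
proof -
  define \<kappa> where "\<kappa> = gap_rate t"
  have \<kappa>: "0 < \<kappa>" "\<kappa> < 1" using gap_rate_pos gap_rate_less_1 t by (auto simp: \<kappa>_def)
  define K where "K = 3 / \<kappa>"
  have K: "0 < K" using \<kappa> by (simp add: K_def)
  have "\<exists>s\<in>{0..1}. (qplus ^^ n) invnorm (s, 1) \<le> ennreal (3 * sqrt ((1 + t\<^sup>2/4) / (1 + t\<^sup>2/3)) ^ (n div 2))"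
  proof (rule exists_small_value_iterates[where f = "\<lambda>n s. (qplus ^^ n) invnorm (s, 1)", OF _ sets_law _ _ _ A AB t])
    show "prob_space \<mu>" by unfold_locales
    fix n
    have [measurable]: "(qplus ^^ n) invnorm \<in> borel_measurable borel"
      by (intro measurable_qplusn invnorm_measurable)
    show "(\<lambda>s. (qplus ^^ n) invnorm (s, 1)) \<in> borel_measurable borel" by measurable
  next
    show "(\<lambda>s. (qplus ^^ 0) invnorm (s, 1)) = unit_density"
      by (auto simp: invnorm_def unit_density_def norm_prod_def add.commute)
  qed (rule qplusn_invnorm_chart)
  then obtain s where s: "s \<in> {0..1}"
    and "(qplus ^^ n) invnorm (s, 1) \<le> ennreal (3 * sqrt ((1 + t\<^sup>2/4) / (1 + t\<^sup>2/3)) ^ (n div 2))"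
    by blast
  note this(2)
  also have "sqrt ((1 + t\<^sup>2/4) / (1 + t\<^sup>2/3)) = \<kappa>\<^sup>2"
    unfolding \<kappa>_def gap_rate_def by (subst real_sqrt_pow2) (auto intro!: divide_nonneg_pos add_nonneg_nonneg add_pos_nonneg)
  also have "3 * \<kappa>\<^sup>2 ^ (n div 2) \<le> K * \<kappa> ^ n"
  proof -
    have "\<kappa> * \<kappa>\<^sup>2 ^ (n div 2) = \<kappa> ^ Suc (2 * (n div 2))" by (simp add: power_mult)
    also have "\<dots> \<le> \<kappa> ^ n" using \<kappa> by (intro power_decreasing) auto
    finally show ?thesis using \<kappa> by (simp add: K_def field_simps)
  qed
  finally have small: "(qplus ^^ n) invnorm (s, 1) \<le> ennreal (K * \<kappa> ^ n)" by (simp add: ennreal_leI)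
  let ?u = "(s, 1) :: real \<times> real"
  have u: "?u \<noteq> 0" by (simp add: prod_eq_iff)
  \<comment> \<open>The expected size of the reciprocal norm, at which the two terms of the next bound balance.\<close>
  define h where "h = \<kappa> ^ n"
  have h: "0 < h" using \<kappa> by (simp add: h_def)
  have pw: "norm v powr - p \<le> h powr p + h powr (p - 1) * (1 / norm v)" if "v \<noteq> 0" for v :: "real \<times> real"
  proof (cases "1 / norm v \<le> h")
    case True
    have "norm v powr - p = (1 / norm v) powr p" using that by (simp add: powr_divide powr_minus_divide)
    also have "\<dots> \<le> h powr p" using True p_pos by (intro powr_mono2) auto
    finally show ?thesis by (simp add: add_increasing2)
  next
    case False
    have "norm v powr - p = (1 / norm v) powr (p - 1) * (1 / norm v)"
      using that by (simp add: powr_divide powr_diff powr_minus_divide)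
    also have "\<dots> \<le> h powr (p - 1) * (1 / norm v)"
      using False h p_le_1 that by (intro mult_right_mono powr_mono2') auto
    finally show ?thesis by (simp add: add_increasing)
  qed
  have "ennreal ((Q ^^ n) (\<lambda>v. norm v powr - p) ?u) = (qplus ^^ n) (\<lambda>v. ennreal (norm v powr - p)) ?u"
    using p_pos by (intro ennreal_Qn tame_norm_powr) auto
  also have "\<dots> \<le> (qplus ^^ n) (\<lambda>v. ennreal (h powr p) + ennreal (h powr (p - 1)) * invnorm v) ?u"
  proof (rule qplusn_mono[OF _ u])
    fix v :: "real \<times> real" assume "v \<noteq> 0"
    then show "ennreal (norm v powr - p) \<le> ennreal (h powr p) + ennreal (h powr (p - 1)) * invnorm v"
      using pw[of v] by (simp add: invnorm_def ennreal_leI flip: ennreal_mult ennreal_plus)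
  qed
  also have "\<dots> = ennreal (h powr p) + ennreal (h powr (p - 1)) * (qplus ^^ n) invnorm ?u"
    by (simp only: qplusn_affine[OF invnorm_measurable])
  also have "\<dots> \<le> ennreal (h powr p) + ennreal (h powr (p - 1)) * ennreal (K * h)"
    using small by (intro add_left_mono mult_left_mono) (auto simp: h_def)
  also have "\<dots> = ennreal (h powr p * (1 + K))"
    using h K by (simp add: powr_diff algebra_simps flip: ennreal_mult ennreal_plus)
  finally have neg: "(Q ^^ n) (\<lambda>v. norm v powr - p) ?u \<le> h powr p * (1 + K)"
    using h K by (subst (asm) ennreal_le_iff) auto
  \<comment> \<open>The tangent to the logarithm is taken at \<open>h powr p\<close>.\<close>
  define a where "a = - p * ln h"
  have ea: "exp a * h powr p = 1" using h by (simp add: a_def powr_def exp_minus flip: exp_add)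
  have "(Q ^^ n) (\<lambda>v. (1 + a) / p + (- exp a / p) * norm v powr - p) ?u \<le> (Q ^^ n) lognorm ?u"
  proof (rule Qn_mono[OF _ tame_lognorm _ u])
    show "tame (\<lambda>v. (1 + a) / p + (- exp a / p) * norm v powr - p)"
      using p_pos by (intro tame_add tame_const tame_cmult tame_norm_powr) auto
    fix v :: "real \<times> real" assume v: "v \<noteq> 0"
    have "ln (exp a * norm v powr - p) = a - p * ln (norm v)"
      using v by (simp add: ln_mult_pos ln_powr)
    moreover have "ln (exp a * norm v powr - p) \<le> exp a * norm v powr - p - 1"
      using v by (intro ln_le_minus_one) auto
    ultimately have "1 + a - exp a * norm v powr - p \<le> p * ln (norm v)" by simp
    then have "(1 + a - exp a * norm v powr - p) / p \<le> ln (norm v)"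
      using p_pos by (simp add: pos_divide_le_eq mult.commute)
    then show "(1 + a) / p + (- exp a / p) * norm v powr - p \<le> ln (norm v)"
      by (simp add: diff_divide_distrib)
  qed
  also have "(Q ^^ n) (\<lambda>v. (1 + a) / p + (- exp a / p) * norm v powr - p) ?u
      = (1 + a) / p + (- exp a / p) * (Q ^^ n) (\<lambda>v. norm v powr - p) ?u"
  proof -
    have tN: "tame (\<lambda>v. norm v powr - p)" using p_pos by (intro tame_norm_powr) auto
    show ?thesis unfolding Qn_add[OF tame_const tame_cmult[OF tN]] Qn_const Qn_cmult by (rule refl)
  qed
  finally have "(1 + a) / p - (exp a * (Q ^^ n) (\<lambda>v. norm v powr - p) ?u) / p \<le> (Q ^^ n) lognorm ?u"
    by simp
  moreover have "exp a * (Q ^^ n) (\<lambda>v. norm v powr - p) ?u \<le> exp a * (h powr p * (1 + K))"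
    by (intro mult_left_mono neg) auto
  ultimately have "(1 + a) / p - (1 + K) / p \<le> (Q ^^ n) lognorm ?u"
    using p_pos ea by (simp add: divide_right_mono flip: mult.assoc) (smt (verit) divide_right_mono)
  moreover have "(1 + a) / p - (1 + K) / p = real n * (- ln \<kappa>) - 3 / (\<kappa> * p)"
    using p_pos \<kappa> by (simp add: a_def h_def K_def ln_realpow diff_divide_distrib add_divide_distrib)
  ultimately show ?thesis using s unfolding \<kappa>_def by (intro bexI[of _ s]) auto
qed

text \<open>The hypotheses on areas are preserved by a common step, so \<open>three_vectors\<close> can be integrated.\<close>

lemma Qn_lognorm_three_vectors:
  assumes d: "0 < d" and K: "0 < K"
    and "z \<noteq> 0"
    and "d \<le> \<bar>wedge u v\<bar>" "d \<le> \<bar>wedge u w\<bar>" "d \<le> \<bar>wedge v w\<bar>"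
    and "\<bar>wedge z u\<bar> \<le> K" "\<bar>wedge z v\<bar> \<le> K" "\<bar>wedge z w\<bar> \<le> K"
  shows "(Q ^^ n) lognorm z + ln (d\<^sup>2 / (2 * K))
      \<le> (Q ^^ n) lognorm u + (Q ^^ n) lognorm v + (Q ^^ n) lognorm w"
  using assms(3-)
proof (induction n arbitrary: u v w z)
  case 0
  then show ?case using three_vectors[OF d K, of z u v w] by simp
next
  case (Suc n)
  have I: "integrable \<mu> (\<lambda>x. (Q ^^ n) lognorm (step x y))" for y
    by (intro tame_integrable tame_Qn tame_lognorm)
  have "(\<integral>x. (Q ^^ n) lognorm (step x z) + ln (d\<^sup>2 / (2 * K)) \<partial>\<mu>)
      \<le> (\<integral>x. (Q ^^ n) lognorm (step x u) + (Q ^^ n) lognorm (step x v) + (Q ^^ n) lognorm (step x w) \<partial>\<mu>)"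
    using Suc I by (intro integral_mono Bochner_Integration.integrable_add) auto
  then show ?case using I by (simp add: Q_def[of "(Q ^^ n) lognorm"] prob_space)
qed

lemma gain_eq_sum: "gain n v = (\<Sum>k<n. (Q ^^ k) drift v)"
  by (induction n) (auto simp: gain_Suc')

lemma drift_scaleR: "drift (c *\<^sub>R v) = drift v" if "c \<noteq> 0"
proof (cases "v = 0")
  case False
  have "lognorm (step x (c *\<^sub>R v)) - lognorm (c *\<^sub>R v) = lognorm (step x v) - lognorm v" for x
    using False that by (simp add: step_scaleR ln_mult_pos)
  then show ?thesis by (simp add: drift_eq_integral)
qed simp

lemma Qn_drift_scaleR: "(Q ^^ n) drift (c *\<^sub>R v) = (Q ^^ n) drift v" if "c \<noteq> 0"
proof (induction n arbitrary: v)
  case 0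
  then show ?case using that by (simp add: drift_scaleR)
next
  case (Suc n)
  then show ?case by (simp add: Q_def[of "(Q ^^ n) drift"] step_scaleR)
qed

lemma gain_scaleR: "gain n (c *\<^sub>R v) = gain n v" if "c \<noteq> 0"
  using that by (simp add: gain_eq_sum Qn_drift_scaleR)

text \<open>If three sets have mass at least \<open>t\<close>, then a part \<open>t\<close> of the masses of all three can be matched
  with each other, and for the rest the trivial lower bound is used.\<close>

lemma integral_ge_three_sets:
  fixes f :: "real \<Rightarrow> real"
  assumes f: "integrable \<mu> f" and l: "\<And>x. l \<le> f x"
    and B[measurable]: "B1 \<in> sets borel" "B2 \<in> sets borel" "B3 \<in> sets borel"
    and disj: "B1 \<inter> B2 = {}" "B1 \<inter> B3 = {}" "B2 \<inter> B3 = {}"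
    and t: "0 < t" "t \<le> prob B1" "t \<le> prob B2" "t \<le> prob B3"
    and T: "\<And>x y z. x \<in> B1 \<Longrightarrow> y \<in> B2 \<Longrightarrow> z \<in> B3 \<Longrightarrow> T \<le> f x + f y + f z"
  shows "l + t * (T - 3 * l) \<le> (\<integral>x. f x \<partial>\<mu>)"
proof -
  define m where "m B = Inf (f ` B)" for B
  have bdd: "bdd_below (f ` B)" for B using l by (intro bdd_belowI2)
  have ne: "B1 \<noteq> {}" "B2 \<noteq> {}" "B3 \<noteq> {}" using t by auto
  have ml: "l \<le> m B" if "B \<noteq> {}" for B using that l by (auto simp: m_def intro: cINF_greatest)
  have mf: "m B \<le> f x" if "x \<in> B" for x B using that bdd by (auto simp: m_def intro: cINF_lower)
  have "T - f x - f y \<le> m B3" if "x \<in> B1" "y \<in> B2" for x y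
    unfolding m_def using ne T[OF that] by (intro cINF_greatest) (auto simp: algebra_simps)
  then have "T - f x - m B3 \<le> f y" if "x \<in> B1" "y \<in> B2" for x y using that by (smt (verit))
  then have "T - f x - m B3 \<le> m B2" if "x \<in> B1" for x
    unfolding m_def[of B2] using ne that by (intro cINF_greatest) auto
  then have "T - m B2 - m B3 \<le> f x" if "x \<in> B1" for x using that by (smt (verit))
  then have "T - m B2 - m B3 \<le> m B1"
    unfolding m_def[of B1] using ne by (intro cINF_greatest) auto
  then have Tm: "T - 3 * l \<le> (m B1 - l) + (m B2 - l) + (m B3 - l)" by simp
  define g where "g x = l + (m B1 - l) * indicator B1 x + (m B2 - l) * indicator B2 x + (m B3 - l) * indicator B3 x" for x
  have Ig: "integrable \<mu> g" unfolding g_def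
    by (intro Bochner_Integration.integrable_add integrable_mult_right integrable_real_indicator)
      (auto simp: emeasure_eq_measure)
  have "l + t * (T - 3 * l) \<le> l + (t * (m B1 - l) + t * (m B2 - l) + t * (m B3 - l))"
    using mult_left_mono[OF Tm, of t] t by (simp add: algebra_simps)
  also have "\<dots> \<le> l + ((m B1 - l) * prob B1 + (m B2 - l) * prob B2 + (m B3 - l) * prob B3)"
    using mult_right_mono[OF t(2), of "m B1 - l"] mult_right_mono[OF t(3), of "m B2 - l"]
      mult_right_mono[OF t(4), of "m B3 - l"] ml ne by (simp add: mult.commute)
  also have "\<dots> = (\<integral>x. g x \<partial>\<mu>)"
    unfolding g_def by (simp add: prob_space emeasure_eq_measure)
  also have "\<dots> \<le> (\<integral>x. f x \<partial>\<mu>)"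
  proof (rule integral_mono[OF Ig f])
    fix x show "g x \<le> f x"
      using mf[of x B1] mf[of x B2] mf[of x B3] l[of x] disj by (auto simp: g_def indicator_def)
  qed
  finally show ?thesis .
qed

lemma integral_ge_one_set:
  fixes f :: "real \<Rightarrow> real"
  assumes f: "integrable \<mu> f" and l: "\<And>x. l \<le> f x"
    and B[measurable]: "B \<in> sets borel" and t: "t \<le> prob B"
    and g: "\<And>x. x \<in> B \<Longrightarrow> g \<le> f x" and lg: "l \<le> g"
  shows "l + t * (g - l) \<le> (\<integral>x. f x \<partial>\<mu>)"
proof -
  have "l + t * (g - l) \<le> l + (g - l) * prob B"
    using mult_right_mono[OF t, of "g - l"] lg by (simp add: mult.commute)
  also have "\<dots> = (\<integral>x. l + (g - l) * indicator B x \<partial>\<mu>)"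
    by (simp add: prob_space emeasure_eq_measure)
  also have "\<dots> \<le> (\<integral>x. f x \<partial>\<mu>)"
    using l g by (intro integral_mono f Bochner_Integration.integrable_add integrable_mult_right integrable_real_indicator)
      (auto simp: indicator_def emeasure_eq_measure)
  finally show ?thesis .
qed

end

text \<open>Three intervals of mass at least \<open>t\<close>, so far apart that points of different intervals differ
  by at least 3.  The intervals are longer than those chosen at the base point of a
  neighbourhood, which leaves room for perturbing the measure and the energy.\<close>

locale spread_law = potential_law +
  fixes y1 y2 y3 t R :: real
  assumes t_pos: "0 < t"
    and sep: "6 \<le> \<bar>y1 - y2\<bar>" "6 \<le> \<bar>y1 - y3\<bar>" "6 \<le> \<bar>y2 - y3\<bar>"
    and heavy: "t \<le> prob (ball y1 (3/2))" "t \<le> prob (ball y2 (3/2))" "t \<le> prob (ball y3 (3/2))"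
    and centres: "\<bar>y1\<bar> + 2 \<le> R" "\<bar>y2\<bar> + 2 \<le> R" "\<bar>y3\<bar> + 2 \<le> R"
begin

text \<open>Directions that are not too close to the vertical one.  From the vertical direction a step leads
  to the horizontal one whatever \<open>x\<close> is, so it takes one more step until the walk spreads
  (\<open>transversal_step\<close>).\<close>

definition transversal :: "real \<times> real \<Rightarrow> bool" where
  "transversal v \<longleftrightarrow> norm v \<le> 4 * (1 + R) * \<bar>fst v\<bar>"

lemma R_ge_2: "2 \<le> R"
  using centres(1) by simp

text \<open>The loss in \<open>gain_three_vectors\<close>: the loss in \<open>lognorm_somewhere\<close>, the one in \<open>three_vectors\<close> for
  \<open>d = 3 / (4 * (1 + R))\<^sup>2\<close> and \<open>K = 2 * (1 + R)\<close>, and the logarithms of the three norms.\<close>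

definition spread_const :: real where
  "spread_const = 3 / (gap_rate t * p) - ln ((3 / (4 * (1 + R))\<^sup>2)\<^sup>2 / (2 * (2 * (1 + R)))) + 3 * ln (1 + R)"

lemma ball_dist: "3 \<le> \<bar>x - y\<bar>" if "x \<in> ball a (3/2)" "y \<in> ball b (3/2)" "6 \<le> \<bar>a - b\<bar>" for a b x y :: real
  using that by (auto simp: dist_real_def abs_if split: if_splits)

lemma ball_bound: "\<bar>x\<bar> \<le> R" if "x \<in> ball a (3/2)" "\<bar>a\<bar> + 2 \<le> R"
  using that by (auto simp: dist_real_def abs_if split: if_splits)

text \<open>The three vectors reached by steps from the three intervals span areas at least \<open>d\<close>, and
  their growth is compared with that of the direction from \<open>lognorm_somewhere\<close>.\<close>

lemma gain_three_vectors:
  assumes v: "norm v = 1" "transversal v"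
    and x: "x1 \<in> ball y1 (3/2)" "x2 \<in> ball y2 (3/2)" "x3 \<in> ball y3 (3/2)"
  shows "real n * (- ln (gap_rate t)) - spread_const
      \<le> gain n (step x1 v) + gain n (step x2 v) + gain n (step x3 v)"
proof -
  obtain s where s: "s \<in> {0..1}"
    and growth: "real n * (- ln (gap_rate t)) - 3 / (gap_rate t * p) \<le> (Q ^^ n) lognorm (s, 1)"
    using lognorm_somewhere[of "ball y1 (3/2)" "ball y2 (3/2)" t n] ball_dist[OF _ _ sep(1)] heavy t_pos
    by fastforce
  define d where "d = 3 / (4 * (1 + R))\<^sup>2"
  define K where "K = 2 * (1 + R)"
  have dK: "0 < d" "0 < K" using R_ge_2 by (auto simp: d_def K_def)
  let ?u = "(s, 1) :: real \<times> real"
  have u: "?u \<noteq> 0" by (simp add: prod_eq_iff)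
  have nu: "norm ?u \<le> 2"
  proof -
    have "norm ?u \<le> norm s + norm (1::real)" by (rule norm_Pair_le)
    then show ?thesis using s by simp
  qed
  have f: "1 / (4 * (1 + R)) \<le> \<bar>fst v\<bar>"
    using v R_ge_2 by (simp add: transversal_def field_simps)
  have f2: "1 / (4 * (1 + R))\<^sup>2 \<le> (fst v)\<^sup>2"
    using power_mono[OF f, of 2] R_ge_2 by (simp add: power_divide)
  have far: "d \<le> \<bar>wedge (step x v) (step y v)\<bar>" if "3 \<le> \<bar>x - y\<bar>" for x y
  proof -
    have "wedge (step x v) (step y v) = (x - y) * (fst v)\<^sup>2"
      by (simp add: wedge_def step_def power2_eq_square algebra_simps)
    moreover have "3 * (1 / (4 * (1 + R))\<^sup>2) \<le> \<bar>x - y\<bar> * (fst v)\<^sup>2"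
      using that f2 by (intro mult_mono) auto
    ultimately show ?thesis by (simp add: d_def abs_mult)
  qed
  have ns: "norm (step x v) \<le> 1 + R" if "\<bar>x\<bar> \<le> R" for x
    using norm_step_le[of x v] v that by simp
  have near: "\<bar>wedge ?u (step x v)\<bar> \<le> K" if "\<bar>x\<bar> \<le> R" for x
  proof -
    have "\<bar>wedge ?u (step x v)\<bar> \<le> norm ?u * norm (step x v)" by (rule abs_wedge_le)
    also have "\<dots> \<le> 2 * (1 + R)" using nu ns[OF that] by (intro mult_mono) auto
    finally show ?thesis by (simp add: K_def)
  qed
  have bd: "\<bar>x1\<bar> \<le> R" "\<bar>x2\<bar> \<le> R" "\<bar>x3\<bar> \<le> R" using x centres ball_bound by auto
  have lns: "lognorm (step x v) \<le> ln (1 + R)" if "\<bar>x\<bar> \<le> R" for x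
  proof -
    have "0 < norm (step x v)" using v by auto
    then show ?thesis using ns[OF that] R_ge_2 by (subst ln_le_cancel_iff) auto
  qed
  have "(Q ^^ n) lognorm ?u + ln (d\<^sup>2 / (2 * K))
      \<le> (Q ^^ n) lognorm (step x1 v) + (Q ^^ n) lognorm (step x2 v) + (Q ^^ n) lognorm (step x3 v)"
    using dK u far near bd x sep ball_dist by (intro Qn_lognorm_three_vectors) auto
  then show ?thesis
    using growth lns[OF bd(1)] lns[OF bd(2)] lns[OF bd(3)]
    unfolding gain_def spread_const_def d_def[symmetric] K_def[symmetric] by linarith
qed

lemma transversal_step:
  assumes v: "norm v = 1" "\<not> transversal v" and x: "\<bar>x\<bar> \<le> R"
  shows "transversal (step x v)"
proof -
  define a b where "a = fst v" and "b = snd v"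
  have R: "2 \<le> R" by (rule R_ge_2)
  have a: "4 * (1 + R) * \<bar>a\<bar> < 1" using v by (simp add: transversal_def a_def)
  have "12 * \<bar>a\<bar> \<le> 4 * (1 + R) * \<bar>a\<bar>" using R by (intro mult_right_mono) auto
  then have a12: "\<bar>a\<bar> < 1/12" using a by linarith
  have "norm v \<le> \<bar>a\<bar> + \<bar>b\<bar>"
    using norm_Pair_le[of a b] by (simp add: a_def b_def)
  then have b: "11/12 \<le> \<bar>b\<bar>" using v a12 by simp
  have "\<bar>x * a\<bar> \<le> R * \<bar>a\<bar>" using x by (auto simp: abs_mult intro: mult_right_mono)
  also have "\<dots> \<le> (1 + R) * \<bar>a\<bar>" by (intro mult_right_mono) auto
  finally have "\<bar>x * a\<bar> < 1/4" using a by linarith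
  then have h: "1/2 \<le> \<bar>x * a - b\<bar>" using b by linarith
  have "norm (step x v) \<le> 1 + \<bar>x\<bar>" using norm_step_le[of x v] v by simp
  also have "\<dots> \<le> 4 * (1 + R) * (1/2)" using x R by simp
  also have "\<dots> \<le> 4 * (1 + R) * \<bar>x * a - b\<bar>" using h R by (intro mult_left_mono) auto
  finally show ?thesis by (simp add: transversal_def step_def a_def b_def)
qed

lemma transversal_scaleR: "c \<noteq> 0 \<Longrightarrow> transversal (c *\<^sub>R v) \<longleftrightarrow> transversal v"
  by (simp add: transversal_def abs_mult mult.left_commute)

text \<open>If \<open>l\<close> bounds the gain of \<open>n\<close> steps from below, then the next step improves on \<open>l\<close> by a fraction of
  the distance between \<open>3 l\<close> and the linear growth in \<open>gain_three_vectors\<close>, which forces a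
  linear lower bound of a smaller slope.  Transversal directions are given the advantage \<open>L\<close>, which
  pays for the step by which the other directions become transversal.\<close>

lemma gain_lower_bound_aux:
  fixes c D L :: real
  assumes c: "0 < c" "3 * c \<le> - ln (gap_rate t)"
    and L: "M / p + c \<le> t * L" "0 \<le> L"
    and D: "L \<le> D" "M / p + c + L + t * spread_const \<le> 3 * t * D"
  shows "v \<noteq> 0 \<Longrightarrow> c * real n - D \<le> gain n v"
    and "v \<noteq> 0 \<Longrightarrow> transversal v \<Longrightarrow> c * real n - D + L \<le> gain n v"
proof (induction n arbitrary: v)
  case 0
  { case 1 then show ?case using D L by simp }
  { case 2 then show ?case using D L by simp }
next
  case (Suc n)
  define l where "l = c * real n - D"
  have unit: "\<exists>w. norm w = 1 \<and> gain (Suc n) w = gain (Suc n) v \<and> (transversal w \<longleftrightarrow> transversal v)" if "v \<noteq> 0" for v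
    using that by (intro exI[of _ "(1 / norm v) *\<^sub>R v"]) (simp add: gain_scaleR transversal_scaleR del: scaleR_one)
  have I: "integrable \<mu> (\<lambda>x. gain n (step x v))" for v by (intro tame_integrable tame_gain)
  have low: "l \<le> gain n (step x w)" if "norm w = 1" for x w
  proof -
    have "step x w \<noteq> 0" using that by auto
    from Suc(1)[OF this] show ?thesis by (simp add: l_def)
  qed
  have dr: "- (M / p) \<le> drift w" if "norm w = 1" for w
    using abs_drift_le[of w] that by force
  have rec: "gain (Suc n) w = drift w + (\<integral>x. gain n (step x w) \<partial>\<mu>)" for w
    by (simp add: gain_Suc Q_def)
  have Tl: "M / p + c + L \<le> t * (real n * (- ln (gap_rate t)) - spread_const - 3 * l)"
  proof -
    have "0 \<le> t * (real n * (- ln (gap_rate t) - 3 * c))" using t_pos c by auto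
    then show ?thesis using D(2) by (simp add: l_def algebra_simps)
  qed
  have transversal_bound: "c * real (Suc n) - D + L \<le> gain (Suc n) w" if w: "norm w = 1" "transversal w" for w
  proof -
    have "l + t * (real n * (- ln (gap_rate t)) - spread_const - 3 * l) \<le> (\<integral>x. gain n (step x w) \<partial>\<mu>)"
    proof (rule integral_ge_three_sets[OF I low[OF w(1)] _ _ _ _ _ _ t_pos heavy])
      show "ball y1 (3/2) \<inter> ball y2 (3/2) = {}" "ball y1 (3/2) \<inter> ball y3 (3/2) = {}" "ball y2 (3/2) \<inter> ball y3 (3/2) = {}"
        using ball_dist[OF _ _ sep(1)] ball_dist[OF _ _ sep(2)] ball_dist[OF _ _ sep(3)] by fastforce+
    qed (use gain_three_vectors[OF w] in auto)
    then show ?thesis using Tl dr[OF w(1)] by (simp add: rec l_def algebra_simps)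
  qed
  have any_bound: "c * real (Suc n) - D \<le> gain (Suc n) w" if w: "norm w = 1" for w
  proof (cases "transversal w")
    case True
    then show ?thesis using transversal_bound[OF w] L by simp
  next
    case False
    have "l + t * (l + L - l) \<le> (\<integral>x. gain n (step x w) \<partial>\<mu>)"
    proof (rule integral_ge_one_set[OF I low[OF w] _ heavy(1)])
      fix x assume x: "x \<in> ball y1 (3/2)"
      then have "transversal (step x w)" using transversal_step[OF w False] ball_bound centres by auto
      moreover have "step x w \<noteq> 0" using w by auto
      ultimately show "l + L \<le> gain n (step x w)" using Suc(2)[of "step x w"] by (simp add: l_def)
    qed (use L in auto)
    then show ?thesis using L(1) dr[OF w] by (simp add: rec l_def algebra_simps)
  qed
  { case 1
    then obtain w where "norm w = 1" "gain (Suc n) w = gain (Suc n) v" using unit by blast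
    then show ?case using any_bound[of w] by simp }
  { case 2
    then obtain w where "norm w = 1" "gain (Suc n) w = gain (Suc n) v" "transversal w" using unit by blast
    then show ?case using transversal_bound[of w] by simp }
qed

end

section \<open>Contraction on the projective line\<close>

lemma exp_le_second_order: "exp y \<le> 1 + y + y\<^sup>2 * exp \<bar>y\<bar>" for y :: real
proof -
  obtain t where t: "\<bar>t\<bar> \<le> \<bar>y\<bar>" "exp y = (\<Sum>m<2. (y ^ m) / fact m) + (exp t / fact 2) * y ^ 2"
    using Maclaurin_exp_le[of y 2] by blast
  then have "exp y = 1 + y + y\<^sup>2 * (exp t / 2)" by (simp add: numeral_2_eq_2)
  also have "\<dots> \<le> 1 + y + y\<^sup>2 * exp \<bar>y\<bar>"
  proof -
    have "exp t / 2 \<le> exp t" by simp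
    also have "\<dots> \<le> exp \<bar>y\<bar>" using t(1) by simp
    finally show ?thesis by (intro add_left_mono mult_left_mono) auto
  qed
  finally show ?thesis .
qed

lemma geometric_increments_limit:
  fixes a :: "nat \<Rightarrow> real"
  assumes q: "0 < q" "q < 1" and a: "\<And>k. \<bar>a (Suc k) - a k\<bar> \<le> A * q ^ k"
  shows "\<exists>L. \<forall>k. \<bar>a k - L\<bar> \<le> A * q ^ k / (1 - q)"
proof -
  have A: "0 \<le> A" using order_trans[OF abs_ge_zero a[of 0]] by simp
  define b where "b k = A * q ^ k / (1 - q)" for k
  have b_diff: "b k - b (Suc k) = A * q ^ k" for k
  proof -
    have "b k - b (Suc k) = (A * q ^ k * (1 - q)) / (1 - q)"
      unfolding b_def diff_divide_distrib[symmetric] by (simp add: algebra_simps)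
    then show ?thesis using q by simp
  qed
  have b_nonneg: "0 \<le> b k" for k using q A by (simp add: b_def)
  have far: "\<bar>a (k + j) - a k\<bar> \<le> b k - b (k + j)" for k j
  proof (induction j)
    case (Suc j)
    then show ?case using a[of "k + j"] b_diff[of "k + j"] by simp
  qed simp
  then have far': "\<bar>a (k + j) - a k\<bar> \<le> b k" for k j using b_nonneg[of "k + j"] by (meson diff_le_self order_trans diff_left_mono le_diff_eq add_increasing2 order_refl)
  have b0: "b \<longlonglongrightarrow> 0"
  proof -
    have "(\<lambda>k. A * q ^ k / (1 - q)) \<longlonglongrightarrow> A * 0 / (1 - q)"
      using q by (intro tendsto_intros LIMSEQ_power_zero) auto
    moreover have "b = (\<lambda>k. A * q ^ k / (1 - q))" by (rule ext) (simp add: b_def)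
    ultimately show ?thesis by simp
  qed
  have "Cauchy a"
  proof (rule CauchyI')
    fix e :: real assume "0 < e"
    then have "eventually (\<lambda>k. b k < e) sequentially" using b0 by (auto dest: order_tendstoD)
    then obtain N where N: "\<And>k. N \<le> k \<Longrightarrow> b k < e" by (auto simp: eventually_sequentially)
    show "\<exists>N. \<forall>m\<ge>N. \<forall>n>m. dist (a m) (a n) < e"
    proof (intro exI allI impI)
      fix m n assume "N \<le> m" "m < n"
      then show "dist (a m) (a n) < e"
        using far'[of m "n - m"] N[of m] by (simp add: dist_real_def abs_minus_commute)
    qed
  qed
  then obtain L where L: "a \<longlonglongrightarrow> L" using Cauchy_convergent unfolding convergent_def by blast
  have "\<bar>a k - L\<bar> \<le> b k" for k
  proof -
    have "(\<lambda>j. \<bar>a k - a (j + k)\<bar>) \<longlonglongrightarrow> \<bar>a k - L\<bar>"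
      by (intro tendsto_intros LIMSEQ_ignore_initial_segment L)
    moreover have "\<bar>a k - a (j + k)\<bar> \<le> b k" for j
      using far'[of k j] by (simp add: abs_minus_commute add.commute)
    ultimately show ?thesis by (intro LIMSEQ_le_const2) auto
  qed
  then show ?thesis by (auto simp: b_def)
qed

lemma ln_one_plus_le: "ln (1 + y) \<le> y powr a / a" if "0 \<le> y" "0 < a" "a \<le> 1" for y a :: real
proof -
  have "a * ln (1 + y) = ln ((1 + y) powr a)" using that by (simp add: ln_powr)
  also have "\<dots> \<le> (1 + y) powr a - 1" using that by (intro ln_le_minus_one) auto
  also have "\<dots> \<le> y powr a" using powr_add_le[of a 1 y] that by simp
  finally show ?thesis using that by (simp add: field_simps)
qed

text \<open>The sine of the angle, a metric on the projective line.\<close>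

definition delta :: "real \<times> real \<Rightarrow> real \<times> real \<Rightarrow> real" where
  "delta v w = \<bar>wedge v w\<bar> / (norm v * norm w)"

lemma delta_nonneg: "0 \<le> delta v w" and delta_le_1: "delta v w \<le> 1"
  using abs_wedge_le[of v w] by (auto simp: delta_def divide_le_eq_1 less_le)

lemma delta_commute: "delta v w = delta w v"
  by (simp add: delta_def abs_wedge_commute mult.commute)

lemma delta_scaleR: "a \<noteq> 0 \<Longrightarrow> b \<noteq> 0 \<Longrightarrow> delta (a *\<^sub>R v) (b *\<^sub>R w) = delta v w"
proof -
  assume "a \<noteq> 0" "b \<noteq> 0"
  have "wedge (a *\<^sub>R v) (b *\<^sub>R w) = a * b * wedge v w" by (simp add: wedge_def algebra_simps)
  then show ?thesis using \<open>a \<noteq> 0\<close> \<open>b \<noteq> 0\<close> by (simp add: delta_def abs_mult)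
qed

lemma step_add: "step x (v + w) = step x v + step x w"
  by (simp add: step_def algebra_simps)

text \<open>Write \<open>w\<close> as a combination of \<open>v\<close> and of the vector orthogonal to \<open>v\<close>; the second coefficient is
  the area, hence small when the directions are close.\<close>

lemma norm_step_ratio:
  assumes "v \<noteq> 0" "w \<noteq> 0"
  shows "norm (step x w) / norm w \<le> norm (step x v) / norm v * (1 + delta v w * (1 + \<bar>x\<bar>)\<^sup>2)"
proof -
  define n where "n = (- snd v, fst v)"
  have nn: "norm n = norm v" by (simp add: n_def norm_prod_def add.commute)
  have pos: "0 < norm v" "0 < norm w" using assms by auto
  have sq: "(norm v)\<^sup>2 = fst v * fst v + snd v * snd v"
    by (simp add: power2_norm_eq_inner inner_prod_def)
  have "(norm v)\<^sup>2 *\<^sub>R w = (v \<bullet> w) *\<^sub>R v + wedge v w *\<^sub>R n"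
    unfolding sq by (simp add: n_def wedge_def inner_prod_def prod_eq_iff algebra_simps)
  then have "(norm v)\<^sup>2 * norm (step x w) = norm ((v \<bullet> w) *\<^sub>R step x v + wedge v w *\<^sub>R step x n)"
    by (metis step_add step_scaleR norm_scaleR abs_power2)
  also have "\<dots> \<le> \<bar>v \<bullet> w\<bar> * norm (step x v) + \<bar>wedge v w\<bar> * norm (step x n)"
    by (rule norm_triangle_le) simp
  also have "\<dots> \<le> (norm v * norm w) * norm (step x v) + \<bar>wedge v w\<bar> * ((1 + \<bar>x\<bar>) * norm v)"
    using norm_step_le[of x n] nn Cauchy_Schwarz_ineq2[of v w]
    by (intro add_mono mult_right_mono mult_left_mono) auto
  also have "\<dots> \<le> (norm v * norm w) * norm (step x v) + \<bar>wedge v w\<bar> * ((1 + \<bar>x\<bar>) * ((1 + \<bar>x\<bar>) * norm (step x v)))"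
    by (intro add_left_mono mult_left_mono norm_le_step) auto
  also have "\<dots> = (norm v)\<^sup>2 * (norm w * (norm (step x v) / norm v * (1 + delta v w * (1 + \<bar>x\<bar>)\<^sup>2)))"
    using pos by (simp add: delta_def field_simps power2_eq_square)
  finally have "norm (step x w) \<le> norm w * (norm (step x v) / norm v * (1 + delta v w * (1 + \<bar>x\<bar>)\<^sup>2))"
    using pos by (subst (asm) mult_le_cancel_left_pos) auto
  then show ?thesis using pos by (simp add: pos_divide_le_eq mult.commute)
qed

context potential_law
begin

text \<open>The derivative of \<open>s \<mapsto> \<parallel>A\<^sup>m v\<parallel>\<^sup>s\<close> at 0 has expectation \<open>gain m v\<close>, and the remainder is bounded by a
  moment that is finite for \<open>\<bar>s\<bar> \<le> p/2\<close>.  Negative \<open>s\<close> gives the contraction and both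
  signs the large deviation bounds of \<open>exponential_moment\<close>.\<close>

lemma second_order_bound:
  assumes s: "\<bar>s\<bar> \<le> p / 2" and v: "norm v = 1"
  shows "(Q ^^ m) (\<lambda>v. norm v powr s) v \<le> 1 + s * gain m v + s\<^sup>2 * (32 / p\<^sup>2 * M ^ m)"
proof -
  have v0: "v \<noteq> 0" using v by auto
  have tw: "tame weight" unfolding weight_def using p_pos by (intro tame_add tame_norm_powr) auto
  have pt: "norm u powr s \<le> 1 + s * lognorm u + (s\<^sup>2 * (16 / p\<^sup>2)) * weight u" if "u \<noteq> 0" for u :: "real \<times> real"
  proof -
    define X where "X = lognorm u"
    have e: "norm u powr r = exp (r * X)" for r using that by (simp add: powr_def X_def)
    have "(p * \<bar>X\<bar> / 4)\<^sup>2 \<le> (exp (p * \<bar>X\<bar> / 4))\<^sup>2"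
    proof (rule power_mono)
      show "p * \<bar>X\<bar> / 4 \<le> exp (p * \<bar>X\<bar> / 4)" using exp_ge_add_one_self[of "p * \<bar>X\<bar> / 4"] by linarith
    qed (use p_pos in auto)
    also have "\<dots> = exp (p * \<bar>X\<bar> / 2)" by (simp flip: exp_double)
    finally have X2: "X\<^sup>2 \<le> 16 / p\<^sup>2 * exp (p * \<bar>X\<bar> / 2)"
      using p_pos by (simp add: power_divide power_mult_distrib field_simps)
    have "\<bar>s * X\<bar> \<le> p * \<bar>X\<bar> / 2" using mult_right_mono[OF s, of "\<bar>X\<bar>"] by (simp add: abs_mult)
    then have "X\<^sup>2 * exp \<bar>s * X\<bar> \<le> (16 / p\<^sup>2 * exp (p * \<bar>X\<bar> / 2)) * exp (p * \<bar>X\<bar> / 2)"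
      using X2 by (intro mult_mono) auto
    also have "\<dots> = 16 / p\<^sup>2 * exp (p * \<bar>X\<bar>)" by (simp flip: exp_add)
    also have "16 / p\<^sup>2 * exp (p * \<bar>X\<bar>) \<le> 16 / p\<^sup>2 * weight u"
      by (rule mult_left_mono, cases "0 \<le> X") (auto simp: weight_def e)
    finally have "s\<^sup>2 * (X\<^sup>2 * exp \<bar>s * X\<bar>) \<le> s\<^sup>2 * (16 / p\<^sup>2 * weight u)"
      by (intro mult_left_mono) auto
    then show ?thesis
      using exp_le_second_order[of "s * X"] unfolding e[of s] X_def[symmetric] by (simp add: power_mult_distrib ac_simps)
  qed
  have "(Q ^^ m) (\<lambda>v. norm v powr s) v \<le> (Q ^^ m) (\<lambda>u. (1 + s * lognorm u) + (s\<^sup>2 * (16 / p\<^sup>2)) * weight u) v"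
    using s p_pos pt v0
    by (intro Qn_mono tame_add tame_const tame_cmult tame_norm_powr tame_lognorm tw) auto
  also have "\<dots> = 1 + s * (Q ^^ m) lognorm v + s\<^sup>2 * (16 / p\<^sup>2) * (Q ^^ m) weight v"
    unfolding Qn_add[OF tame_add[OF tame_const tame_cmult[OF tame_lognorm]] tame_cmult[OF tw]]
      Qn_add[OF tame_const tame_cmult[OF tame_lognorm]] Qn_const Qn_cmult by (rule refl)
  finally have le: "(Q ^^ m) (\<lambda>v. norm v powr s) v
      \<le> 1 + s * (Q ^^ m) lognorm v + s\<^sup>2 * (16 / p\<^sup>2) * (Q ^^ m) weight v" .
  have "(Q ^^ m) weight v \<le> 2 * M ^ m"
    unfolding weight_def
    using Qn_norm_powr_le[of p v m] Qn_norm_powr_le[of "-p" v m] p_pos v v0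
    by (simp add: Qn_add tame_norm_powr)
  then have "s\<^sup>2 * (16 / p\<^sup>2) * (Q ^^ m) weight v \<le> s\<^sup>2 * (16 / p\<^sup>2) * (2 * M ^ m)"
    by (intro mult_left_mono) auto
  also have "\<dots> = s\<^sup>2 * (32 / p\<^sup>2 * M ^ m)" by simp
  finally show ?thesis using le v by (simp add: gain_def)
qed

lemma Qn_norm_powr_scaleR:
  assumes "c \<noteq> 0"
  shows "(Q ^^ n) (\<lambda>v. norm v powr s) (c *\<^sub>R v) = \<bar>c\<bar> powr s * (Q ^^ n) (\<lambda>v. norm v powr s) v"
proof (induction n arbitrary: v)
  case 0
  then show ?case by (simp add: powr_mult)
next
  case (Suc n)
  then show ?case by (simp add: Q_def[of "(Q ^^ n) (\<lambda>v. norm v powr s)"] step_scaleR)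
qed

text \<open>A bound for \<open>m\<close> steps on unit vectors is iterated, as powers of the norm are homogeneous; a
  remaining block of fewer than \<open>m\<close> steps costs a constant.\<close>

lemma Qn_norm_powr_le_from_block:
  assumes s: "\<bar>s\<bar> \<le> p" and m: "0 < m"
    and blk: "\<And>v. norm v = 1 \<Longrightarrow> (Q ^^ m) (\<lambda>v. norm v powr s) v \<le> exp (\<beta> * real m)"
    and v: "v \<noteq> 0"
  shows "(Q ^^ n) (\<lambda>v. norm v powr s) v \<le> (M ^ m * exp (\<bar>\<beta>\<bar> * real m)) * exp (\<beta> * real n) * norm v powr s"
proof -
  let ?F = "\<lambda>v :: real \<times> real. norm v powr s"
  have tF: "tame ?F" using s by (rule tame_norm_powr)
  have blk': "(Q ^^ m) ?F v \<le> exp (\<beta> * real m) * ?F v" if "v \<noteq> 0" for v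
  proof -
    define u where "u = (1 / norm v) *\<^sub>R v"
    have vu: "v = norm v *\<^sub>R u" "norm u = 1" using that by (auto simp: u_def)
    have "(Q ^^ m) ?F v = norm v powr s * (Q ^^ m) ?F u"
      using that Qn_norm_powr_scaleR[of "norm v" m s u] by (simp flip: vu(1))
    also have "\<dots> \<le> norm v powr s * exp (\<beta> * real m)" using vu by (intro mult_left_mono blk) auto
    finally show ?thesis by (simp add: mult.commute)
  qed
  have many: "(Q ^^ (m * k)) ?F v \<le> exp (\<beta> * real m) ^ k * ?F v" if "v \<noteq> 0" for k v
  proof (induction k)
    case (Suc k)
    have "(Q ^^ (m * Suc k)) ?F v = (Q ^^ (m * k)) ((Q ^^ m) ?F) v"
      by (simp only: mult_Suc_right add.commute[of m] funpow_add o_apply)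
    also have "\<dots> \<le> (Q ^^ (m * k)) (\<lambda>v. exp (\<beta> * real m) * ?F v) v"
      using blk' that by (intro Qn_mono tame_Qn tame_cmult tF) auto
    also have "\<dots> = exp (\<beta> * real m) * (Q ^^ (m * k)) ?F v" by (simp add: Qn_cmult)
    also have "\<dots> \<le> exp (\<beta> * real m) * (exp (\<beta> * real m) ^ k * ?F v)"
      using Suc by (intro mult_left_mono) auto
    finally show ?case by (simp add: ac_simps)
  qed simp
  define k r where "k = n div m" and "r = n mod m"
  have n: "n = r + m * k" by (simp add: k_def r_def)
  have "(Q ^^ n) ?F v = (Q ^^ r) ((Q ^^ (m * k)) ?F) v" by (simp add: n funpow_add)
  also have "\<dots> \<le> (Q ^^ r) (\<lambda>v. exp (\<beta> * real m) ^ k * ?F v) v"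
    using many v by (intro Qn_mono tame_Qn tame_cmult tF) auto
  also have "\<dots> = exp (\<beta> * real m) ^ k * (Q ^^ r) ?F v" by (simp add: Qn_cmult)
  also have "\<dots> \<le> exp (\<beta> * real m) ^ k * (M ^ r * ?F v)"
    using s v by (intro mult_left_mono Qn_norm_powr_le) auto
  also have "\<dots> \<le> (exp (\<bar>\<beta>\<bar> * real m) * exp (\<beta> * real n)) * (M ^ m * ?F v)"
  proof (intro mult_mono)
    have "r < m" using m by (simp add: r_def)
    then have "- (\<beta> * real r) \<le> \<bar>\<beta>\<bar> * real m"
      by (smt (verit) abs_ge_self mult_mono abs_ge_zero of_nat_0_le_iff of_nat_mono less_imp_le minus_mult_left abs_ge_minus_self mult_right_mono)
    then show "exp (\<beta> * real m) ^ k \<le> exp (\<bar>\<beta>\<bar> * real m) * exp (\<beta> * real n)"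
      unfolding exp_of_nat_mult[symmetric] exp_add[symmetric] n by (simp add: algebra_simps)
    show "M ^ r \<le> M ^ m" using \<open>r < m\<close> C_nonneg by (intro power_increasing) auto
  qed (use C_nonneg in auto)
  finally show ?thesis by (simp add: ac_simps)
qed

lemma drift_hoelder:
  assumes a: "0 < a" "2 * a \<le> p" and vw: "v \<noteq> 0" "w \<noteq> 0"
  shows "drift w - drift v \<le> M / a * delta v w powr a"
proof -
  have a1: "a \<le> 1" using a p_le_1 by simp
  have pt: "(lognorm (step x w) - lognorm w) - (lognorm (step x v) - lognorm v)
      \<le> delta v w powr a / a * (1 + \<bar>x\<bar>) powr p" for x
  proof -
    define y where "y = delta v w * (1 + \<bar>x\<bar>)\<^sup>2"
    have y: "0 \<le> y" using delta_nonneg by (simp add: y_def)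
    have pos: "0 < norm v" "0 < norm w" "0 < norm (step x v)" "0 < norm (step x w)" using vw by auto
    have "ln (norm (step x w) / norm w) \<le> ln (norm (step x v) / norm v * (1 + y))"
      by (intro iffD2[OF ln_le_cancel_iff] norm_step_ratio[OF vw, of x, folded y_def])
        (use pos y in \<open>auto intro!: mult_pos_pos divide_pos_pos add_pos_nonneg\<close>)
    also have "\<dots> = ln (norm (step x v) / norm v) + ln (1 + y)"
      using pos y by (intro ln_mult_pos) auto
    finally have "(lognorm (step x w) - lognorm w) - (lognorm (step x v) - lognorm v) \<le> ln (1 + y)"
      using pos by (simp add: ln_div)
    also have "\<dots> \<le> y powr a / a" using y a a1 by (intro ln_one_plus_le)
    also have "y powr a = delta v w powr a * (1 + \<bar>x\<bar>) powr (2 * a)"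
      using delta_nonneg by (simp add: y_def powr_mult powr_powr flip: powr_numeral)
    also have "(1 + \<bar>x\<bar>) powr (2 * a) \<le> (1 + \<bar>x\<bar>) powr p" using a by (intro powr_mono) auto
    finally show ?thesis using a by (simp add: divide_right_mono mult_left_mono)
  qed
  have I: "integrable \<mu> (\<lambda>x. lognorm (step x u) - lognorm u)" for u
    using tame_integrable[OF tame_lognorm] by auto
  have "drift w - drift v = (\<integral>x. (lognorm (step x w) - lognorm w) - (lognorm (step x v) - lognorm v) \<partial>\<mu>)"
    unfolding drift_eq_integral using I by (subst Bochner_Integration.integral_diff) auto
  also have "\<dots> \<le> (\<integral>x. delta v w powr a / a * (1 + \<bar>x\<bar>) powr p \<partial>\<mu>)"
    using integrable_growth
    by (intro integral_mono Bochner_Integration.integrable_diff[OF I I] pt) auto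
  also have "\<dots> = delta v w powr a / a * (\<integral>x. (1 + \<bar>x\<bar>) powr p \<partial>\<mu>)" by simp
  also have "\<dots> \<le> delta v w powr a / a * M" using integral_growth a by (intro mult_left_mono) auto
  finally show ?thesis by (simp add: mult.commute)
qed

lemma delta_powr_le:
  assumes "v \<noteq> 0" "w \<noteq> 0"
  shows "delta v w powr a \<le> \<bar>wedge v w\<bar> powr a * (norm v powr (- (2 * a)) + norm w powr (- (2 * a)))"
proof -
  have pos: "0 < norm v" "0 < norm w" using assms by auto
  have "delta v w powr a = \<bar>wedge v w\<bar> powr a * (norm v powr - a * norm w powr - a)"
    using pos by (simp add: delta_def powr_divide powr_mult powr_minus field_simps)
  also have "norm v powr - a * norm w powr - a \<le> (norm v powr - a)\<^sup>2 + (norm w powr - a)\<^sup>2"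
  proof -
    have "0 \<le> norm v powr - a * norm w powr - a" by simp
    moreover have "2 * (norm v powr - a * norm w powr - a) \<le> (norm v powr - a)\<^sup>2 + (norm w powr - a)\<^sup>2"
      using sum_squares_bound[of "norm v powr - a" "norm w powr - a"] by simp
    ultimately show ?thesis by linarith
  qed
  also have "(norm v powr - a)\<^sup>2 + (norm w powr - a)\<^sup>2 = norm v powr (- (2 * a)) + norm w powr (- (2 * a))"
    by (simp add: power2_eq_square flip: powr_add)
  finally show ?thesis by (simp add: mult_left_mono)
qed

text \<open>The quantity \<open>delta v w powr a\<close> is majorised by a sum of two functions of one variable each,
  times a power of the invariant area (\<open>delta_powr_le\<close>); such a majorant can be pushed forward
  by applying \<open>Q\<close> to each of them separately.\<close>

lemma Qn_drift_diff_le: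
  assumes a: "0 < a" "2 * a \<le> p" and vw: "v \<noteq> 0" "w \<noteq> 0"
  shows "\<bar>(Q ^^ n) drift v - (Q ^^ n) drift w\<bar> \<le> M / a * \<bar>wedge v w\<bar> powr a *
     ((Q ^^ n) (\<lambda>v. norm v powr (- (2 * a))) v + (Q ^^ n) (\<lambda>v. norm v powr (- (2 * a))) w)"
  using vw
proof (induction n arbitrary: v w)
  case 0
  have "\<bar>drift v - drift w\<bar> \<le> M / a * delta v w powr a"
    using drift_hoelder[OF a, of v w] drift_hoelder[OF a, of w v] 0 delta_commute[of v w] by simp
  also have "\<dots> \<le> M / a * (\<bar>wedge v w\<bar> powr a * (norm v powr (- (2 * a)) + norm w powr (- (2 * a))))"
    using a C_nonneg delta_powr_le 0 by (intro mult_left_mono) auto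
  finally show ?case by (simp add: mult.assoc)
next
  case (Suc n)
  let ?F = "(Q ^^ n) (\<lambda>v. norm v powr (- (2 * a)))"
  have tF: "tame ?F" using a by (intro tame_Qn tame_norm_powr) auto
  have I: "integrable \<mu> (\<lambda>x. (Q ^^ n) drift (step x u))" "integrable \<mu> (\<lambda>x. ?F (step x u))" for u
    by (intro tame_integrable tame_Qn tame_drift tF)+
  have "(Q ^^ Suc n) drift v - (Q ^^ Suc n) drift w
      = (\<integral>x. (Q ^^ n) drift (step x v) - (Q ^^ n) drift (step x w) \<partial>\<mu>)"
    using I by (simp add: Q_def[of "(Q ^^ n) drift"])
  also have "\<bar>\<dots>\<bar> \<le> (\<integral>x. \<bar>(Q ^^ n) drift (step x v) - (Q ^^ n) drift (step x w)\<bar> \<partial>\<mu>)"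
    by (rule integral_abs_bound)
  also have "\<dots> \<le> (\<integral>x. M / a * \<bar>wedge v w\<bar> powr a * (?F (step x v) + ?F (step x w)) \<partial>\<mu>)"
  proof (rule integral_mono)
    fix x show "\<bar>(Q ^^ n) drift (step x v) - (Q ^^ n) drift (step x w)\<bar>
      \<le> M / a * \<bar>wedge v w\<bar> powr a * (?F (step x v) + ?F (step x w))"
      using Suc(1)[of "step x v" "step x w"] Suc(2,3) by simp
  qed (use I in auto)
  also have "\<dots> = M / a * \<bar>wedge v w\<bar> powr a * (Q ?F v + Q ?F w)"
    using I by (simp add: Q_def[of ?F])
  finally show ?case by simp
qed

end

context spread_law
begin

definition growth_rate :: real where "growth_rate = - ln (gap_rate t) / 3"

text \<open>This number and the next one solve the inequalities for \<open>L\<close> and \<open>D\<close> in \<open>gain_lower_bound_aux\<close>.\<close>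

definition growth_gap :: real where "growth_gap = (M / p + growth_rate) / t"

definition growth_loss :: real where
  "growth_loss = growth_gap + \<bar>M / p + growth_rate + growth_gap + t * spread_const\<bar> / (3 * t)"

lemma growth_rate_pos: "0 < growth_rate"
  using gap_rate_pos[of t] gap_rate_less_1[of t] t_pos by (simp add: growth_rate_def)

lemma gain_lower_bound: "v \<noteq> 0 \<Longrightarrow> growth_rate * real n - growth_loss \<le> gain n v"
proof (rule gain_lower_bound_aux(1)[where L = growth_gap])
  show "M / p + growth_rate \<le> t * growth_gap" using t_pos by (simp add: growth_gap_def)
  show gap: "0 \<le> growth_gap" using growth_rate_pos t_pos p_pos C_nonneg by (simp add: growth_gap_def)
  show "growth_gap \<le> growth_loss" using t_pos by (simp add: growth_loss_def)
  show "M / p + growth_rate + growth_gap + t * spread_const \<le> 3 * t * growth_loss"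
  proof -
    have "3 * t * growth_loss = 3 * t * growth_gap + \<bar>M / p + growth_rate + growth_gap + t * spread_const\<bar>"
      using t_pos by (simp add: growth_loss_def field_simps)
    moreover have "0 \<le> 3 * t * growth_gap" using gap t_pos by simp
    ultimately show ?thesis by linarith
  qed
qed (use growth_rate_pos in \<open>auto simp: growth_rate_def\<close>)

text \<open>A number of steps after which every direction has gained at least 1.\<close>

definition block :: nat where "block = nat \<lceil>(1 + \<bar>growth_loss\<bar>) / growth_rate\<rceil>"

lemma block_pos: "0 < block" and gain_block: "v \<noteq> 0 \<Longrightarrow> 1 \<le> gain block v"
proof -
  have "0 < (1 + \<bar>growth_loss\<bar>) / growth_rate" using growth_rate_pos by (intro divide_pos_pos) auto
  then show "0 < block" by (simp add: block_def)
  have "(1 + \<bar>growth_loss\<bar>) / growth_rate \<le> real block" unfolding block_def by linarith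
  then have "1 + \<bar>growth_loss\<bar> \<le> growth_rate * real block" using growth_rate_pos by (simp add: field_simps)
  then show "v \<noteq> 0 \<Longrightarrow> 1 \<le> gain block v" using gain_lower_bound[of v block] by linarith
qed

text \<open>Small enough for the quadratic term of \<open>second_order_bound\<close>, at \<open>s = - 2 hoelder_exponent\<close>,
  to be at most half of the linear one.\<close>

definition hoelder_exponent :: real where "hoelder_exponent = min (p / 4) (1 / (128 / p\<^sup>2 * M ^ block))"

lemma hoelder_exponent: "0 < hoelder_exponent" "2 * hoelder_exponent \<le> p / 2" "2 * hoelder_exponent \<le> p" "hoelder_exponent \<le> 1"
  "2 * hoelder_exponent * (32 / p\<^sup>2 * M ^ block) \<le> 1 / 2"
proof -
  define Z where "Z = 128 / p\<^sup>2 * M ^ block"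
  have Z: "0 < Z" using p_pos C_nonneg by (simp add: Z_def)
  then have "0 < p / 4" "0 < 1 / Z" using p_pos by auto
  then show "0 < hoelder_exponent" unfolding hoelder_exponent_def Z_def[symmetric] by simp
  show e: "2 * hoelder_exponent \<le> p / 2" unfolding hoelder_exponent_def by simp
  then show "2 * hoelder_exponent \<le> p" "hoelder_exponent \<le> 1" using p_pos p_le_1 by auto
  have "hoelder_exponent * Z \<le> 1 / Z * Z"
    using Z by (intro mult_right_mono) (auto simp: hoelder_exponent_def Z_def)
  also have "\<dots> = 1" using Z by simp
  finally show "2 * hoelder_exponent * (32 / p\<^sup>2 * M ^ block) \<le> 1 / 2" by (simp add: Z_def mult.left_commute)
qed

definition decay :: real where "decay = exp (- hoelder_exponent / real block)"

lemma decay: "0 < decay" "decay < 1"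
  using hoelder_exponent block_pos by (auto simp: decay_def)

definition decay_const :: real where "decay_const = M ^ block * exp hoelder_exponent"

lemma decay_const_nonneg: "0 \<le> decay_const"
  using C_nonneg by (simp add: decay_const_def)

lemma Qn_norm_powr_decay:
  assumes "v \<noteq> 0"
  shows "(Q ^^ n) (\<lambda>v. norm v powr (- (2 * hoelder_exponent))) v \<le> decay_const * decay ^ n * norm v powr (- (2 * hoelder_exponent))"
proof -
  let ?\<beta> = "- hoelder_exponent / real block"
  have "(Q ^^ n) (\<lambda>v. norm v powr (- (2 * hoelder_exponent))) v
    \<le> (M ^ block * exp (\<bar>?\<beta>\<bar> * real block)) * exp (?\<beta> * real n) * norm v powr (- (2 * hoelder_exponent))"
  proof (rule Qn_norm_powr_le_from_block[OF _ block_pos _ assms])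
    show "\<bar>- (2 * hoelder_exponent)\<bar> \<le> p" using hoelder_exponent by simp
    fix u :: "real \<times> real" assume u: "norm u = 1"
    then have "u \<noteq> 0" by auto
    have "(Q ^^ block) (\<lambda>v. norm v powr (- (2 * hoelder_exponent))) u
        \<le> 1 + (- (2 * hoelder_exponent)) * gain block u + (- (2 * hoelder_exponent))\<^sup>2 * (32 / p\<^sup>2 * M ^ block)"
      using hoelder_exponent u by (intro second_order_bound) auto
    also have "\<dots> \<le> 1 + (- (2 * hoelder_exponent)) * 1 + (2 * hoelder_exponent) * (1 / 2)"
    proof -
      have "(2 * hoelder_exponent) * 1 \<le> (2 * hoelder_exponent) * gain block u"
        using hoelder_exponent gain_block[OF \<open>u \<noteq> 0\<close>] by (intro mult_left_mono) auto
      moreover have "(2 * hoelder_exponent) * ((2 * hoelder_exponent) * (32 / p\<^sup>2 * M ^ block)) \<le> (2 * hoelder_exponent) * (1 / 2)"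
        using hoelder_exponent by (intro mult_left_mono) auto
      ultimately show ?thesis by (simp add: power2_eq_square)
    qed
    also have "\<dots> \<le> exp (- hoelder_exponent)" using exp_ge_add_one_self[of "- hoelder_exponent"] by simp
    also have "- hoelder_exponent = ?\<beta> * real block" using block_pos by simp
    finally show "(Q ^^ block) (\<lambda>v. norm v powr (- (2 * hoelder_exponent))) u \<le> exp (?\<beta> * real block)" .
  qed
  also have "\<bar>?\<beta>\<bar> * real block = hoelder_exponent" using block_pos hoelder_exponent by (simp add: abs_divide)
  also have "exp (?\<beta> * real n) = decay ^ n" by (simp add: decay_def mult.commute flip: exp_of_nat_mult)
  finally show ?thesis by (simp add: decay_const_def)
qed

definition hoelder_const :: real where "hoelder_const = 2 * (M / hoelder_exponent) * decay_const"

lemma hoelder_const_nonneg: "0 \<le> hoelder_const"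
  using decay_const_nonneg C_nonneg hoelder_exponent by (simp add: hoelder_const_def)

lemma Qn_drift_hoelder:
  assumes "v \<noteq> 0" "w \<noteq> 0"
  shows "\<bar>(Q ^^ n) drift v - (Q ^^ n) drift w\<bar> \<le> hoelder_const * decay ^ n * delta v w powr hoelder_exponent"
proof -
  have unit: "\<bar>(Q ^^ n) drift v - (Q ^^ n) drift w\<bar> \<le> hoelder_const * decay ^ n * delta v w powr hoelder_exponent"
    if u: "norm v = 1" "norm w = 1" for v w
  proof -
    have nz: "v \<noteq> 0" "w \<noteq> 0" using u by auto
    have "\<bar>(Q ^^ n) drift v - (Q ^^ n) drift w\<bar> \<le> M / hoelder_exponent * \<bar>wedge v w\<bar> powr hoelder_exponent *
       ((Q ^^ n) (\<lambda>v. norm v powr (- (2 * hoelder_exponent))) v + (Q ^^ n) (\<lambda>v. norm v powr (- (2 * hoelder_exponent))) w)"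
      using hoelder_exponent nz by (intro Qn_drift_diff_le) auto
    also have "\<dots> \<le> M / hoelder_exponent * \<bar>wedge v w\<bar> powr hoelder_exponent * (decay_const * decay ^ n + decay_const * decay ^ n)"
      using Qn_norm_powr_decay[OF nz(1), of n] Qn_norm_powr_decay[OF nz(2), of n] u hoelder_exponent C_nonneg
      by (intro mult_left_mono add_mono) auto
    also have "\<dots> = hoelder_const * decay ^ n * \<bar>wedge v w\<bar> powr hoelder_exponent"
      unfolding hoelder_const_def by (simp add: algebra_simps)
    also have "\<bar>wedge v w\<bar> = delta v w" using u by (simp add: delta_def)
    finally show ?thesis .
  qed
  have "\<bar>(Q ^^ n) drift ((1 / norm v) *\<^sub>R v) - (Q ^^ n) drift ((1 / norm w) *\<^sub>R w)\<bar>
      \<le> hoelder_const * decay ^ n * delta ((1 / norm v) *\<^sub>R v) ((1 / norm w) *\<^sub>R w) powr hoelder_exponent"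
    using assms by (intro unit) auto
  then show ?thesis using assms by (simp add: Qn_drift_scaleR delta_scaleR del: scaleR_one)
qed

lemma Qn_drift_oscillation:
  assumes "v \<noteq> 0" "w \<noteq> 0"
  shows "\<bar>(Q ^^ n) drift v - (Q ^^ n) drift w\<bar> \<le> hoelder_const * decay ^ n"
proof -
  have "delta v w powr hoelder_exponent \<le> 1 powr hoelder_exponent"
    using delta_nonneg delta_le_1 hoelder_exponent by (intro powr_mono2) auto
  then have "hoelder_const * decay ^ n * delta v w powr hoelder_exponent \<le> hoelder_const * decay ^ n * 1"
    using hoelder_const_nonneg decay by (intro mult_left_mono) auto
  then show ?thesis using Qn_drift_hoelder[OF assms, of n] by simp
qed

text \<open>The increments of the sequence are bounded by the oscillation of the iterates of the drift.\<close>

lemma exists_limit: "\<exists>L. \<forall>n. \<bar>(Q ^^ n) drift (1, 0) - L\<bar> \<le> hoelder_const * decay ^ n / (1 - decay)"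
proof (rule geometric_increments_limit[OF decay])
  fix k
  let ?e = "(1, 0) :: real \<times> real"
  have e: "?e \<noteq> 0" by (simp add: prod_eq_iff)
  have I: "integrable \<mu> (\<lambda>x. (Q ^^ k) drift (step x ?e))"
    by (intro tame_integrable tame_Qn tame_drift)
  have "(Q ^^ Suc k) drift ?e - (Q ^^ k) drift ?e = (\<integral>x. (Q ^^ k) drift (step x ?e) - (Q ^^ k) drift ?e \<partial>\<mu>)"
    using I by (simp add: Q_def[of "(Q ^^ k) drift"] prob_space)
  also have "\<bar>\<dots>\<bar> \<le> (\<integral>x. \<bar>(Q ^^ k) drift (step x ?e) - (Q ^^ k) drift ?e\<bar> \<partial>\<mu>)"
    by (rule integral_abs_bound)
  also have "\<dots> \<le> (\<integral>x. hoelder_const * decay ^ k \<partial>\<mu>)"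
    using I e by (intro integral_mono Qn_drift_oscillation) auto
  also have "\<dots> = hoelder_const * decay ^ k" by (simp add: prob_space)
  finally show "\<bar>(Q ^^ Suc k) drift ?e - (Q ^^ k) drift ?e\<bar> \<le> hoelder_const * decay ^ k" .
qed

text \<open>The limit, which does not depend on the starting direction by \<open>Qn_drift_limit\<close>.\<close>

definition exponent :: real where
  "exponent = (SOME L. \<forall>n. \<bar>(Q ^^ n) drift (1, 0) - L\<bar> \<le> hoelder_const * decay ^ n / (1 - decay))"

definition limit_const :: real where
  "limit_const = hoelder_const + hoelder_const / (1 - decay)"

lemma limit_const_nonneg: "0 \<le> limit_const"
  using hoelder_const_nonneg decay by (simp add: limit_const_def)

lemma Qn_drift_limit:
  assumes "v \<noteq> 0"
  shows "\<bar>(Q ^^ n) drift v - exponent\<bar> \<le> limit_const * decay ^ n"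
proof -
  have "\<bar>(Q ^^ n) drift (1, 0) - exponent\<bar> \<le> hoelder_const * decay ^ n / (1 - decay)"
    unfolding exponent_def using someI_ex[OF exists_limit] by blast
  moreover have "\<bar>(Q ^^ n) drift v - (Q ^^ n) drift (1, 0)\<bar> \<le> hoelder_const * decay ^ n"
    by (intro Qn_drift_oscillation assms) (simp add: prod_eq_iff)
  ultimately show ?thesis by (simp add: limit_const_def distrib_right)
qed

lemma gain_linear:
  assumes "v \<noteq> 0"
  shows "\<bar>gain n v - real n * exponent\<bar> \<le> limit_const / (1 - decay)"
proof -
  have "gain n v - real n * exponent = (\<Sum>k<n. (Q ^^ k) drift v - exponent)"
    by (simp add: gain_eq_sum sum_subtractf)
  also have "\<bar>\<dots>\<bar> \<le> (\<Sum>k<n. limit_const * decay ^ k)"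
    using Qn_drift_limit[OF assms] by (intro order_trans[OF sum_abs sum_mono]) auto
  also have "\<dots> = limit_const * ((1 - decay ^ n) / (1 - decay))"
    using decay by (simp add: sum_gp_strict flip: sum_distrib_left)
  also have "\<dots> \<le> limit_const * (1 / (1 - decay))"
    using decay limit_const_nonneg by (intro mult_left_mono divide_right_mono) auto
  finally show ?thesis by simp
qed

lemma abs_exponent_le: "\<bar>exponent\<bar> \<le> M / p + limit_const"
  using Qn_drift_limit[of "(1,0)" 0] abs_drift_le[of "(1,0)"] by (simp add: prod_eq_iff)

end

section \<open>The limit of the drift is the Lyapunov exponent\<close>

text \<open>The walk driven by a sequence of potentials at energy \<open>E\<close>; \<open>pair_of_iterate\<close> identifies it with the
  matrix cocycle.\<close>

primrec viter :: "real \<Rightarrow> nat \<Rightarrow> (int \<Rightarrow> real) \<Rightarrow> real \<times> real \<Rightarrow> real \<times> real" where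
  "viter E 0 \<omega> v = v"
| "viter E (Suc n) \<omega> v = step (\<omega> (int n) - E) (viter E n \<omega> v)"

lemma viter_eq_0_iff [simp]: "viter E n \<omega> v = 0 \<longleftrightarrow> v = 0"
  by (induction n) auto

lemma viter_linear: "viter E n \<omega> (a *\<^sub>R v + b *\<^sub>R w) = a *\<^sub>R viter E n \<omega> v + b *\<^sub>R viter E n \<omega> w"
  by (induction n) (auto simp: step_add step_scaleR)

lemma viter_cong: "(\<And>i. i \<in> {0..<int n} \<Longrightarrow> \<omega> i = \<omega>' i) \<Longrightarrow> viter E n \<omega> v = viter E n \<omega>' v"
  by (induction n) auto

lemma measurable_viter:
  assumes "sets \<nu> = sets borel" "{0..<int n} \<subseteq> I"
  shows "(\<lambda>\<omega>. viter E n \<omega> v) \<in> PiM I (\<lambda>_. \<nu>) \<rightarrow>\<^sub>M borel"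
  using assms(2)
proof (induction n)
  case (Suc n)
  note [measurable_cong] = assms(1)
  have [measurable]: "(\<lambda>\<omega>. viter E n \<omega> v) \<in> PiM I (\<lambda>_. \<nu>) \<rightarrow>\<^sub>M borel"
    using Suc(2) by (intro Suc(1) order_trans[OF _ Suc(2)]) auto
  have "int n \<in> I" using Suc(2) by auto
  then have [measurable]: "(\<lambda>\<omega>. \<omega> (int n)) \<in> PiM I (\<lambda>_. \<nu>) \<rightarrow>\<^sub>M borel"
    using measurable_component_singleton[of "int n" I "\<lambda>_. \<nu>"] assms(1) by (simp cong: measurable_cong_sets)
  show ?case by simp
qed simp

text \<open>The operator \<open>qplus\<close> of the law of \<open>x - E\<close>.\<close>

definition shifted_qplus :: "real measure \<Rightarrow> real \<Rightarrow> (real \<times> real \<Rightarrow> ennreal) \<Rightarrow> real \<times> real \<Rightarrow> ennreal" where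
  "shifted_qplus \<nu> E F v = (\<integral>\<^sup>+x. F (step (x - E) v) \<partial>\<nu>)"

lemma measurable_shifted_qplus:
  assumes "prob_space \<nu>" "sets \<nu> = sets borel" and [measurable]: "F \<in> borel_measurable borel"
  shows "shifted_qplus \<nu> E F \<in> borel_measurable borel"
proof -
  interpret prob_space \<nu> by fact
  note [measurable_cong] = assms(2)
  have "(\<lambda>(v, x). F (step (x - E) v)) \<in> borel_measurable (borel \<Otimes>\<^sub>M \<nu>)" by measurable
  then show ?thesis unfolding shifted_qplus_def by measurable
qed

lemma nn_integral_viter_finite:
  assumes \<nu>: "prob_space \<nu>" "sets \<nu> = sets borel" and F: "F \<in> borel_measurable borel"
  shows "(\<integral>\<^sup>+\<omega>. F (viter E n \<omega> v) \<partial>PiM {0..<int n} (\<lambda>_. \<nu>)) = (shifted_qplus \<nu> E ^^ n) F v"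
  using F
proof (induction n arbitrary: F)
  case 0
  then show ?case by (simp add: PiM_empty nn_integral_count_space_finite)
next
  case (Suc n)
  note [measurable] = Suc(2)
  interpret prob_space \<nu> by fact
  interpret product_sigma_finite "\<lambda>_::int. \<nu>" by unfold_locales
  have ins: "{0..<int (Suc n)} = insert (int n) {0..<int n}" by auto
  have m: "(\<lambda>\<omega>. F (viter E (Suc n) \<omega> v)) \<in> borel_measurable (PiM (insert (int n) {0..<int n}) (\<lambda>_. \<nu>))"
    unfolding ins[symmetric] by (rule measurable_compose[OF measurable_viter[OF \<nu>(2)]]) auto
  have "(\<integral>\<^sup>+\<omega>. F (viter E (Suc n) \<omega> v) \<partial>PiM {0..<int (Suc n)} (\<lambda>_. \<nu>))
      = (\<integral>\<^sup>+\<omega>. \<integral>\<^sup>+y. F (viter E (Suc n) (fun_upd \<omega> (int n) y) v) \<partial>\<nu> \<partial>PiM {0..<int n} (\<lambda>_. \<nu>))"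
    unfolding ins by (rule product_nn_integral_insert[OF _ _ m]) auto
  also have "\<dots> = (\<integral>\<^sup>+\<omega>. shifted_qplus \<nu> E F (viter E n \<omega> v) \<partial>PiM {0..<int n} (\<lambda>_. \<nu>))"
  proof (intro nn_integral_cong)
    fix \<omega>
    have "viter E n (fun_upd \<omega> (int n) y) v = viter E n \<omega> v" for y by (rule viter_cong) auto
    then show "(\<integral>\<^sup>+y. F (viter E (Suc n) (fun_upd \<omega> (int n) y) v) \<partial>\<nu>) = shifted_qplus \<nu> E F (viter E n \<omega> v)"
      by (simp add: shifted_qplus_def)
  qed
  also have "\<dots> = (shifted_qplus \<nu> E ^^ n) (shifted_qplus \<nu> E F) v"
    by (rule Suc(1)[OF measurable_shifted_qplus[OF \<nu> Suc(2)]])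
  finally show ?case by (simp add: funpow_swap1)
qed

text \<open>The first \<open>n\<close> steps depend on finitely many coordinates, which reduces the claim to a finite product
  of measures.\<close>

lemma nn_integral_viter:
  assumes \<nu>: "prob_space \<nu>" "sets \<nu> = sets borel" and F: "F \<in> borel_measurable borel"
  shows "(\<integral>\<^sup>+\<omega>. F (viter E n \<omega> v) \<partial>bernoulli \<nu>) = (shifted_qplus \<nu> E ^^ n) F v"
proof -
  interpret prob_space \<nu> by fact
  interpret product_prob_space "\<lambda>_::int. \<nu>" UNIV by unfold_locales
  let ?J = "{0..<int n}"
  have "(\<integral>\<^sup>+\<omega>. F (viter E n \<omega> v) \<partial>bernoulli \<nu>)
      = (\<integral>\<^sup>+\<omega>. F (viter E n (restrict \<omega> ?J) v) \<partial>PiM UNIV (\<lambda>_. \<nu>))"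
    unfolding bernoulli_def
    by (intro nn_integral_cong arg_cong[where f = F] viter_cong) simp
  also have "\<dots> = (\<integral>\<^sup>+\<omega>. F (viter E n \<omega> v) \<partial>distr (PiM UNIV (\<lambda>_. \<nu>)) (PiM ?J (\<lambda>_. \<nu>)) (\<lambda>\<omega>. restrict \<omega> ?J))"
  proof -
    have "(\<lambda>\<omega>. restrict \<omega> ?J) \<in> PiM UNIV (\<lambda>_. \<nu>) \<rightarrow>\<^sub>M PiM ?J (\<lambda>_. \<nu>)"
      by (rule measurable_restrict_subset) simp
    moreover have "(\<lambda>\<omega>. F (viter E n \<omega> v)) \<in> borel_measurable (PiM ?J (\<lambda>_. \<nu>))"
      by (rule measurable_compose[OF measurable_viter[OF \<nu>(2)] F]) simp
    ultimately show ?thesis by (subst nn_integral_distr) simp_all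
  qed
  also have "\<dots> = (\<integral>\<^sup>+\<omega>. F (viter E n \<omega> v) \<partial>PiM ?J (\<lambda>_. \<nu>))"
    by (subst distr_PiM_restrict_finite) auto
  also have "\<dots> = (shifted_qplus \<nu> E ^^ n) F v" by (rule nn_integral_viter_finite[OF \<nu> F])
  finally show ?thesis .
qed

definition pair_of :: "real^2 \<Rightarrow> real \<times> real" where
  "pair_of x = (x $ 1, x $ 2)"

lemma norm_pair_of: "norm (pair_of x) = norm x"
  by (simp add: pair_of_def norm_prod_def norm_vec_def L2_set_def sum_2)

lemma shift_funpow: "(shift ^^ n) \<omega> k = \<omega> (k + int n)"
  by (induction n arbitrary: k) (auto simp: shift_def algebra_simps)

lemma pair_of_schroedinger: "pair_of (schroedinger E \<omega> *v x) = step (\<omega> 0 - E) (pair_of x)"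
  by (simp add: pair_of_def schroedinger_def potential_def step_def matrix_vector_mult_def sum_2 vector_2)

lemma pair_of_iterate: "pair_of (iterate E n \<omega> *v x) = viter E n \<omega> (pair_of x)"
proof (induction n)
  case (Suc n)
  have "iterate E (Suc n) \<omega> *v x = schroedinger E ((shift ^^ n) \<omega>) *v (iterate E n \<omega> *v x)"
    by (simp add: matrix_vector_mul_assoc)
  then show ?case using Suc by (simp add: pair_of_schroedinger shift_funpow)
qed simp

text \<open>The norm of the matrix and the norms of the images of the basis vectors differ by a factor of at
  most 2, so they have the same exponential growth.\<close>

lemma onorm_iterate_bounds:
  shows "norm (viter E n \<omega> (1, 0)) \<le> onorm (\<lambda>x. iterate E n \<omega> *v x)"
    and "onorm (\<lambda>x. iterate E n \<omega> *v x) \<le> norm (viter E n \<omega> (1, 0)) + norm (viter E n \<omega> (0, 1))"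
proof -
  let ?T = "\<lambda>x. iterate E n \<omega> *v x"
  have nT: "norm (?T x) = norm (viter E n \<omega> (pair_of x))" for x
    by (simp add: norm_pair_of flip: pair_of_iterate)
  have "norm (?T (vector [1, 0])) \<le> onorm ?T * norm (vector [1, 0] :: real^2)"
    by (intro onorm matrix_vector_mul_bounded_linear)
  moreover have "pair_of (vector [1, 0]) = (1, 0)" by (simp add: pair_of_def)
  moreover from this have "norm (vector [1, 0] :: real^2) = 1" by (simp flip: norm_pair_of)
  ultimately show "norm (viter E n \<omega> (1, 0)) \<le> onorm ?T" by (simp add: nT)
  show "onorm ?T \<le> norm (viter E n \<omega> (1, 0)) + norm (viter E n \<omega> (0, 1))"
  proof (rule onorm_le)
    fix x :: "real^2"
    have "pair_of x = (x $ 1) *\<^sub>R (1, 0) + (x $ 2) *\<^sub>R (0, 1)" by (simp add: pair_of_def)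
    then have "norm (?T x) = norm ((x $ 1) *\<^sub>R viter E n \<omega> (1, 0) + (x $ 2) *\<^sub>R viter E n \<omega> (0, 1))"
      by (simp only: nT viter_linear)
    also have "\<dots> \<le> \<bar>x $ 1\<bar> * norm (viter E n \<omega> (1, 0)) + \<bar>x $ 2\<bar> * norm (viter E n \<omega> (0, 1))"
      by (rule norm_triangle_le) simp
    also have "\<dots> \<le> norm x * norm (viter E n \<omega> (1, 0)) + norm x * norm (viter E n \<omega> (0, 1))"
      by (intro add_mono mult_right_mono component_le_norm_cart) auto
    finally show "norm (?T x) \<le> (norm (viter E n \<omega> (1, 0)) + norm (viter E n \<omega> (0, 1))) * norm x"
      by (simp add: algebra_simps)
  qed
qed

context spread_law
begin

text \<open>The gain differs from \<open>n * exponent\<close> by a bounded amount, which is negligible compared with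
  \<open>m \<epsilon>\<close> for a long block of \<open>m\<close> steps; then \<open>s\<close> is chosen so small that the quadratic term of
  \<open>second_order_bound\<close> is negligible as well.\<close>

lemma exponential_moment:
  assumes \<epsilon>: "0 < \<epsilon>" and \<sigma>: "\<bar>\<sigma>\<bar> = 1"
  shows "\<exists>s K. 0 < s \<and> s \<le> p \<and> 0 \<le> K \<and> (\<forall>n v. norm v = 1 \<longrightarrow>
      (Q ^^ n) (\<lambda>v. norm v powr (\<sigma> * s)) v \<le> K * exp ((\<sigma> * s * exponent + s * \<epsilon>) * real n))"
proof -
  define B where "B = limit_const / (1 - decay)"
  have B: "0 \<le> B" using limit_const_nonneg decay by (simp add: B_def)
  define m where "m = Suc (nat \<lceil>2 * B / \<epsilon>\<rceil>)"
  have "2 * B / \<epsilon> \<le> real m" unfolding m_def by linarith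
  then have m: "0 < m" "B \<le> real m * \<epsilon> / 2" using \<epsilon> by (auto simp: m_def field_simps)
  define Z where "Z = 32 / p\<^sup>2 * M ^ m"
  have Z: "0 < Z" using p_pos C_nonneg by (simp add: Z_def)
  define s where "s = min (p / 2) (real m * \<epsilon> / (2 * Z))"
  have s: "0 < s" "s \<le> p / 2" using p_pos m \<epsilon> Z by (auto simp: s_def)
  have sZ: "s * Z \<le> real m * \<epsilon> / 2"
  proof -
    have "s * Z \<le> real m * \<epsilon> / (2 * Z) * Z" using Z by (intro mult_right_mono) (auto simp: s_def)
    then show ?thesis using Z by simp
  qed
  have abs_s: "\<bar>\<sigma> * s\<bar> = s" using \<sigma> s by (simp add: abs_mult)
  define \<beta> where "\<beta> = \<sigma> * s * exponent + s * \<epsilon>"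
  have blk: "(Q ^^ m) (\<lambda>v. norm v powr (\<sigma> * s)) u \<le> exp (\<beta> * real m)" if u: "norm u = 1" for u
  proof -
    have nz: "u \<noteq> 0" using u by auto
    have "(Q ^^ m) (\<lambda>v. norm v powr (\<sigma> * s)) u \<le> 1 + \<sigma> * s * gain m u + (\<sigma> * s)\<^sup>2 * Z"
      unfolding Z_def using abs_s s u by (intro second_order_bound) auto
    also have "(\<sigma> * s)\<^sup>2 * Z = s * (s * Z)"
    proof -
      have "(\<sigma> * s)\<^sup>2 = s\<^sup>2" using abs_s by (metis power2_abs)
      then show ?thesis by (simp only: power2_eq_square[of s] mult.assoc)
    qed
    also have "1 + \<sigma> * s * gain m u + s * (s * Z) \<le> 1 + \<beta> * real m"
    proof -
      have "\<sigma> * s * (gain m u - real m * exponent) \<le> \<bar>\<sigma> * s\<bar> * \<bar>gain m u - real m * exponent\<bar>"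
        by (metis abs_ge_self abs_mult)
      also have "\<dots> \<le> s * B" unfolding abs_s B_def using s gain_linear[OF nz] by (intro mult_left_mono) auto
      also have "\<dots> \<le> s * (real m * \<epsilon> / 2)" using s m by (intro mult_left_mono) auto
      finally have "\<sigma> * s * gain m u - \<sigma> * s * exponent * real m \<le> s * (real m * \<epsilon> / 2)"
        by (simp add: algebra_simps)
      moreover have "s * (s * Z) \<le> s * (real m * \<epsilon> / 2)" using s sZ by (intro mult_left_mono) auto
      ultimately show ?thesis by (simp add: \<beta>_def algebra_simps)
    qed
    also have "\<dots> \<le> exp (\<beta> * real m)" by (rule exp_ge_add_one_self)
    finally show ?thesis .
  qed
  show ?thesis
  proof (intro exI conjI allI impI)
    show "0 < s" "s \<le> p" using s p_pos by auto
    show "0 \<le> M ^ m * exp (\<bar>\<beta>\<bar> * real m)" using C_nonneg by simp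
    fix n and v :: "real \<times> real" assume v: "norm v = 1"
    then have "v \<noteq> 0" by auto
    have "\<bar>\<sigma> * s\<bar> \<le> p" using abs_s s p_pos by simp
    from Qn_norm_powr_le_from_block[OF this m(1) blk \<open>v \<noteq> 0\<close>, of n]
    show "(Q ^^ n) (\<lambda>v. norm v powr (\<sigma> * s)) v
        \<le> M ^ m * exp (\<bar>\<beta>\<bar> * real m) * exp ((\<sigma> * s * exponent + s * \<epsilon>) * real n)"
      using v by (simp add: \<beta>_def)
  qed
qed

text \<open>The exponential moments, damped by twice the error allowed in \<open>exponential_moment\<close>, have a finite
  sum over \<open>n\<close>.  So the sum of the damped powers is finite almost surely, and its terms are
  eventually less than 1.\<close>

lemma AE_one_sided:
  assumes \<nu>: "prob_space \<nu>" "sets \<nu> = sets borel" "\<mu> = distr \<nu> borel (\<lambda>x. x - E)"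
    and v: "norm v = 1" and \<epsilon>: "0 < \<epsilon>" and \<sigma>: "\<bar>\<sigma>\<bar> = 1"
  shows "AE \<omega> in bernoulli \<nu>. eventually
     (\<lambda>n. \<sigma> * (ln (norm (viter E n \<omega> v)) - real n * exponent) \<le> 2 * real n * \<epsilon>) sequentially"
proof -
  interpret \<nu>: prob_space \<nu> by fact
  have "\<exists>s K. 0 < s \<and> s \<le> p \<and> 0 \<le> K \<and> (\<forall>n v. norm v = 1 \<longrightarrow>
      (Q ^^ n) (\<lambda>v. norm v powr (\<sigma> * s)) v \<le> K * exp ((\<sigma> * s * exponent + s * \<epsilon>) * real n))"
    by (rule exponential_moment[OF \<epsilon> \<sigma>])
  then obtain s K where s: "0 < s" "s \<le> p" and K: "0 \<le> K"
    and bound: "\<And>n v. norm v = 1 \<Longrightarrow>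
      (Q ^^ n) (\<lambda>v. norm v powr (\<sigma> * s)) v \<le> K * exp ((\<sigma> * s * exponent + s * \<epsilon>) * real n)"
    by metis
  have tF: "tame (\<lambda>v. norm v powr (\<sigma> * s))" using s \<sigma> by (intro tame_norm_powr) (simp add: abs_mult)
  define c where "c n = exp (- (\<sigma> * s * exponent + 2 * s * \<epsilon>) * real n)" for n
  define f where "f n \<omega> = c n * norm (viter E n \<omega> v) powr (\<sigma> * s)" for n \<omega>
  have f0: "0 \<le> f n \<omega>" for n \<omega> by (simp add: f_def c_def)
  have qk: "(qplus ^^ n) F = (shifted_qplus \<nu> E ^^ n) F" if F: "F \<in> borel_measurable borel" for n F
  proof (induction n)
    case (Suc n)
    have [measurable_cong]: "sets \<nu> = sets borel" by fact
    define H where "H = (qplus ^^ n) F"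
    have [measurable]: "H \<in> borel_measurable borel" unfolding H_def by (rule measurable_qplusn[OF F])
    have "qplus H v = shifted_qplus \<nu> E H v" for v
    proof -
      have "qplus H v = (\<integral>\<^sup>+x. H (step x v) \<partial>distr \<nu> borel (\<lambda>x. x - E))"
        unfolding qplus_def by (rule arg_cong[OF \<nu>(3)])
      also have "\<dots> = shifted_qplus \<nu> E H v" unfolding shifted_qplus_def by (subst nn_integral_distr) auto
      finally show ?thesis .
    qed
    then have eq: "qplus H = shifted_qplus \<nu> E H" by (rule ext)
    have "(qplus ^^ Suc n) F = qplus H" by (simp add: H_def)
    also note eq
    also have "shifted_qplus \<nu> E H = (shifted_qplus \<nu> E ^^ Suc n) F" by (simp add: H_def Suc)
    finally show ?case .
  qed simp
  have [measurable]: "(\<lambda>\<omega>. viter E n \<omega> v) \<in> bernoulli \<nu> \<rightarrow>\<^sub>M borel" for n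
    unfolding bernoulli_def by (rule measurable_viter[OF \<nu>(2)]) auto
  have int: "(\<integral>\<^sup>+\<omega>. ennreal (f n \<omega>) \<partial>bernoulli \<nu>) \<le> ennreal (K * exp (- (s * \<epsilon>)) ^ n)" for n
  proof -
    have "(\<integral>\<^sup>+\<omega>. ennreal (f n \<omega>) \<partial>bernoulli \<nu>)
        = ennreal (c n) * (\<integral>\<^sup>+\<omega>. ennreal (norm (viter E n \<omega> v) powr (\<sigma> * s)) \<partial>bernoulli \<nu>)"
      by (simp add: f_def ennreal_mult' c_def nn_integral_cmult)
    also have "(\<integral>\<^sup>+\<omega>. ennreal (norm (viter E n \<omega> v) powr (\<sigma> * s)) \<partial>bernoulli \<nu>)
        = (qplus ^^ n) (\<lambda>v. ennreal (norm v powr (\<sigma> * s))) v"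
      by (subst qk, measurable) (rule nn_integral_viter[OF \<nu>(1,2)], measurable)
    also have "\<dots> = ennreal ((Q ^^ n) (\<lambda>v. norm v powr (\<sigma> * s)) v)"
      using tF by (simp add: ennreal_Qn)
    also have "ennreal (c n) * \<dots> \<le> ennreal (c n) * ennreal (K * exp ((\<sigma> * s * exponent + s * \<epsilon>) * real n))"
      by (intro mult_left_mono ennreal_leI bound v) auto
    also have "\<dots> = ennreal (K * (c n * exp ((\<sigma> * s * exponent + s * \<epsilon>) * real n)))"
      using K by (simp add: c_def ac_simps flip: ennreal_mult)
    also have "c n * exp ((\<sigma> * s * exponent + s * \<epsilon>) * real n) = exp (- (s * \<epsilon>)) ^ n"
      unfolding c_def exp_add[symmetric] exp_of_nat_mult[symmetric] by (simp add: algebra_simps)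
    finally show ?thesis .
  qed
  have "(\<integral>\<^sup>+\<omega>. (\<Sum>n. ennreal (f n \<omega>)) \<partial>bernoulli \<nu>) = (\<Sum>n. \<integral>\<^sup>+\<omega>. ennreal (f n \<omega>) \<partial>bernoulli \<nu>)"
    by (rule nn_integral_suminf) (simp add: f_def)
  also have "\<dots> \<le> (\<Sum>n. ennreal (K * exp (- (s * \<epsilon>)) ^ n))"
    by (intro suminf_le int) auto
  also have "\<dots> < \<infinity>"
  proof -
    have "summable (\<lambda>n. K * exp (- (s * \<epsilon>)) ^ n)"
      using s \<epsilon> by (intro summable_mult summable_geometric) auto
    then show ?thesis using K by (subst suminf_ennreal2) auto
  qed
  finally have "AE \<omega> in bernoulli \<nu>. (\<Sum>n. ennreal (f n \<omega>)) \<noteq> \<infinity>"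
    by (intro nn_integral_PInf_AE) (auto simp: f_def)
  then show ?thesis
  proof eventually_elim
    case (elim \<omega>)
    then have "summable (\<lambda>n. f n \<omega>)" using f0 by (intro summable_suminf_not_top) auto
    then have "(\<lambda>n. f n \<omega>) \<longlonglongrightarrow> 0" by (rule summable_LIMSEQ_zero)
    then have "eventually (\<lambda>n. f n \<omega> < 1) sequentially" by (rule order_tendstoD(2)) simp
    then show ?case
    proof eventually_elim
      case (elim n)
      define X where "X = ln (norm (viter E n \<omega> v))"
      have "v \<noteq> 0" using v by auto
      then have "f n \<omega> = exp (\<sigma> * s * X - (\<sigma> * s * exponent + 2 * s * \<epsilon>) * real n)"
        by (simp add: f_def c_def X_def powr_def algebra_simps flip: exp_add)
      with elim have "\<sigma> * s * X - (\<sigma> * s * exponent + 2 * s * \<epsilon>) * real n < 0" by simp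
      then have "s * (\<sigma> * (X - real n * exponent)) < s * (2 * real n * \<epsilon>)" by (simp add: algebra_simps)
      then show ?case using s by (simp add: X_def)
    qed
  qed
qed

lemma AE_growth:
  assumes \<nu>: "prob_space \<nu>" "sets \<nu> = sets borel" "\<mu> = distr \<nu> borel (\<lambda>x. x - E)"
    and v: "norm v = 1"
  shows "AE \<omega> in bernoulli \<nu>. (\<lambda>n. ln (norm (viter E n \<omega> v)) / real n) \<longlonglongrightarrow> exponent"
proof -
  let ?X = "\<lambda>\<omega> n. ln (norm (viter E n \<omega> v))"
  have "AE \<omega> in bernoulli \<nu>. \<forall>j. eventually
     (\<lambda>n. 1 * (?X \<omega> n - real n * exponent) \<le> 2 * real n * (1 / real (Suc j))) sequentially"
    unfolding AE_all_countable by (intro allI AE_one_sided[OF \<nu> v]) auto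
  moreover have "AE \<omega> in bernoulli \<nu>. \<forall>j. eventually
     (\<lambda>n. - 1 * (?X \<omega> n - real n * exponent) \<le> 2 * real n * (1 / real (Suc j))) sequentially"
    unfolding AE_all_countable by (intro allI AE_one_sided[OF \<nu> v]) auto
  ultimately show ?thesis
  proof eventually_elim
    case (elim \<omega>)
    show ?case
    proof (rule tendstoI)
      fix e :: real assume "0 < e"
      then obtain j where j: "2 / e < real j" using reals_Archimedean2 by blast
      have "2 * (1 / real (Suc j)) < e"
      proof -
        have "2 < e * real j" using j \<open>0 < e\<close> by (simp add: field_simps)
        also have "\<dots> \<le> e * real (Suc j)" using \<open>0 < e\<close> by (intro mult_left_mono) auto
        finally show ?thesis by (simp add: field_simps)
      qed
      note j = this
      from elim(1)[rule_format, of j] elim(2)[rule_format, of j] eventually_gt_at_top[of "0::nat"]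
      show "eventually (\<lambda>n. dist (?X \<omega> n / real n) exponent < e) sequentially"
      proof eventually_elim
        case (elim n)
        have "\<bar>?X \<omega> n - real n * exponent\<bar> \<le> real n * (2 * (1 / real (Suc j)))"
          using elim(1,2) by (simp add: abs_le_iff mult.commute mult.left_commute)
        also have "\<dots> < real n * e" using elim(3) j by (intro mult_strict_left_mono) auto
        finally have "\<bar>?X \<omega> n - real n * exponent\<bar> / real n < e" using elim(3) by (simp add: field_simps)
        moreover have "?X \<omega> n / real n - exponent = (?X \<omega> n - real n * exponent) / real n"
          using elim(3) by (simp add: field_simps)
        ultimately show ?case by (simp add: dist_real_def abs_divide)
      qed
    qed
  qed
qed

lemma AE_onorm_growth:
  assumes \<nu>: "prob_space \<nu>" "sets \<nu> = sets borel" "\<mu> = distr \<nu> borel (\<lambda>x. x - E)"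
  shows "AE \<omega> in bernoulli \<nu>. (\<lambda>n. ln (onorm (\<lambda>v. iterate E n \<omega> *v v)) / real n) \<longlonglongrightarrow> exponent"
proof -
  let ?e1 = "(1, 0) :: real \<times> real" and ?e2 = "(0, 1) :: real \<times> real"
  have n1: "norm ?e1 = 1" "norm ?e2 = 1" by (simp_all add: norm_prod_def)
  have nz: "?e1 \<noteq> 0" "?e2 \<noteq> 0" by (auto simp: prod_eq_iff)
  from AE_growth[OF \<nu> n1(1)] AE_growth[OF \<nu> n1(2)] show ?thesis
  proof eventually_elim
    case (elim \<omega>)
    define a where "a n = norm (viter E n \<omega> ?e1)" for n
    define b where "b n = norm (viter E n \<omega> ?e2)" for n
    define T where "T n = onorm (\<lambda>v. iterate E n \<omega> *v v)" for n
    have ab: "0 < a n" "0 < b n" for n using nz by (auto simp: a_def b_def)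
    have bounds: "a n \<le> T n" "T n \<le> a n + b n" for n
      using onorm_iterate_bounds[of E n \<omega>] by (auto simp: a_def b_def T_def)
    have up: "ln (T n) / real n \<le> ln 2 / real n + max (ln (a n) / real n) (ln (b n) / real n)" for n
    proof -
      have "ln (T n) \<le> ln (2 * max (a n) (b n))"
        using bounds[of n] ab[of n] by (subst ln_le_cancel_iff) auto
      also have "\<dots> = ln 2 + max (ln (a n)) (ln (b n))"
        using ab[of n] by (subst ln_mult_pos) (auto simp: max_def)
      finally have "ln (T n) / real n \<le> (ln 2 + max (ln (a n)) (ln (b n))) / real n"
        by (rule divide_right_mono) simp
      also have "\<dots> = ln 2 / real n + max (ln (a n) / real n) (ln (b n) / real n)"
        by (simp add: add_divide_distrib max_divide_distrib_right)
      finally show ?thesis .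
    qed
    have "(\<lambda>n. ln 2 / real n + max (ln (a n) / real n) (ln (b n) / real n)) \<longlonglongrightarrow> 0 + max exponent exponent"
      using elim by (intro tendsto_add tendsto_max lim_const_over_n) (auto simp: a_def b_def)
    moreover have "(\<lambda>n. ln (a n) / real n) \<longlonglongrightarrow> exponent" using elim(1) by (simp add: a_def)
    ultimately have "(\<lambda>n. ln (T n) / real n) \<longlonglongrightarrow> exponent"
    proof (rule_tac tendsto_sandwich[where f = "\<lambda>n. ln (a n) / real n" and h = "\<lambda>n. ln 2 / real n + max (ln (a n) / real n) (ln (b n) / real n)"])
      show "\<forall>\<^sub>F n in sequentially. ln (a n) / real n \<le> ln (T n) / real n"
      proof (intro always_eventually allI divide_right_mono)
        fix n show "ln (a n) \<le> ln (T n)"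
          using bounds(1)[of n] ab(1)[of n] by (subst ln_le_cancel_iff) auto
      qed auto
    qed (use up in auto)
    then show ?case by (simp add: T_def)
  qed
qed

lemma lyapunov_eq_exponent:
  assumes \<nu>: "prob_space \<nu>" "sets \<nu> = sets borel" "\<mu> = distr \<nu> borel (\<lambda>x. x - E)"
  shows "lyapunov \<nu> E = exponent"
  unfolding lyapunov_def
proof (rule the_equality)
  interpret \<nu>: prob_space \<nu> by fact
  interpret B: prob_space "bernoulli \<nu>" unfolding bernoulli_def by (rule prob_space_PiM) (rule \<nu>(1))
  show lim: "AE \<omega> in bernoulli \<nu>. (\<lambda>n. ln (onorm (\<lambda>v. iterate E n \<omega> *v v)) / real n) \<longlonglongrightarrow> exponent"
    by (rule AE_onorm_growth[OF \<nu>])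
  fix L assume "AE \<omega> in bernoulli \<nu>. (\<lambda>n. ln (onorm (\<lambda>v. iterate E n \<omega> *v v)) / real n) \<longlonglongrightarrow> L"
  with lim have "AE \<omega> in bernoulli \<nu>. L = exponent"
    by eventually_elim (rule LIMSEQ_unique)
  then show "L = exponent" by (simp add: B.AE_const)
qed

end

section \<open>Comparison of two laws along a coupling\<close>

lemma abs_fst_le_norm_step: "\<bar>fst v\<bar> \<le> norm (step x v)"
  using abs_snd_le_norm[of "step x v"] by (simp add: step_def)

text \<open>The area spanned by the two images is \<open>(x - y) a\<^sup>2\<close>, where \<open>a\<close> is the first coordinate of \<open>v\<close>, and
  both images have norm at least \<open>\<bar>a\<bar>\<close>.\<close>

lemma delta_step_le: "delta (step x v) (step y v) \<le> \<bar>x - y\<bar>"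
proof (cases "fst v = 0")
  case True
  then show ?thesis by (simp add: delta_def wedge_def step_def)
next
  case False
  have "wedge (step x v) (step y v) = (x - y) * (fst v * fst v)"
    by (simp add: wedge_def step_def algebra_simps)
  then have "delta (step x v) (step y v) = \<bar>x - y\<bar> * (\<bar>fst v\<bar> * \<bar>fst v\<bar> / (norm (step x v) * norm (step y v)))"
    by (simp add: delta_def abs_mult)
  also have "\<dots> \<le> \<bar>x - y\<bar> * 1"
  proof (rule mult_left_mono)
    have "v \<noteq> 0" using False by auto
    then have "0 < norm (step x v) * norm (step y v)" by simp
    moreover have "\<bar>fst v\<bar> * \<bar>fst v\<bar> \<le> norm (step x v) * norm (step y v)"
      by (intro mult_mono abs_fst_le_norm_step) auto
    ultimately show "\<bar>fst v\<bar> * \<bar>fst v\<bar> / (norm (step x v) * norm (step y v)) \<le> 1"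
      by (subst divide_le_eq_1_pos)
  qed simp
  finally show ?thesis by simp
qed

lemma abs_ln_norm_step_diff_le:
  assumes v: "v \<noteq> 0" and a: "0 < a" "a \<le> 1"
  shows "\<bar>ln (norm (step x v)) - ln (norm (step y v))\<bar> \<le> \<bar>x - y\<bar> powr a / a"
proof -
  have one: "ln (norm (step x v)) - ln (norm (step y v)) \<le> \<bar>x - y\<bar> powr a / a" for x y
  proof -
    have pos: "0 < norm (step x v)" "0 < norm (step y v)" using v by auto
    have "step x v = step y v + ((x - y) * fst v, 0)" by (simp add: step_def algebra_simps)
    then have "norm (step x v) \<le> norm (step y v) + norm ((x - y) * fst v, 0 :: real)"
      by (metis norm_triangle_ineq)
    also have "norm ((x - y) * fst v, 0 :: real) = \<bar>x - y\<bar> * \<bar>fst v\<bar>"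
      by (simp add: norm_prod_def abs_mult)
    also have "norm (step y v) + \<bar>x - y\<bar> * \<bar>fst v\<bar> \<le> norm (step y v) + \<bar>x - y\<bar> * norm (step y v)"
      by (intro add_left_mono mult_left_mono abs_fst_le_norm_step) auto
    also have "\<dots> = norm (step y v) * (1 + \<bar>x - y\<bar>)" by (simp add: algebra_simps)
    finally have "ln (norm (step x v)) \<le> ln (norm (step y v) * (1 + \<bar>x - y\<bar>))"
      using pos by (subst ln_le_cancel_iff) (auto intro!: mult_pos_pos)
    also have "\<dots> = ln (norm (step y v)) + ln (1 + \<bar>x - y\<bar>)"
      using pos by (intro ln_mult_pos) auto
    also have "ln (1 + \<bar>x - y\<bar>) \<le> \<bar>x - y\<bar> powr a / a" using a by (intro ln_one_plus_le) auto
    finally show ?thesis by simp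
  qed
  from one[of x y] one[of y x] show ?thesis by (simp add: abs_le_iff abs_minus_commute)
qed

lemma prob_space_of_coupling:
  assumes "\<pi> \<in> couplings \<mu> \<nu>" "prob_space \<mu>" "sets \<mu> = sets borel"
  shows "prob_space \<pi>"
proof (rule prob_spaceI)
  interpret prob_space \<mu> by fact
  have [measurable_cong]: "sets \<pi> = sets (borel \<Otimes>\<^sub>M borel)" and m: "distr \<pi> borel fst = \<mu>"
    using assms by (auto simp: couplings_def)
  have "emeasure \<pi> (space \<pi>) = emeasure (distr \<pi> borel fst) UNIV"
    by (subst emeasure_distr) auto
  also have "\<dots> = 1" using emeasure_space_1 sets_eq_imp_space_eq[OF assms(3)] by (simp add: m)
  finally show "emeasure \<pi> (space \<pi>) = 1" .
qed

locale coupled_laws = A: spread_law \<mu> p C y1 y2 y3 t R + B: spread_law \<nu> p C y1 y2 y3 t R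
  for \<mu> \<nu> :: "real measure" and p C y1 y2 y3 t R +
  fixes \<pi> :: "(real \<times> real) measure"
  assumes coupling: "\<pi> \<in> couplings \<mu> \<nu>"
begin

lemma sets_coupling [measurable_cong]: "sets \<pi> = sets (borel \<Otimes>\<^sub>M borel)"
  and marginals: "distr \<pi> borel fst = \<mu>" "distr \<pi> borel snd = \<nu>"
  using coupling by (auto simp: couplings_def)

lemma prob_space_coupling: "prob_space \<pi>"
  using prob_space_of_coupling[OF coupling A.prob_space_axioms A.sets_law] .

lemma coupling_integral_left:
  assumes "A.tame F"
  shows "integrable \<pi> (\<lambda>z. F (step (fst z) v))" "A.Q F v = (\<integral>z. F (step (fst z) v) \<partial>\<pi>)"
proof -
  have [measurable]: "F \<in> borel_measurable borel" using A.tame_measurable[OF assms] .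
  have I: "integrable (distr \<pi> borel fst) (\<lambda>x. F (step x v))"
    unfolding marginals by (rule A.tame_integrable[OF assms])
  then show "integrable \<pi> (\<lambda>z. F (step (fst z) v))"
    by (subst (asm) integrable_distr_eq) auto
  have "A.Q F v = (\<integral>x. F (step x v) \<partial>distr \<pi> borel fst)" unfolding A.Q_def marginals by (rule refl)
  also have "\<dots> = (\<integral>z. F (step (fst z) v) \<partial>\<pi>)" by (rule integral_distr) auto
  finally show "A.Q F v = (\<integral>z. F (step (fst z) v) \<partial>\<pi>)" .
qed

lemma coupling_integral_right:
  assumes "B.tame F"
  shows "integrable \<pi> (\<lambda>z. F (step (snd z) v))" "B.Q F v = (\<integral>z. F (step (snd z) v) \<partial>\<pi>)"
proof -
  have [measurable]: "F \<in> borel_measurable borel" using B.tame_measurable[OF assms] .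
  have I: "integrable (distr \<pi> borel snd) (\<lambda>x. F (step x v))"
    unfolding marginals by (rule B.tame_integrable[OF assms])
  then show "integrable \<pi> (\<lambda>z. F (step (snd z) v))"
    by (subst (asm) integrable_distr_eq) auto
  have "B.Q F v = (\<integral>x. F (step x v) \<partial>distr \<pi> borel snd)" unfolding B.Q_def marginals by (rule refl)
  also have "\<dots> = (\<integral>z. F (step (snd z) v) \<partial>\<pi>)" by (rule integral_distr) auto
  finally show "B.Q F v = (\<integral>z. F (step (snd z) v) \<partial>\<pi>)" .
qed

text \<open>Replace the steps of one walk by those of the other one at a time.  A replacement that is followed
  by \<open>k\<close> further steps changes the expected drift by at most \<open>hoelder_const * decay ^ k\<close> times the mean of
  \<open>delta\<close> to the power \<open>hoelder_exponent\<close>, to which \<open>delta_step_le\<close> applies.\<close>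

lemma exponent_diff_le_integral:
  assumes I: "integrable \<pi> (\<lambda>z. \<bar>fst z - snd z\<bar> powr A.hoelder_exponent)"
  shows "\<bar>A.exponent - B.exponent\<bar>
    \<le> (1 / A.hoelder_exponent + A.hoelder_const / (1 - A.decay)) * (\<integral>z. \<bar>fst z - snd z\<bar> powr A.hoelder_exponent \<partial>\<pi>)"
proof -
  interpret \<pi>: prob_space \<pi> by (rule prob_space_coupling)
  define D where "D = (\<integral>z. \<bar>fst z - snd z\<bar> powr A.hoelder_exponent \<partial>\<pi>)"
  have D: "0 \<le> D" by (simp add: D_def)
  note e = A.hoelder_exponent(1,4)
  have step_bound: "\<bar>(A.Q ^^ k) A.drift v - (B.Q ^^ k) B.drift v\<bar>
      \<le> D * (1 / A.hoelder_exponent + A.hoelder_const * (\<Sum>i<k. A.decay ^ i))" if "v \<noteq> 0" for k v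
    using that
  proof (induction k arbitrary: v)
    case 0
    have "A.drift v - B.drift v = A.Q A.lognorm v - B.Q B.lognorm v"
      by (simp add: A.drift_def B.drift_def)
    also have "\<dots> = (\<integral>z. A.lognorm (step (fst z) v) - A.lognorm (step (snd z) v) \<partial>\<pi>)"
      using coupling_integral_left[OF A.tame_lognorm, of v] coupling_integral_right[OF B.tame_lognorm, of v] by simp
    also have "\<bar>\<dots>\<bar> \<le> (\<integral>z. \<bar>A.lognorm (step (fst z) v) - A.lognorm (step (snd z) v)\<bar> \<partial>\<pi>)"
      by (rule integral_abs_bound)
    also have "\<dots> \<le> (\<integral>z. \<bar>fst z - snd z\<bar> powr A.hoelder_exponent / A.hoelder_exponent \<partial>\<pi>)"
      using I coupling_integral_left(1)[OF A.tame_lognorm, of v] coupling_integral_right(1)[OF B.tame_lognorm, of v]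
      by (intro integral_mono abs_ln_norm_step_diff_le 0 e) auto
    finally show ?case by (simp add: D_def)
  next
    case (Suc k)
    let ?f = "(A.Q ^^ k) A.drift" and ?g = "(B.Q ^^ k) B.drift"
    define S where "S = D * (1 / A.hoelder_exponent + A.hoelder_const * (\<Sum>i<k. A.decay ^ i))"
    have If: "integrable \<pi> (\<lambda>z. ?f (step (fst z) v))" and Qf: "(A.Q ^^ Suc k) A.drift v = (\<integral>z. ?f (step (fst z) v) \<partial>\<pi>)"
      using coupling_integral_left[OF A.tame_Qn[OF A.tame_drift], of k v] by auto
    have Ig: "integrable \<pi> (\<lambda>z. ?g (step (snd z) v))" and Qg: "(B.Q ^^ Suc k) B.drift v = (\<integral>z. ?g (step (snd z) v) \<partial>\<pi>)"
      using coupling_integral_right[OF B.tame_Qn[OF B.tame_drift], of k v] by auto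
    have "\<bar>(A.Q ^^ Suc k) A.drift v - (B.Q ^^ Suc k) B.drift v\<bar> = \<bar>\<integral>z. ?f (step (fst z) v) - ?g (step (snd z) v) \<partial>\<pi>\<bar>"
      unfolding Qf Qg using If Ig by simp
    also have "\<dots> \<le> (\<integral>z. \<bar>?f (step (fst z) v) - ?g (step (snd z) v)\<bar> \<partial>\<pi>)"
      by (rule integral_abs_bound)
    also have "\<dots> \<le> (\<integral>z. A.hoelder_const * A.decay ^ k * \<bar>fst z - snd z\<bar> powr A.hoelder_exponent + S \<partial>\<pi>)"
    proof (rule integral_mono)
      fix z
      have nz: "step (fst z) v \<noteq> 0" "step (snd z) v \<noteq> 0" using Suc(2) by auto
      have "\<bar>?f (step (fst z) v) - ?f (step (snd z) v)\<bar>
          \<le> A.hoelder_const * A.decay ^ k * delta (step (fst z) v) (step (snd z) v) powr A.hoelder_exponent"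
        by (rule A.Qn_drift_hoelder[OF nz])
      also have "\<dots> \<le> A.hoelder_const * A.decay ^ k * \<bar>fst z - snd z\<bar> powr A.hoelder_exponent"
        using A.hoelder_const_nonneg A.decay e
        by (intro mult_left_mono powr_mono2 delta_step_le delta_nonneg) auto
      finally show "\<bar>?f (step (fst z) v) - ?g (step (snd z) v)\<bar>
          \<le> A.hoelder_const * A.decay ^ k * \<bar>fst z - snd z\<bar> powr A.hoelder_exponent + S"
        using Suc(1)[OF nz(2)] unfolding S_def[symmetric] by linarith
    qed (use If Ig I in auto)
    also have "\<dots> = A.hoelder_const * A.decay ^ k * D + S"
      using I by (simp add: D_def \<pi>.prob_space)
    also have "\<dots> = D * (1 / A.hoelder_exponent + A.hoelder_const * (\<Sum>i<Suc k. A.decay ^ i))"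
      by (simp add: S_def algebra_simps)
    finally show ?case .
  qed
  define K where "K = 1 / A.hoelder_exponent + A.hoelder_const / (1 - A.decay)"
  have "\<bar>A.exponent - B.exponent\<bar> \<le> K * D + 2 * A.limit_const * A.decay ^ k" for k
  proof -
    let ?e = "(1, 0) :: real \<times> real"
    have nz: "?e \<noteq> 0" by (simp add: prod_eq_iff)
    have "(\<Sum>i<k. A.decay ^ i) \<le> 1 / (1 - A.decay)"
      using A.decay by (simp add: sum_gp_strict divide_right_mono)
    then have "A.hoelder_const * (\<Sum>i<k. A.decay ^ i) \<le> A.hoelder_const * (1 / (1 - A.decay))"
      using A.hoelder_const_nonneg by (rule mult_left_mono)
    then have "1 / A.hoelder_exponent + A.hoelder_const * (\<Sum>i<k. A.decay ^ i) \<le> K" by (simp add: K_def)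
    then have "D * (1 / A.hoelder_exponent + A.hoelder_const * (\<Sum>i<k. A.decay ^ i)) \<le> D * K"
      using D by (rule mult_left_mono)
    then have "\<bar>(A.Q ^^ k) A.drift ?e - (B.Q ^^ k) B.drift ?e\<bar> \<le> K * D"
      using step_bound[OF nz, of k] by (simp only: mult.commute[of K])
    then show ?thesis using A.Qn_drift_limit[OF nz, of k] B.Qn_drift_limit[OF nz, of k] by linarith
  qed
  moreover have "(\<lambda>k. K * D + 2 * A.limit_const * A.decay ^ k) \<longlonglongrightarrow> K * D + 2 * A.limit_const * 0"
    using A.decay by (intro tendsto_intros LIMSEQ_power_zero) auto
  ultimately have "\<bar>A.exponent - B.exponent\<bar> \<le> K * D + 2 * A.limit_const * 0"
    by (intro LIMSEQ_le_const) auto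
  then show ?thesis by (simp add: K_def D_def)
qed

text \<open>A form of Jensen's inequality: \<open>x powr hoelder_exponent\<close> is at most a constant plus a multiple of
  \<open>x powr p\<close>, balanced at \<open>x = h\<close>.\<close>

lemma exponent_diff_le_cost:
  assumes w: "0 < w" and cost: "(\<integral>\<^sup>+z. ennreal (\<bar>fst z - snd z\<bar> powr p) \<partial>\<pi>) \<le> ennreal w"
  shows "\<bar>A.exponent - B.exponent\<bar>
    \<le> 2 * (1 / A.hoelder_exponent + A.hoelder_const / (1 - A.decay)) * w powr (A.hoelder_exponent / p)"
proof -
  interpret \<pi>: prob_space \<pi> by (rule prob_space_coupling)
  have e: "0 < A.hoelder_exponent" "A.hoelder_exponent \<le> p" using A.hoelder_exponent by auto
  define h where "h = w powr (1 / p)"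
  have h: "0 < h" using w by (simp add: h_def)
  have Ip: "integrable \<pi> (\<lambda>z. \<bar>fst z - snd z\<bar> powr p)"
    using cost by (intro integrableI_bounded) (auto intro: le_less_trans)
  have intp: "(\<integral>z. \<bar>fst z - snd z\<bar> powr p \<partial>\<pi>) \<le> w"
    using cost w by (subst (asm) nn_integral_eq_integral[OF Ip]) (auto simp: ennreal_le_iff)
  have pt: "x powr A.hoelder_exponent \<le> h powr A.hoelder_exponent + h powr (A.hoelder_exponent - p) * x powr p" if "0 \<le> x" for x
  proof (cases "x \<le> h")
    case True
    then have "x powr A.hoelder_exponent \<le> h powr A.hoelder_exponent" using that e by (intro powr_mono2) auto
    then show ?thesis by (simp add: add_increasing2)
  next
    case False
    then have "x powr A.hoelder_exponent = x powr (A.hoelder_exponent - p) * x powr p" by (simp flip: powr_add)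
    also have "\<dots> \<le> h powr (A.hoelder_exponent - p) * x powr p"
      using False h e by (intro mult_right_mono powr_mono2') auto
    finally show ?thesis by (simp add: add_increasing)
  qed
  have Ib: "integrable \<pi> (\<lambda>z. h powr A.hoelder_exponent + h powr (A.hoelder_exponent - p) * \<bar>fst z - snd z\<bar> powr p)"
    using Ip by auto
  have I: "integrable \<pi> (\<lambda>z. \<bar>fst z - snd z\<bar> powr A.hoelder_exponent)"
    by (rule Bochner_Integration.integrable_bound[OF Ib]) (auto intro!: AE_I2 order_trans[OF pt])
  have "(\<integral>z. \<bar>fst z - snd z\<bar> powr A.hoelder_exponent \<partial>\<pi>) \<le> (\<integral>z. h powr A.hoelder_exponent + h powr (A.hoelder_exponent - p) * \<bar>fst z - snd z\<bar> powr p \<partial>\<pi>)"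
    by (intro integral_mono I Ib pt) auto
  also have "\<dots> = h powr A.hoelder_exponent + h powr (A.hoelder_exponent - p) * (\<integral>z. \<bar>fst z - snd z\<bar> powr p \<partial>\<pi>)"
    using Ip by (simp add: \<pi>.prob_space)
  also have "\<dots> \<le> h powr A.hoelder_exponent + h powr (A.hoelder_exponent - p) * w"
    using intp by (intro add_left_mono mult_left_mono) auto
  also have "h powr (A.hoelder_exponent - p) * w = h powr A.hoelder_exponent"
  proof -
    have "w = h powr p" using w A.p_pos by (simp add: h_def powr_powr)
    then show ?thesis by (metis powr_add diff_add_cancel)
  qed
  also have "h powr A.hoelder_exponent = w powr (A.hoelder_exponent / p)" by (simp add: h_def powr_powr)
  finally have "(\<integral>z. \<bar>fst z - snd z\<bar> powr A.hoelder_exponent \<partial>\<pi>) \<le> 2 * w powr (A.hoelder_exponent / p)" by simp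
  moreover define c where "c = 1 / A.hoelder_exponent + A.hoelder_const / (1 - A.decay)"
  moreover have "0 \<le> c" unfolding c_def
    using A.hoelder_const_nonneg A.decay e by (intro add_nonneg_nonneg divide_nonneg_nonneg) auto
  ultimately have "c * (\<integral>z. \<bar>fst z - snd z\<bar> powr A.hoelder_exponent \<partial>\<pi>) \<le> c * (2 * w powr (A.hoelder_exponent / p))"
    by (intro mult_left_mono) auto
  then show ?thesis using exponent_diff_le_integral[OF I] unfolding c_def[symmetric] by simp
qed

end

section \<open>Wasserstein neighbourhoods\<close>

lemma closed_msupport: "closed (msupport \<mu>)"
proof -
  have "\<exists>U. open U \<and> x \<in> U \<and> U \<subseteq> - msupport \<mu>" if "x \<notin> msupport \<mu>" for x
  proof -
    obtain U where "open U" "x \<in> U" "\<not> 0 < emeasure \<mu> U"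
      using \<open>x \<notin> msupport \<mu>\<close> by (auto simp: msupport_def)
    then show ?thesis by (intro exI[of _ U]) (auto simp: msupport_def)
  qed
  then have "open (- msupport \<mu>)" by (subst open_subopen) auto
  then show ?thesis by (simp add: closed_def)
qed

text \<open>A closed set that is not compact is unbounded.\<close>

lemma separated_support_points:
  assumes "\<not> compact (msupport \<mu>)"
  obtains y1 y2 y3 where "y1 \<in> msupport \<mu>" "y2 \<in> msupport \<mu>" "y3 \<in> msupport \<mu>"
    "6 \<le> \<bar>y1 - y2\<bar>" "6 \<le> \<bar>y1 - y3\<bar>" "6 \<le> \<bar>y2 - y3\<bar>"
proof -
  have "\<not> bounded (msupport \<mu>)"
    using assms closed_msupport compact_eq_bounded_closed by blast
  then have far: "\<exists>y\<in>msupport \<mu>. B < \<bar>y\<bar>" for B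
    unfolding bounded_iff by (auto simp: not_le)
  obtain y1 where y1: "y1 \<in> msupport \<mu>" using far by blast
  obtain y2 where y2: "y2 \<in> msupport \<mu>" "\<bar>y1\<bar> + 6 < \<bar>y2\<bar>" using far by blast
  obtain y3 where y3: "y3 \<in> msupport \<mu>" "\<bar>y2\<bar> + 6 < \<bar>y3\<bar>" using far by blast
  have "6 \<le> \<bar>y1 - y2\<bar>" "6 \<le> \<bar>y1 - y3\<bar>" "6 \<le> \<bar>y2 - y3\<bar>" using y2(2) y3(2) by linarith+
  then show thesis using that y1 y2(1) y3(1) by blast
qed

lemma product_coupling:
  assumes "prob_space \<mu>" "prob_space \<nu>" and [measurable_cong]: "sets \<mu> = sets borel" "sets \<nu> = sets borel"
  shows "\<mu> \<Otimes>\<^sub>M \<nu> \<in> couplings \<mu> \<nu>"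
proof -
  interpret M: prob_space \<mu> by fact
  interpret N: prob_space \<nu> by fact
  have sp: "space \<mu> = UNIV" "space \<nu> = UNIV" using assms(3,4)[THEN sets_eq_imp_space_eq] by auto
  have "distr (\<mu> \<Otimes>\<^sub>M \<nu>) borel fst = \<mu>"
  proof (rule measure_eqI)
    fix A assume "A \<in> sets (distr (\<mu> \<Otimes>\<^sub>M \<nu>) borel fst)"
    then have [measurable]: "A \<in> sets borel" by simp
    have "emeasure (distr (\<mu> \<Otimes>\<^sub>M \<nu>) borel fst) A = emeasure (\<mu> \<Otimes>\<^sub>M \<nu>) (A \<times> UNIV)"
      by (subst emeasure_distr) (auto simp: space_pair_measure sp intro!: arg_cong[where f = "emeasure (\<mu> \<Otimes>\<^sub>M \<nu>)"])
    also have "\<dots> = emeasure \<mu> A"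
      using N.emeasure_space_1 by (subst N.emeasure_pair_measure_Times) (auto simp: sp)
    finally show "emeasure (distr (\<mu> \<Otimes>\<^sub>M \<nu>) borel fst) A = emeasure \<mu> A" .
  qed (simp add: assms)
  moreover have "distr (\<mu> \<Otimes>\<^sub>M \<nu>) borel snd = \<nu>"
  proof (rule measure_eqI)
    fix A assume "A \<in> sets (distr (\<mu> \<Otimes>\<^sub>M \<nu>) borel snd)"
    then have [measurable]: "A \<in> sets borel" by simp
    have "emeasure (distr (\<mu> \<Otimes>\<^sub>M \<nu>) borel snd) A = emeasure (\<mu> \<Otimes>\<^sub>M \<nu>) (UNIV \<times> A)"
      by (subst emeasure_distr) (auto simp: space_pair_measure sp intro!: arg_cong[where f = "emeasure (\<mu> \<Otimes>\<^sub>M \<nu>)"])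
    also have "\<dots> = emeasure \<nu> A"
      using M.emeasure_space_1 by (subst N.emeasure_pair_measure_Times) (auto simp: sp)
    finally show "emeasure (distr (\<mu> \<Otimes>\<^sub>M \<nu>) borel snd) A = emeasure \<nu> A" .
  qed (simp add: assms)
  moreover have "sets (\<mu> \<Otimes>\<^sub>M \<nu>) = sets (borel \<Otimes>\<^sub>M borel)"
    by (rule sets_pair_measure_cong) (fact assms)+
  ultimately show ?thesis by (simp add: couplings_def)
qed

lemma abs_diff_powr_le:
  fixes a b p :: real
  assumes "0 < p" "p \<le> 1"
  shows "\<bar>a - b\<bar> powr p \<le> \<bar>a\<bar> powr p + \<bar>b\<bar> powr p"
proof -
  have "\<bar>a - b\<bar> powr p \<le> (\<bar>a\<bar> + \<bar>b\<bar>) powr p" using assms by (intro powr_mono2) auto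
  also have "\<dots> \<le> \<bar>a\<bar> powr p + \<bar>b\<bar> powr p" using assms by (intro powr_add_le) auto
  finally show ?thesis .
qed

text \<open>The product measure shows that the infimum of the costs is finite, so that a bound on the real
  number \<open>wasserstein p \<mu> \<nu>\<close> is a bound on the infimum.\<close>

lemma exists_coupling:
  assumes p: "0 < p" "p \<le> 1" and \<mu>: "\<mu> \<in> Lp_measures p C" and \<nu>: "\<nu> \<in> Lp_measures p C"
    and w: "wasserstein p \<mu> \<nu> < w"
  shows "\<exists>\<pi>\<in>couplings \<mu> \<nu>. (\<integral>\<^sup>+z. ennreal (\<bar>fst z - snd z\<bar> powr p) \<partial>\<pi>) \<le> ennreal w"
proof -
  let ?cost = "\<lambda>\<pi>. \<integral>\<^sup>+z. ennreal (\<bar>fst z - snd z\<bar> powr p) \<partial>\<pi>"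
  let ?I = "INF \<pi>\<in>couplings \<mu> \<nu>. ?cost \<pi>"
  have prod: "\<mu> \<Otimes>\<^sub>M \<nu> \<in> couplings \<mu> \<nu>"
    using \<mu> \<nu> by (intro product_coupling) (auto simp: Lp_measures_def)
  then have [measurable_cong]: "sets (\<mu> \<Otimes>\<^sub>M \<nu>) = sets (borel \<Otimes>\<^sub>M borel)"
    and m: "distr (\<mu> \<Otimes>\<^sub>M \<nu>) borel fst = \<mu>" "distr (\<mu> \<Otimes>\<^sub>M \<nu>) borel snd = \<nu>"
    by (auto simp: couplings_def)
  have "?I \<le> ?cost (\<mu> \<Otimes>\<^sub>M \<nu>)" using prod by (rule INF_lower)
  also have "\<dots> \<le> (\<integral>\<^sup>+z. ennreal (\<bar>fst z\<bar> powr p) + ennreal (\<bar>snd z\<bar> powr p) \<partial>(\<mu> \<Otimes>\<^sub>M \<nu>))"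
    using p by (intro nn_integral_mono) (simp add: abs_diff_powr_le ennreal_leI flip: ennreal_plus)
  also have "\<dots> = (\<integral>\<^sup>+z. ennreal (\<bar>fst z\<bar> powr p) \<partial>(\<mu> \<Otimes>\<^sub>M \<nu>)) + (\<integral>\<^sup>+z. ennreal (\<bar>snd z\<bar> powr p) \<partial>(\<mu> \<Otimes>\<^sub>M \<nu>))"
    by (rule nn_integral_add) measurable
  also have "(\<integral>\<^sup>+z. ennreal (\<bar>fst z\<bar> powr p) \<partial>(\<mu> \<Otimes>\<^sub>M \<nu>)) = (\<integral>\<^sup>+x. ennreal (\<bar>x\<bar> powr p) \<partial>distr (\<mu> \<Otimes>\<^sub>M \<nu>) borel fst)"
    by (subst nn_integral_distr) auto
  also have "(\<integral>\<^sup>+z. ennreal (\<bar>snd z\<bar> powr p) \<partial>(\<mu> \<Otimes>\<^sub>M \<nu>)) = (\<integral>\<^sup>+x. ennreal (\<bar>x\<bar> powr p) \<partial>distr (\<mu> \<Otimes>\<^sub>M \<nu>) borel snd)"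
    by (subst nn_integral_distr) auto
  also have "(\<integral>\<^sup>+x. ennreal (\<bar>x\<bar> powr p) \<partial>distr (\<mu> \<Otimes>\<^sub>M \<nu>) borel fst)
      + (\<integral>\<^sup>+x. ennreal (\<bar>x\<bar> powr p) \<partial>distr (\<mu> \<Otimes>\<^sub>M \<nu>) borel snd) \<le> ennreal C + ennreal C"
    unfolding m using \<mu> \<nu> by (intro add_mono) (auto simp: Lp_measures_def)
  also have "\<dots> < \<top>" by simp
  finally have fin: "?I < \<top>" .
  have "?I = ennreal (wasserstein p \<mu> \<nu>)" unfolding wasserstein_def using fin by simp
  also have "\<dots> < ennreal w" using w by (intro ennreal_lessI) (auto simp: wasserstein_def intro: le_less_trans[OF enn2real_nonneg])
  finally obtain \<pi> where "\<pi> \<in> couplings \<mu> \<nu>" "?cost \<pi> < ennreal w" by (auto simp: INF_less_iff)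
  then show ?thesis by (auto intro: less_imp_le)
qed

text \<open>Mass of the smaller ball leaves the larger one only by being moved over at least one half.\<close>

lemma coupling_ball_mass:
  assumes \<pi>: "\<pi> \<in> couplings \<mu> \<nu>" and \<mu>: "prob_space \<mu>" "sets \<mu> = sets borel" and \<nu>: "prob_space \<nu>"
    and p: "0 < p" and cost: "(\<integral>\<^sup>+z. ennreal (\<bar>fst z - snd z\<bar> powr p) \<partial>\<pi>) \<le> ennreal w" and w: "0 \<le> w"
  shows "measure \<mu> (ball y (1/2)) \<le> measure \<nu> (ball y 1) + 2 powr p * w"
proof -
  interpret \<pi>: prob_space \<pi> by (rule prob_space_of_coupling[OF \<pi> \<mu>])
  interpret \<mu>: prob_space \<mu> by fact
  interpret \<nu>: prob_space \<nu> by fact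
  have S[measurable_cong]: "sets \<pi> = sets (borel \<Otimes>\<^sub>M borel)"
    and m: "distr \<pi> borel fst = \<mu>" "distr \<pi> borel snd = \<nu>"
    using \<pi> by (auto simp: couplings_def)
  have sp: "space \<pi> = UNIV" using sets_eq_imp_space_eq[OF S] by (simp add: space_pair_measure)
  have "{z \<in> space \<pi>. \<bar>y - snd z\<bar> < 1} \<in> sets \<pi>" "{z \<in> space \<pi>. 1/2 \<le> \<bar>fst z - snd z\<bar>} \<in> sets \<pi>"
    by measurable
  then have meas: "snd -` ball y 1 \<in> sets \<pi>" "{z. 1/2 \<le> \<bar>fst z - snd z\<bar>} \<in> sets \<pi>"
    by (simp_all only: sp vimage_def UNIV_I simp_thms mem_ball dist_real_def)
  have "emeasure \<mu> (ball y (1/2)) = emeasure \<pi> (fst -` ball y (1/2))"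
    unfolding m(1)[symmetric] by (subst emeasure_distr) (auto simp: sp)
  also have "\<dots> \<le> emeasure \<pi> (snd -` ball y 1 \<union> {z. 1/2 \<le> \<bar>fst z - snd z\<bar>})"
  proof (rule emeasure_mono)
    show "fst -` ball y (1/2) \<subseteq> snd -` ball y 1 \<union> {z. 1/2 \<le> \<bar>fst z - snd z\<bar>}"
      by (auto simp: dist_real_def abs_if split: if_splits)
  qed (intro sets.Un meas)
  also have "\<dots> \<le> emeasure \<pi> (snd -` ball y 1) + emeasure \<pi> {z. 1/2 \<le> \<bar>fst z - snd z\<bar>}"
    by (intro emeasure_subadditive meas)
  also have "emeasure \<pi> (snd -` ball y 1) = emeasure \<nu> (ball y 1)"
    unfolding m(2)[symmetric] by (subst emeasure_distr) (auto simp: sp)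
  also have "emeasure \<pi> {z. 1/2 \<le> \<bar>fst z - snd z\<bar>} \<le> ennreal (2 powr p) * ennreal w"
  proof -
    have "emeasure \<pi> {z. 1/2 \<le> \<bar>fst z - snd z\<bar>} = (\<integral>\<^sup>+z. indicator {z. 1/2 \<le> \<bar>fst z - snd z\<bar>} z \<partial>\<pi>)"
      by (rule nn_integral_indicator[symmetric, OF meas(2)])
    also have "\<dots> \<le> (\<integral>\<^sup>+z. ennreal (2 powr p) * ennreal (\<bar>fst z - snd z\<bar> powr p) \<partial>\<pi>)"
    proof (rule nn_integral_mono)
      fix z :: "real \<times> real"
      have "1 \<le> 2 powr p * \<bar>fst z - snd z\<bar> powr p" if "1/2 \<le> \<bar>fst z - snd z\<bar>"
      proof -
        have "1 powr p \<le> (2 * \<bar>fst z - snd z\<bar>) powr p" using that p by (intro powr_mono2) auto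
        then show ?thesis by (simp add: powr_mult)
      qed
      then show "indicator {z. 1/2 \<le> \<bar>fst z - snd z\<bar>} z \<le> ennreal (2 powr p) * ennreal (\<bar>fst z - snd z\<bar> powr p)"
        by (auto simp: indicator_def simp flip: ennreal_mult ennreal_1)
    qed
    also have "\<dots> = ennreal (2 powr p) * (\<integral>\<^sup>+z. ennreal (\<bar>fst z - snd z\<bar> powr p) \<partial>\<pi>)"
      by (rule nn_integral_cmult) measurable
    also have "\<dots> \<le> ennreal (2 powr p) * ennreal w" by (intro mult_left_mono cost) auto
    finally show ?thesis .
  qed
  finally show ?thesis
    using w by (simp add: \<mu>.emeasure_eq_measure \<nu>.emeasure_eq_measure ennreal_le_iff add_left_mono flip: ennreal_mult ennreal_plus)
qed

lemma shifted_spread_law: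
  assumes p: "0 < p" "p \<le> 1" and \<nu>: "\<nu> \<in> Lp_measures p C" and t: "0 < t"
    and sep: "6 \<le> \<bar>y1 - y2\<bar>" "6 \<le> \<bar>y1 - y3\<bar>" "6 \<le> \<bar>y2 - y3\<bar>"
    and heavy: "t \<le> measure \<nu> (ball y1 1)" "t \<le> measure \<nu> (ball y2 1)" "t \<le> measure \<nu> (ball y3 1)"
    and E: "\<bar>E0 - E\<bar> < 1/2"
  shows "spread_law (distr \<nu> borel (\<lambda>x. x - E)) p (\<bar>C\<bar> + (\<bar>E0\<bar> + 1) powr p)
    (y1 - E0) (y2 - E0) (y3 - E0) t (\<bar>y1\<bar> + \<bar>y2\<bar> + \<bar>y3\<bar> + \<bar>E0\<bar> + 2)"
proof -
  have S[measurable_cong]: "sets \<nu> = sets borel" and "prob_space \<nu>"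
    and mom: "(\<integral>\<^sup>+ x. ennreal (\<bar>x\<bar> powr p) \<partial>\<nu>) \<le> ennreal C"
    using \<nu> by (auto simp: Lp_measures_def)
  interpret \<nu>: prob_space \<nu> by fact
  let ?\<mu> = "distr \<nu> borel (\<lambda>x. x - E)"
  have sp: "space \<nu> = UNIV" using sets_eq_imp_space_eq[OF S] by simp
  interpret \<mu>: prob_space ?\<mu> by (rule \<nu>.prob_space_distr) measurable
  have ball: "t \<le> measure ?\<mu> (ball (y - E0) (3/2))" if "t \<le> measure \<nu> (ball y 1)" for y
  proof -
    have "measure \<nu> (ball y 1) \<le> measure \<nu> ((\<lambda>x. x - E) -` ball (y - E0) (3/2) \<inter> space \<nu>)"
    proof (rule \<nu>.finite_measure_mono)
      show "ball y 1 \<subseteq> (\<lambda>x. x - E) -` ball (y - E0) (3/2) \<inter> space \<nu>"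
        using E by (auto simp: sp dist_real_def abs_if split: if_splits)
      show "(\<lambda>x. x - E) -` ball (y - E0) (3/2) \<inter> space \<nu> \<in> sets \<nu>" by measurable
    qed
    also have "\<dots> = measure ?\<mu> (ball (y - E0) (3/2))" by (subst measure_distr) auto
    finally show ?thesis using that by simp
  qed
  have "(\<integral>\<^sup>+ x. ennreal (\<bar>x\<bar> powr p) \<partial>?\<mu>) = (\<integral>\<^sup>+ x. ennreal (\<bar>x - E\<bar> powr p) \<partial>\<nu>)"
    by (subst nn_integral_distr) auto
  also have "\<dots> \<le> (\<integral>\<^sup>+ x. ennreal (\<bar>x\<bar> powr p) + ennreal ((\<bar>E0\<bar> + 1) powr p) \<partial>\<nu>)"
  proof (rule nn_integral_mono)
    fix x
    have "\<bar>E\<bar> \<le> \<bar>E0\<bar> + 1" using E by linarith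
    then have "\<bar>E\<bar> powr p \<le> (\<bar>E0\<bar> + 1) powr p" using p by (intro powr_mono2) auto
    then have "\<bar>x - E\<bar> powr p \<le> \<bar>x\<bar> powr p + (\<bar>E0\<bar> + 1) powr p"
      using abs_diff_powr_le[OF p, of x E] by simp
    then show "ennreal (\<bar>x - E\<bar> powr p) \<le> ennreal (\<bar>x\<bar> powr p) + ennreal ((\<bar>E0\<bar> + 1) powr p)"
      by (simp add: ennreal_leI flip: ennreal_plus)
  qed
  also have "\<dots> = (\<integral>\<^sup>+ x. ennreal (\<bar>x\<bar> powr p) \<partial>\<nu>) + ennreal ((\<bar>E0\<bar> + 1) powr p)"
    by (subst nn_integral_add) (auto simp: \<nu>.emeasure_space_1)
  also have "\<dots> \<le> ennreal \<bar>C\<bar> + ennreal ((\<bar>E0\<bar> + 1) powr p)"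
    by (intro add_right_mono order_trans[OF mom] ennreal_leI) auto
  also have "\<dots> = ennreal (\<bar>C\<bar> + (\<bar>E0\<bar> + 1) powr p)" by simp
  finally have mom': "(\<integral>\<^sup>+ x. ennreal (\<bar>x\<bar> powr p) \<partial>?\<mu>) \<le> ennreal (\<bar>C\<bar> + (\<bar>E0\<bar> + 1) powr p)" .
  show ?thesis
    using p t sep ball[OF heavy(1)] ball[OF heavy(2)] ball[OF heavy(3)] mom'
    by unfold_locales auto
qed

lemma shifted_coupling:
  assumes p: "0 < p" "p \<le> 1" and \<pi>: "\<pi> \<in> couplings \<mu> \<nu>" and \<mu>: "prob_space \<mu>" "sets \<mu> = sets borel"
    and cost: "(\<integral>\<^sup>+z. ennreal (\<bar>fst z - snd z\<bar> powr p) \<partial>\<pi>) \<le> ennreal w" and w: "0 \<le> w"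
  shows "\<exists>\<pi>'\<in>couplings (distr \<mu> borel (\<lambda>x. x - E)) (distr \<nu> borel (\<lambda>x. x - F)).
    (\<integral>\<^sup>+z. ennreal (\<bar>fst z - snd z\<bar> powr p) \<partial>\<pi>') \<le> ennreal (w + \<bar>E - F\<bar> powr p)"
proof -
  interpret \<pi>: prob_space \<pi> by (rule prob_space_of_coupling[OF \<pi> \<mu>])
  have S[measurable_cong]: "sets \<pi> = sets (borel \<Otimes>\<^sub>M borel)"
    and m: "distr \<pi> borel fst = \<mu>" "distr \<pi> borel snd = \<nu>"
    using \<pi> by (auto simp: couplings_def)
  define T where "T = (\<lambda>z :: real \<times> real. (fst z - E, snd z - F))"
  have T[measurable]: "T \<in> \<pi> \<rightarrow>\<^sub>M borel \<Otimes>\<^sub>M borel" unfolding T_def by measurable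
  define \<pi>' where "\<pi>' = distr \<pi> (borel \<Otimes>\<^sub>M borel) T"
  have "distr \<pi>' borel fst = distr \<pi> borel (\<lambda>z. fst z - E)"
    unfolding \<pi>'_def by (subst distr_distr) (auto simp: T_def comp_def)
  also have "\<dots> = distr (distr \<pi> borel fst) borel (\<lambda>x. x - E)"
    by (subst distr_distr) (auto simp: comp_def)
  finally have 1: "distr \<pi>' borel fst = distr \<mu> borel (\<lambda>x. x - E)" by (simp only: m)
  have "distr \<pi>' borel snd = distr \<pi> borel (\<lambda>z. snd z - F)"
    unfolding \<pi>'_def by (subst distr_distr) (auto simp: T_def comp_def)
  also have "\<dots> = distr (distr \<pi> borel snd) borel (\<lambda>x. x - F)"
    by (subst distr_distr) (auto simp: comp_def)
  finally have 2: "distr \<pi>' borel snd = distr \<nu> borel (\<lambda>x. x - F)" by (simp only: m)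
  have "(\<integral>\<^sup>+z. ennreal (\<bar>fst z - snd z\<bar> powr p) \<partial>\<pi>') = (\<integral>\<^sup>+z. ennreal (\<bar>(fst z - snd z) - (E - F)\<bar> powr p) \<partial>\<pi>)"
    unfolding \<pi>'_def by (subst nn_integral_distr) (auto simp: T_def algebra_simps)
  also have "\<dots> \<le> (\<integral>\<^sup>+z. ennreal (\<bar>fst z - snd z\<bar> powr p) + ennreal (\<bar>E - F\<bar> powr p) \<partial>\<pi>)"
    by (intro nn_integral_mono) (simp add: abs_diff_powr_le[OF p] ennreal_leI flip: ennreal_plus)
  also have "\<dots> = (\<integral>\<^sup>+z. ennreal (\<bar>fst z - snd z\<bar> powr p) \<partial>\<pi>) + ennreal (\<bar>E - F\<bar> powr p)"
    by (subst nn_integral_add) (auto simp: \<pi>.emeasure_space_1)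
  also have "\<dots> \<le> ennreal w + ennreal (\<bar>E - F\<bar> powr p)" by (intro add_right_mono cost)
  also have "\<dots> = ennreal (w + \<bar>E - F\<bar> powr p)" using w by simp
  finally have 3: "(\<integral>\<^sup>+z. ennreal (\<bar>fst z - snd z\<bar> powr p) \<partial>\<pi>') \<le> ennreal (w + \<bar>E - F\<bar> powr p)" .
  have "\<pi>' \<in> couplings (distr \<mu> borel (\<lambda>x. x - E)) (distr \<nu> borel (\<lambda>x. x - F))"
    using 1 2 by (simp add: couplings_def \<pi>'_def)
  with 3 show ?thesis by blast
qed

text \<open>This settles two points at distance 0 in the product metric: a coupling is only available for costs
  that strictly exceed the Wasserstein distance.\<close>

lemma zero_of_small_powr_bounds:
  fixes x K a :: real
  assumes "0 < a" "0 \<le> K" "\<And>e. 0 < e \<Longrightarrow> e < 1 \<Longrightarrow> x \<le> K * e powr a"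
  shows "x \<le> 0"
proof (rule ccontr)
  assume "\<not> x \<le> 0"
  then have x: "0 < x" by simp
  define e where "e = min (1/2) ((x / (2 * (K + 1))) powr (1 / a))"
  have e: "0 < e" "e < 1" using x assms by (auto simp: e_def)
  have "e powr a \<le> ((x / (2 * (K + 1))) powr (1 / a)) powr a"
    using e assms by (intro powr_mono2) (auto simp: e_def)
  also have "\<dots> = x / (2 * (K + 1))" using assms x by (simp add: powr_powr)
  finally have "K * e powr a \<le> K * (x / (2 * (K + 1)))" using assms by (intro mult_left_mono)
  also have "\<dots> = x * (K / (2 * (K + 1)))" by simp
  also have "\<dots> < x * 1" using x assms(2) by (intro mult_strict_left_mono) (auto simp: divide_less_eq)
  finally show False using assms(3)[OF e] by (simp only: mult_1_right)
qed

theorem proposition9p1: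
  fixes p C :: real
  assumes "0 < p" and "p \<le> 1"
  shows "locally_hoelder_on (Lp_measures p C \<times> (UNIV :: real set))
           (prod_dist (wasserstein p) dist) (\<lambda>(\<mu>, E). lyapunov \<mu> E)"
  unfolding locally_hoelder_on_def
proof
  note p = assms
  let ?d = "prod_dist (wasserstein p) dist"
  fix x :: "real measure \<times> real" assume "x \<in> Lp_measures p C \<times> UNIV"
  then obtain \<mu>0 E0 where x: "x = (\<mu>0, E0)" and \<mu>0: "\<mu>0 \<in> Lp_measures p C" by auto
  have \<mu>0': "prob_space \<mu>0" "sets \<mu>0 = sets borel" "\<not> compact (msupport \<mu>0)"
    using \<mu>0 by (auto simp: Lp_measures_def)
  interpret \<mu>0: prob_space \<mu>0 by fact
  obtain y1 y2 y3 where y: "y1 \<in> msupport \<mu>0" "y2 \<in> msupport \<mu>0" "y3 \<in> msupport \<mu>0"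
    and sep: "6 \<le> \<bar>y1 - y2\<bar>" "6 \<le> \<bar>y1 - y3\<bar>" "6 \<le> \<bar>y2 - y3\<bar>"
    using separated_support_points[OF \<mu>0'(3)] by blast
  have pos: "0 < measure \<mu>0 (ball y (1/2))" if "y \<in> msupport \<mu>0" for y
  proof -
    have "0 < emeasure \<mu>0 (ball y (1/2))" using that by (auto simp: msupport_def)
    then show ?thesis by (simp add: \<mu>0.emeasure_eq_measure)
  qed
  define t where "t = Min {measure \<mu>0 (ball y1 (1/2)), measure \<mu>0 (ball y2 (1/2)), measure \<mu>0 (ball y3 (1/2))} / 2"
  have t: "0 < t" using pos y by (simp add: t_def)
  have t2: "2 * t \<le> measure \<mu>0 (ball y1 (1/2))" "2 * t \<le> measure \<mu>0 (ball y2 (1/2))" "2 * t \<le> measure \<mu>0 (ball y3 (1/2))"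
    by (auto simp: t_def)
  define r where "r = min (1/2) (t / 2 powr p)"
  have r: "0 < r" "r \<le> 1/2" "2 powr p * r \<le> t"
  proof -
    show "0 < r" using t by (simp add: r_def)
    show "r \<le> 1/2" unfolding r_def by (rule min.cobounded1)
    have "2 powr p * r \<le> 2 powr p * (t / 2 powr p)" by (intro mult_left_mono) (auto simp: r_def)
    then show "2 powr p * r \<le> t" by simp
  qed
  define C' where "C' = \<bar>C\<bar> + (\<bar>E0\<bar> + 1) powr p"
  define R where "R = \<bar>y1\<bar> + \<bar>y2\<bar> + \<bar>y3\<bar> + \<bar>E0\<bar> + 2"
  have W_nonneg: "0 \<le> wasserstein p \<mu> \<nu>" for \<mu> \<nu> by (simp add: wasserstein_def)
  have d: "wasserstein p \<mu> \<nu> \<le> ?d (\<mu>, E) (\<nu>, F)" "\<bar>E - F\<bar> \<le> ?d (\<mu>, E) (\<nu>, F)" for \<mu> \<nu> E F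
    unfolding prod_dist_def dist_real_def by (auto intro!: real_le_rsqrt)
  have near: "spread_law (distr \<nu> borel (\<lambda>x. x - E)) p C' (y1 - E0) (y2 - E0) (y3 - E0) t R"
    if \<nu>: "\<nu> \<in> Lp_measures p C" and dr: "?d x (\<nu>, E) < r" for \<nu> E
  proof -
    have W: "wasserstein p \<mu>0 \<nu> < r" and E: "\<bar>E0 - E\<bar> < 1/2"
      using d(1)[of \<mu>0 \<nu> E0 E] d(2)[of E0 E \<mu>0 \<nu>] dr r by (auto simp: x)
    obtain \<pi> where \<pi>: "\<pi> \<in> couplings \<mu>0 \<nu>" "(\<integral>\<^sup>+z. ennreal (\<bar>fst z - snd z\<bar> powr p) \<partial>\<pi>) \<le> ennreal r"
      using exists_coupling[OF p \<mu>0 \<nu> W] by blast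
    have "prob_space \<nu>" using \<nu> by (auto simp: Lp_measures_def)
    note mass = coupling_ball_mass[OF \<pi>(1) \<mu>0'(1,2) this p(1) \<pi>(2)]
    show ?thesis
      unfolding C'_def R_def
      using mass[of y1] mass[of y2] mass[of y3] r t2
      by (intro shifted_spread_law p \<nu> t sep E) auto
  qed
  \<comment> \<open>The constants of this interpretation serve for all points of the neighbourhood.\<close>
  interpret Z: spread_law "distr \<mu>0 borel (\<lambda>x. x - E0)" p C' "y1 - E0" "y2 - E0" "y3 - E0" t R
  proof -
    have "2 * t \<le> measure \<mu>0 (ball y 1)" if "2 * t \<le> measure \<mu>0 (ball y (1/2))" for y
    proof -
      have "measure \<mu>0 (ball y (1/2)) \<le> measure \<mu>0 (ball y 1)"
        using \<mu>0'(2) by (intro \<mu>0.finite_measure_mono) auto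
      with that show ?thesis by linarith
    qed
    from this[OF t2(1)] this[OF t2(2)] this[OF t2(3)]
    show "spread_law (distr \<mu>0 borel (\<lambda>x. x - E0)) p C' (y1 - E0) (y2 - E0) (y3 - E0) t R"
      unfolding C'_def R_def using t by (intro shifted_spread_law p \<mu>0 sep) auto
  qed
  define a where "a = Z.hoelder_exponent"
  have a: "0 < a" "a \<le> 1" using Z.hoelder_exponent by (auto simp: a_def)
  define K1 where "K1 = 2 * (1 / Z.hoelder_exponent + Z.hoelder_const / (1 - Z.decay))"
  define K where "K = max K1 (Z.M / p + Z.limit_const)"
  have K: "0 \<le> K"
  proof -
    have "0 \<le> Z.M / p + Z.limit_const"
      using Z.limit_const_nonneg Z.C_nonneg p by (intro add_nonneg_nonneg divide_nonneg_nonneg) auto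
    then show ?thesis by (simp add: K_def)
  qed
  define K' where "K' = 2 * K + K * 3 powr (a / p)"
  have K': "2 * K \<le> K'" "K * 3 powr (a / p) \<le> K'" "0 \<le> K'" using K by (auto simp: K'_def)
  have main: "\<bar>lyapunov \<mu> E - lyapunov \<nu> F\<bar> \<le> K' * ?d (\<mu>, E) (\<nu>, F) powr a"
    if \<mu>: "\<mu> \<in> Lp_measures p C" and \<nu>: "\<nu> \<in> Lp_measures p C"
      and dr: "?d x (\<mu>, E) < r" "?d x (\<nu>, F) < r" for \<mu> \<nu> E F
  proof -
    have \<mu>': "prob_space \<mu>" "sets \<mu> = sets borel" and \<nu>': "prob_space \<nu>" "sets \<nu> = sets borel"
      using \<mu> \<nu> by (auto simp: Lp_measures_def)
    interpret A: spread_law "distr \<mu> borel (\<lambda>x. x - E)" p C' "y1 - E0" "y2 - E0" "y3 - E0" t R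
      by (rule near[OF \<mu> dr(1)])
    interpret B: spread_law "distr \<nu> borel (\<lambda>x. x - F)" p C' "y1 - E0" "y2 - E0" "y3 - E0" t R
      by (rule near[OF \<nu> dr(2)])
    have lA: "lyapunov \<mu> E = A.exponent" by (rule A.lyapunov_eq_exponent[OF \<mu>' refl])
    have lB: "lyapunov \<nu> F = B.exponent" by (rule B.lyapunov_eq_exponent[OF \<nu>' refl])
    have bdd: "\<bar>lyapunov \<mu> E\<bar> \<le> K" "\<bar>lyapunov \<nu> F\<bar> \<le> K"
      using A.abs_exponent_le B.abs_exponent_le by (auto simp: lA lB K_def)
    define D where "D = ?d (\<mu>, E) (\<nu>, F)"
    have D: "wasserstein p \<mu> \<nu> \<le> D" "\<bar>E - F\<bar> \<le> D" unfolding D_def by (rule d)+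
    have D0: "0 \<le> D" using D(2) by linarith
    have small: "\<bar>lyapunov \<mu> E - lyapunov \<nu> F\<bar> \<le> K' * e powr a" if e: "0 < e" "D \<le> e" "e \<le> 1" for e
    proof -
      \<comment> \<open>The factor 2 makes the inequality strict.\<close>
      have "wasserstein p \<mu> \<nu> < 2 * e" using D e by simp
      then obtain \<pi> where \<pi>: "\<pi> \<in> couplings \<mu> \<nu>" "(\<integral>\<^sup>+z. ennreal (\<bar>fst z - snd z\<bar> powr p) \<partial>\<pi>) \<le> ennreal (2 * e)"
        using exists_coupling[OF p \<mu> \<nu>] by blast
      have "0 \<le> 2 * e" using e by simp
      from shifted_coupling[OF p \<pi>(1) \<mu>' \<pi>(2) this]
      obtain \<pi>' where \<pi>': "\<pi>' \<in> couplings (distr \<mu> borel (\<lambda>x. x - E)) (distr \<nu> borel (\<lambda>x. x - F))"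
        and cost: "(\<integral>\<^sup>+z. ennreal (\<bar>fst z - snd z\<bar> powr p) \<partial>\<pi>') \<le> ennreal (2 * e + \<bar>E - F\<bar> powr p)"
        by blast
      have w: "0 < 2 * e + \<bar>E - F\<bar> powr p" using e by (intro add_pos_nonneg) auto
      have "2 * e + \<bar>E - F\<bar> powr p \<le> 3 * e powr p"
      proof -
        have "e powr 1 \<le> e powr p" using e p by (intro powr_mono') auto
        moreover have "\<bar>E - F\<bar> powr p \<le> e powr p" using D e p by (intro powr_mono2) auto
        ultimately show ?thesis using e by simp
      qed
      then have "(2 * e + \<bar>E - F\<bar> powr p) powr (a / p) \<le> (3 * e powr p) powr (a / p)"
        using w a p by (intro powr_mono2) auto
      also have "\<dots> = 3 powr (a / p) * e powr a" using p by (simp add: powr_mult powr_powr)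
      finally have pw: "(2 * e + \<bar>E - F\<bar> powr p) powr (a / p) \<le> 3 powr (a / p) * e powr a" .
      interpret P: coupled_laws "distr \<mu> borel (\<lambda>x. x - E)" "distr \<nu> borel (\<lambda>x. x - F)"
        p C' "y1 - E0" "y2 - E0" "y3 - E0" t R \<pi>'
        by unfold_locales (rule \<pi>')
      have "\<bar>lyapunov \<mu> E - lyapunov \<nu> F\<bar> \<le> K1 * (2 * e + \<bar>E - F\<bar> powr p) powr (a / p)"
        using P.exponent_diff_le_cost[OF w cost] by (simp add: lA lB K1_def a_def)
      also have "\<dots> \<le> K * (2 * e + \<bar>E - F\<bar> powr p) powr (a / p)"
        by (intro mult_right_mono) (auto simp: K_def)
      also have "\<dots> \<le> K * (3 powr (a / p) * e powr a)" using pw K by (rule mult_left_mono)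
      also have "\<dots> \<le> K' * e powr a" using mult_right_mono[OF K'(2), of "e powr a"] by (simp add: mult.assoc)
      finally show ?thesis .
    qed
    consider "D = 0" | "0 < D" "D \<le> 1" | "1 < D" using D0 by linarith
    then show ?thesis
    proof cases
      case 1
      have "\<bar>lyapunov \<mu> E - lyapunov \<nu> F\<bar> \<le> 0"
        using a(1) K'(3) small 1 by (intro zero_of_small_powr_bounds[of a K']) auto
      then show ?thesis using 1 by (simp add: D_def)
    next
      case 2
      then show ?thesis using small[of D] by (simp add: D_def)
    next
      case 3
      have "\<bar>lyapunov \<mu> E - lyapunov \<nu> F\<bar> \<le> 2 * K" using bdd by linarith
      also have "\<dots> \<le> K' * 1" using K' by simp
      also have "\<dots> \<le> K' * D powr a" using 3 a K' by (intro mult_left_mono ge_one_powr_ge_zero) auto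
      finally show ?thesis by (simp add: D_def)
    qed
  qed
  have hoelder: "\<forall>y\<in>Lp_measures p C \<times> UNIV. \<forall>z\<in>Lp_measures p C \<times> UNIV. ?d x y < r \<longrightarrow> ?d x z < r \<longrightarrow>
      \<bar>(case y of (\<mu>, E) \<Rightarrow> lyapunov \<mu> E) - (case z of (\<mu>, E) \<Rightarrow> lyapunov \<mu> E)\<bar> \<le> K' * ?d y z powr a"
    using main by auto
  show "\<exists>r>0. \<exists>\<alpha>>0. \<exists>K. \<alpha> \<le> 1 \<and>
      (\<forall>y\<in>Lp_measures p C \<times> UNIV. \<forall>z\<in>Lp_measures p C \<times> UNIV. ?d x y < r \<longrightarrow> ?d x z < r \<longrightarrow>
        \<bar>(case y of (\<mu>, E) \<Rightarrow> lyapunov \<mu> E) - (case z of (\<mu>, E) \<Rightarrow> lyapunov \<mu> E)\<bar> \<le> K * ?d y z powr \<alpha>)"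
    by (rule exI[of _ r], rule conjI[OF r(1)], rule exI[of _ a], rule conjI[OF a(1)],
        rule exI[of _ K'], rule conjI[OF a(2) hoelder])
qed

end
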